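(* Let $d\ge 1$, let $\Delta=\{\vec\delta_j\}_{j=1}^L\subset\mathbb{T}^d$ and $P=\{\vec p_k\}_{k=1}^N\subset\mathbb{Z}^d$ be finite sets with $L=|\Delta|$ and $N=|P|$. Let $\mathcal{B}(\Delta)$, $T(P)$ and the $L\times N$ matrix $\boldsymbol{\Gamma}(\Delta,P)$ be as defined in the context. (a) Assume $L\ge N$. The following are equivalent: (i) $\mathcal{B}(\Delta)$ is a frame for $L^2(T(P))$; (ii) $\boldsymbol{\Gamma}(\Delta,P)$ has rank $N$; (iii) the rows of $\boldsymbol{\Gamma}(\Delta,P)$ form a frame for $\mathbb{C}^N$. If any of these equivalent statements hold, the optimal frame constants of $\mathcal{B}(\Delta)$ for $L^2(T(P))$ are $\sigma_1^2(\boldsymbol{\Gamma}(\Delta,P))$ (upper) and $\sigma_N^2(\boldsymbol{\Gamma}(\Delta,P))$ (lower). (b) Assume $L\le N$. The following are equivalent: (i) $\mathcal{B}(\Delta)$ is a Riesz sequence in $L^2(T(P))$; (ii) $\boldsymbol{\Gamma}(\Delta,P)$ has rank $L$; (iii) the rows of $\boldsymbol{\Gamma}(\Delta,P)$ are linearly independent. If any of these equivalent statements hold, the optimal Riesz sequence constants of $\mathcal{B}(\Delta)$ in $L^2(T(P))$ are $\sigma_1^2(\boldsymbol{\Gamma}(\Delta,P))$ (upper) and $\sigma_L^2(\boldsymbol{\Gamma}(\Delta,P))$ (lower).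
   Context: $\mathbb{T}^d=(\mathbb{R}/\mathbb{Z})^d$ and $Q=[0,1)^d$. The $\vec\delta_j$ are distinct elements of $\mathbb{T}^d$ (identified with representatives in $\mathbb{R}^d$), and the $\vec p_k$ are distinct elements of $\mathbb{Z}^d$. Define $$\mathcal{B}(\Delta)=\bigcup_{j=1}^L\{e^{2\pi i(\vec n+\vec\delta_j)\cdot x}\}_{\vec n\in\mathbb{Z}^d},\qquad T(P)=\bigcup_{k=1}^N(Q+\vec p_k),\qquad \boldsymbol{\Gamma}(\Delta,P)=\big[e^{2\pi i\vec\delta_j\cdot\vec p_k}\big]_{1\le j\le L,\,1\le k\le N}.$$ For a matrix, $\sigma_1\ge\sigma_2\ge\cdots$ denote its singular values. In a separable Hilbert space $H$, a family $\{v_j\}$ is a Riesz sequence with constants $A,B>0$ if $A\sum_{j\in J}|a_j|^2\le\|\sum_{j\in J}a_jv_j\|_H^2\le B\sum_{j\in J}|a_j|^2$ for all finite families of scalars $\{a_j\}_{j\in J}\subset\mathbb{C}$; it is a frame with constants $A,B>0$ if $A\|w\|_H^2\le\sum_j|\langle w,v_j\rangle_H|^2\le B\|w\|_H^2$ for all $w\in H$. The optimal constants are the largest $A$ and the smallest $B$ for which the respective inequalities hold. *)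

theory Defs
  imports "HOL-Analysis.Analysis" "HOL-Library.Multiset"
begin

text \<open>
  A Hilbert space is passed to the frame predicates as a carrier \<open>H\<close> with an inner product \<open>ip\<close>,
  linear in its first argument, so that the squared norm of \<open>w\<close> is \<open>Re (ip w w)\<close>.
  The sum of the squared coefficients is taken in the extended nonnegative reals, where a
  divergent sum has the value infinity and so violates every upper bound.
\<close>

definition frame_lower_bound :: "'h set \<Rightarrow> ('h \<Rightarrow> 'h \<Rightarrow> complex) \<Rightarrow> ('i \<Rightarrow> 'h) \<Rightarrow> real \<Rightarrow> bool" where
  "frame_lower_bound H ip v A \<longleftrightarrow>
     (\<forall>w\<in>H. ennreal (A * Re (ip w w)) \<le> (\<Sum>\<^sub>\<infinity>j. ennreal ((cmod (ip w (v j)))\<^sup>2)))"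

definition frame_upper_bound :: "'h set \<Rightarrow> ('h \<Rightarrow> 'h \<Rightarrow> complex) \<Rightarrow> ('i \<Rightarrow> 'h) \<Rightarrow> real \<Rightarrow> bool" where
  "frame_upper_bound H ip v B \<longleftrightarrow>
     (\<forall>w\<in>H. (\<Sum>\<^sub>\<infinity>j. ennreal ((cmod (ip w (v j)))\<^sup>2)) \<le> ennreal (B * Re (ip w w)))"

definition frame_constants ::
    "'h set \<Rightarrow> ('h \<Rightarrow> 'h \<Rightarrow> complex) \<Rightarrow> ('i \<Rightarrow> 'h) \<Rightarrow> real \<Rightarrow> real \<Rightarrow> bool" where
  "frame_constants H ip v A B \<longleftrightarrow> range v \<subseteq> H \<and> 0 < A \<and> 0 < B \<and>
     frame_lower_bound H ip v A \<and> frame_upper_bound H ip v B"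

definition is_frame :: "'h set \<Rightarrow> ('h \<Rightarrow> 'h \<Rightarrow> complex) \<Rightarrow> ('i \<Rightarrow> 'h) \<Rightarrow> bool" where
  "is_frame H ip v \<longleftrightarrow> (\<exists>A B. frame_constants H ip v A B)"

definition optimal_frame_constants ::
    "'h set \<Rightarrow> ('h \<Rightarrow> 'h \<Rightarrow> complex) \<Rightarrow> ('i \<Rightarrow> 'h) \<Rightarrow> real \<Rightarrow> real \<Rightarrow> bool" where
  "optimal_frame_constants H ip v A B \<longleftrightarrow> frame_constants H ip v A B \<and>
     (\<forall>A'>0. frame_lower_bound H ip v A' \<longrightarrow> A' \<le> A) \<and>
     (\<forall>B'>0. frame_upper_bound H ip v B' \<longrightarrow> B \<le> B')"

text \<open>Elements of \<open>L\<^sup>2(M)\<close> are represented by functions, without passing to classes modulo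
  almost everywhere equality; all notions below are invariant under that equality.\<close>

definition L2_space :: "'a measure \<Rightarrow> ('a \<Rightarrow> complex) set" where
  "L2_space M = {f \<in> borel_measurable M. integrable M (\<lambda>x. (cmod (f x))\<^sup>2)}"

definition L2_inner :: "'a measure \<Rightarrow> ('a \<Rightarrow> complex) \<Rightarrow> ('a \<Rightarrow> complex) \<Rightarrow> complex" where
  "L2_inner M f g = (LINT x|M. f x * cnj (g x))"

definition L2_norm_sq :: "'a measure \<Rightarrow> ('a \<Rightarrow> complex) \<Rightarrow> real" where
  "L2_norm_sq M f = (LINT x|M. (cmod (f x))\<^sup>2)"

definition riesz_lower_bound :: "'a measure \<Rightarrow> ('i \<Rightarrow> 'a \<Rightarrow> complex) \<Rightarrow> real \<Rightarrow> bool" where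
  "riesz_lower_bound M v A \<longleftrightarrow>
     (\<forall>J a. finite J \<longrightarrow>
        A * (\<Sum>j\<in>J. (cmod (a j))\<^sup>2) \<le> L2_norm_sq M (\<lambda>x. \<Sum>j\<in>J. a j * v j x))"

definition riesz_upper_bound :: "'a measure \<Rightarrow> ('i \<Rightarrow> 'a \<Rightarrow> complex) \<Rightarrow> real \<Rightarrow> bool" where
  "riesz_upper_bound M v B \<longleftrightarrow>
     (\<forall>J a. finite J \<longrightarrow>
        L2_norm_sq M (\<lambda>x. \<Sum>j\<in>J. a j * v j x) \<le> B * (\<Sum>j\<in>J. (cmod (a j))\<^sup>2))"

definition riesz_constants ::
    "'a measure \<Rightarrow> ('i \<Rightarrow> 'a \<Rightarrow> complex) \<Rightarrow> real \<Rightarrow> real \<Rightarrow> bool" where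
  "riesz_constants M v A B \<longleftrightarrow> range v \<subseteq> L2_space M \<and> 0 < A \<and> 0 < B \<and>
     riesz_lower_bound M v A \<and> riesz_upper_bound M v B"

definition is_riesz_sequence :: "'a measure \<Rightarrow> ('i \<Rightarrow> 'a \<Rightarrow> complex) \<Rightarrow> bool" where
  "is_riesz_sequence M v \<longleftrightarrow> (\<exists>A B. riesz_constants M v A B)"

definition optimal_riesz_constants ::
    "'a measure \<Rightarrow> ('i \<Rightarrow> 'a \<Rightarrow> complex) \<Rightarrow> real \<Rightarrow> real \<Rightarrow> bool" where
  "optimal_riesz_constants M v A B \<longleftrightarrow> riesz_constants M v A B \<and>
     (\<forall>A'>0. riesz_lower_bound M v A' \<longrightarrow> A' \<le> A) \<and>
     (\<forall>B'>0. riesz_upper_bound M v B' \<longrightarrow> B \<le> B')"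

definition cvec_inner :: "complex^'n \<Rightarrow> complex^'n \<Rightarrow> complex" where
  "cvec_inner w v = (\<Sum>i\<in>UNIV. w $ i * cnj (v $ i))"

definition conj_transpose :: "complex^'n^'m \<Rightarrow> complex^'m^'n" where
  "conj_transpose A = (\<chi> i j. cnj (A $ j $ i))"

definition gram_eigenspace :: "complex^'n^'m \<Rightarrow> real \<Rightarrow> (complex^'n) set" where
  "gram_eigenspace A t =
     {v. (conj_transpose A ** A) *v v = complex_of_real t *s v}"

text \<open>
  The singular values are the nonnegative square roots of the eigenvalues of \<open>A\<^sup>*A\<close>, listed in
  decreasing order. As \<open>A\<^sup>*A\<close> is Hermitian, the multiplicity of an eigenvalue is the dimension
  of its eigenspace. An \<open>m\<close> by \<open>n\<close> matrix thus gets \<open>n\<close> singular values; for \<open>m < n\<close> the last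
  \<open>n - m\<close> of them are the trivial zeros.
\<close>

definition singular_values :: "complex^'n^'m \<Rightarrow> real list" where
  "singular_values A = rev (sorted_list_of_multiset
     (\<Sum>s\<in>{s. 0 \<le> s \<and> (\<exists>v\<in>gram_eigenspace A (s\<^sup>2). v \<noteq> 0)}.
        replicate_mset (vec.dim (gram_eigenspace A (s\<^sup>2))) s))"

definition singular_value :: "nat \<Rightarrow> complex^'n^'m \<Rightarrow> real" where
  "singular_value k A = singular_values A ! (k - 1)"  \<comment> \<open>numbered from 1\<close>

definition int_vec :: "int^'d \<Rightarrow> real^'d" where
  "int_vec n = (\<chi> i. real_of_int (n $ i))"

definition unit_cube :: "(real^'d) set" where
  "unit_cube = {x. \<forall>i. 0 \<le> x $ i \<and> x $ i < 1}"

definition multi_tile :: "('n \<Rightarrow> int^'d) \<Rightarrow> (real^'d) set" where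
  "multi_tile p = (\<Union>k. (\<lambda>x. x + int_vec (p k)) ` unit_cube)"

definition character :: "real^'d \<Rightarrow> real^'d \<Rightarrow> complex" where
  "character \<xi> x = exp (2 * complex_of_real pi * \<i> * complex_of_real (\<xi> \<bullet> x))"

definition exp_system :: "('l \<Rightarrow> real^'d) \<Rightarrow> 'l \<times> (int^'d) \<Rightarrow> real^'d \<Rightarrow> complex" where
  "exp_system \<delta> = (\<lambda>(j, n). character (int_vec n + \<delta> j))"

definition Gamma_matrix ::
    "('l::finite \<Rightarrow> real^'d) \<Rightarrow> ('n::finite \<Rightarrow> int^'d) \<Rightarrow> complex^'n^'l" where
  "Gamma_matrix \<delta> p = (\<chi> j k. character (\<delta> j) (int_vec (p k)))"

text \<open>Points of the torus are given by representatives; distinct points have representatives that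
  do not differ by an integer vector.\<close>

definition distinct_mod_lattice :: "('l \<Rightarrow> real^'d) \<Rightarrow> bool" where
  "distinct_mod_lattice \<delta> \<longleftrightarrow> (\<forall>i j. i \<noteq> j \<longrightarrow> \<delta> i - \<delta> j \<notin> range int_vec)"

text \<open>Independence of the rows as a family: a repeated row counts as a dependence.\<close>

definition rows_independent :: "complex^'n^'l \<Rightarrow> bool" where
  "rows_independent A \<longleftrightarrow> inj (\<lambda>j. row j A) \<and> vec.independent (rows A)"

end

theory Submission
  imports Defs
begin

text \<open>
  The whole statement reduces to finite linear algebra, because both inequalities can be tested
  fibre by fibre. Write \<open>\<Gamma>\<close> for the matrix and \<open>Q\<close> for the unit cube. As integer characters are
  invariant under integer shifts, on the tile \<open>Q + p\<^sub>k\<close> the exponential with index \<open>(j, n)\<close> equals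
  \<open>\<Gamma>\<^sub>j\<^sub>k\<close> times \<open>exp (2 \<pi> i (n + \<delta>\<^sub>j) \<cdot> x)\<close>, where \<open>x\<close> runs over \<open>Q\<close>
  (\<open>exp_system_on_tile\<close>).

  For frames, collect the values of \<open>f\<close> at the points \<open>x + p\<^sub>k\<close> (conjugated) in the vector
  \<open>F(x)\<close>, with one entry for each tile. The coefficients of \<open>f\<close> against the exponentials of index
  \<open>(j, n)\<close>, for a fixed \<open>j\<close>, are the Fourier coefficients on \<open>Q\<close> of a function with the modulus
  of \<open>(\<Gamma> F(x))\<^sub>j\<close>. By Parseval the sum of all squared coefficients is the integral of
  \<open>\<parallel>\<Gamma> F(x)\<parallel>\<^sup>2\<close> over \<open>Q\<close> (\<open>frame_coefficients_sum\<close>), while the squared norm of \<open>f\<close> is the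
  integral of \<open>\<parallel>F(x)\<parallel>\<^sup>2\<close>. So a frame bound for the exponentials is the same as a bound between
  \<open>\<parallel>\<Gamma> w\<parallel>\<^sup>2\<close> and \<open>\<parallel>w\<parallel>\<^sup>2\<close> for all vectors \<open>w\<close>: integrate in one direction, and take a function
  with constant fibre \<open>w\<close> in the other.

  For Riesz bounds the picture is dual. A finite combination of the exponentials has the squared
  norm given by the integral of \<open>\<parallel>\<Gamma>\<^sup>* H(x)\<parallel>\<^sup>2\<close>, where \<open>H\<close> has twisted trigonometric polynomials as
  conjugated entries, and the integral of \<open>\<parallel>H(x)\<parallel>\<^sup>2\<close> is the sum of the squared coefficients
  (\<open>synthesis_norm_sq\<close>, \<open>coefficient_fiber_norm_sq\<close>). Here a constant \<open>H\<close> is in general not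
  available, but it is a limit of admissible ones (\<open>riesz_test_combination\<close>), which is enough as all
  inequalities are closed.

  What remains is that the best constants in these inequalities are squares of singular values.
  The definition of the singular values counts eigenvalues of \<open>\<Gamma>\<^sup>* \<Gamma>\<close> with the dimensions of
  the eigenspaces, so the spectral theorem is needed (\<open>gram_eigenbasis_exists\<close>): with an
  orthonormal eigenbasis \<open>B\<close> the singular values are just the sorted numbers \<open>\<parallel>\<Gamma> b\<parallel>\<close>. Parseval on
  the cube rests on the density of trigonometric polynomials, which comes from the
  Stone-Weierstrass theorem on the torus (\<open>L2_cube_approximable\<close>).
\<close>

section \<open>The Hermitian inner product\<close>

lemma cvec_inner_add_left: "cvec_inner (x + y) z = cvec_inner x z + cvec_inner y z"
  by (simp add: cvec_inner_def distrib_right sum.distrib)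

lemma cvec_inner_diff_left: "cvec_inner (x - y) z = cvec_inner x z - cvec_inner y z"
  by (simp add: cvec_inner_def left_diff_distrib sum_subtractf)

lemma cvec_inner_scale_left: "cvec_inner (c *s x) z = c * cvec_inner x z"
  by (simp add: cvec_inner_def sum_distrib_left mult.assoc)

lemma cvec_inner_zero_left [simp]: "cvec_inner 0 z = 0"
  by (simp add: cvec_inner_def)

lemma cvec_inner_sum_left: "cvec_inner (\<Sum>i\<in>I. f i) z = (\<Sum>i\<in>I. cvec_inner (f i) z)"
  by (induction I rule: infinite_finite_induct) (simp_all add: cvec_inner_add_left)

lemma cvec_inner_commute: "cvec_inner x y = cnj (cvec_inner y x)"
  by (simp add: cvec_inner_def mult.commute)

lemma cvec_inner_scale_right: "cvec_inner x (c *s y) = cnj c * cvec_inner x y"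
  by (metis cvec_inner_commute cvec_inner_scale_left complex_cnj_mult)

lemma cvec_inner_sum_right: "cvec_inner z (\<Sum>i\<in>I. f i) = (\<Sum>i\<in>I. cvec_inner z (f i))"
  by (subst cvec_inner_commute, subst cvec_inner_sum_left, simp add: cvec_inner_commute[of z])

lemma norm_vec_power2: "(norm x)\<^sup>2 = (\<Sum>i\<in>UNIV. (cmod (x $ i))\<^sup>2)"
  for x :: "complex^'n"
  by (simp add: norm_vec_def L2_set_def sum_nonneg)

lemma cvec_inner_self: "cvec_inner x x = complex_of_real ((norm x)\<^sup>2)"
  by (simp add: cvec_inner_def norm_vec_power2 flip: complex_norm_square)

lemma Re_cvec_inner: "Re (cvec_inner x y) = x \<bullet> y"
  by (simp add: cvec_inner_def inner_vec_def inner_complex_def)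

lemma norm_complex_scale: "norm (c *s x) = cmod c * norm x" for x :: "complex^'n"
proof -
  have "(norm (c *s x))\<^sup>2 = (cmod c * norm x)\<^sup>2"
    by (simp add: norm_vec_power2 norm_mult power_mult_distrib sum_distrib_left)
  then show ?thesis by (simp add: power2_eq_iff_nonneg)
qed

lemma of_real_scale: "complex_of_real r *s x = r *\<^sub>R x"
  by (simp add: vec_eq_iff) (simp add: scaleR_conv_of_real)

lemma cvec_inner_adjoint:
  "cvec_inner (A *v x) y = cvec_inner x (conj_transpose A *v y)"
proof -
  have "cvec_inner (A *v x) y = (\<Sum>i\<in>UNIV. \<Sum>k\<in>UNIV. A $ i $ k * x $ k * cnj (y $ i))"
    by (simp add: cvec_inner_def matrix_vector_mult_def sum_distrib_right)
  also have "\<dots> = (\<Sum>k\<in>UNIV. \<Sum>i\<in>UNIV. A $ i $ k * x $ k * cnj (y $ i))"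
    by (rule sum.swap)
  also have "\<dots> = cvec_inner x (conj_transpose A *v y)"
    by (simp add: cvec_inner_def matrix_vector_mult_def conj_transpose_def sum_distrib_left mult_ac)
  finally show ?thesis .
qed

lemma conj_transpose_twice: "conj_transpose (conj_transpose A) = A"
  by (simp add: conj_transpose_def vec_eq_iff)

lemma cvec_inner_gram:
  "cvec_inner ((conj_transpose A ** A) *v x) y = cvec_inner (A *v x) (A *v y)"
  by (metis cvec_inner_adjoint conj_transpose_twice matrix_vector_mul_assoc)

definition orthonormal :: "(complex^'n) set \<Rightarrow> bool" where
  "orthonormal B \<longleftrightarrow> (\<forall>b\<in>B. \<forall>c\<in>B. cvec_inner b c = (if b = c then 1 else 0))"

lemma orthonormal_norm: "orthonormal B \<Longrightarrow> b \<in> B \<Longrightarrow> norm b = 1"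
proof -
  assume "orthonormal B" "b \<in> B"
  then have "complex_of_real ((norm b)\<^sup>2) = 1"
    using cvec_inner_self[of b] by (simp add: orthonormal_def)
  then have "(norm b)\<^sup>2 = 1" by (metis of_real_eq_1_iff)
  then show ?thesis by (simp add: power2_eq_1_iff) (metis norm_ge_zero neg_0_le_iff_le not_one_le_zero)
qed

text \<open>
  Pairing a vanishing combination with one of its vectors isolates the coefficient of that vector.
\<close>

lemma orthogonal_independent:
  fixes B :: "(complex^'n) set"
  assumes "\<And>b c. b \<in> B \<Longrightarrow> c \<in> B \<Longrightarrow> b \<noteq> c \<Longrightarrow> cvec_inner b c = 0" and "0 \<notin> B"
  shows "vec.independent B"
  unfolding vec.independent_explicit_module
proof (intro allI impI)
  fix t u v assume t: "finite t" "t \<subseteq> B" "(\<Sum>v\<in>t. u v *s v) = 0" "v \<in> t"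
  have "0 = cvec_inner (\<Sum>v\<in>t. u v *s v) v" by (simp add: t)
  also have "\<dots> = (\<Sum>w\<in>t. u w * cvec_inner w v)"
    by (simp add: cvec_inner_sum_left cvec_inner_scale_left)
  also have "\<dots> = (\<Sum>w\<in>t. if w = v then u v * cvec_inner v v else 0)"
    using t assms(1) by (intro sum.cong) auto
  also have "\<dots> = u v * complex_of_real ((norm v)\<^sup>2)"
    using t by (simp add: cvec_inner_self)
  finally show "u v = 0" using assms(2) t by auto
qed

lemma orthonormal_independent: "orthonormal B \<Longrightarrow> vec.independent B"
  using orthonormal_norm[of B 0] by (intro orthogonal_independent) (auto simp: orthonormal_def)

lemma orthonormal_finite:
  fixes B :: "(complex^'n) set"
  assumes "orthonormal B" shows "finite B" "card B \<le> CARD('n)"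
proof -
  have "vec.independent B" using assms by (rule orthonormal_independent)
  then show "finite B" "card B \<le> CARD('n)"
    using vec.independent_bound_general[of B] vec.dim_subset[of B UNIV]
    unfolding vec_dim_card by auto
qed


section \<open>Full rank\<close>

lemma rank_eq_columns_iff:
  fixes A :: "'a::field^'n^'m"
  shows "rank A = CARD('n) \<longleftrightarrow> (\<forall>v. A *v v = 0 \<longrightarrow> v = 0)"
proof -
  have "rank A = CARD('n) \<longleftrightarrow> vec.dim (rows A) = vec.dim (UNIV :: ('a^'n) set)"
    by (simp only: row_rank_def_gen vec_dim_card)
  also have "\<dots> \<longleftrightarrow> vec.span (rows A) = UNIV"
    using vec.dim_eq_full[of "rows A"] by (simp add: vec.dimension_def)
  also have "\<dots> \<longleftrightarrow> (\<forall>v. A *v v = 0 \<longrightarrow> v = 0)"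
    by (metis matrix_left_invertible_span_rows_gen matrix_left_invertible_ker)
  finally show ?thesis .
qed

lemma rank_eq_rows_iff:
  fixes A :: "complex^'n^'m"
  shows "rank A = CARD('m) \<longleftrightarrow> rows_independent A"
proof -
  have rows: "rows A = range (\<lambda>j. row j A)" by (auto simp: rows_def)
  then have fin: "finite (rows A)" by simp
  show ?thesis
  proof
    assume "rank A = CARD('m)"
    then have dim: "vec.dim (rows A) = CARD('m)" by (simp add: row_rank_def_gen)
    have "CARD('m) \<le> card (rows A)" using vec.dim_le_card'[OF fin] dim by simp
    moreover have "card (rows A) \<le> CARD('m)" unfolding rows by (rule card_image_le) simp
    ultimately have card: "card (rows A) = CARD('m)" by simp
    then have "inj (\<lambda>j. row j A)" unfolding rows by (intro eq_card_imp_inj_on) auto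
    moreover have "vec.independent (rows A)"
      using card dim fin vec.span_superset by (intro vec.card_le_dim_spanning[of _ "rows A"]) auto
    ultimately show "rows_independent A" by (simp add: rows_independent_def)
  next
    assume ind: "rows_independent A"
    then have "vec.dim (rows A) = card (rows A)"
      by (simp add: rows_independent_def vec.dim_eq_card_independent)
    also have "\<dots> = CARD('m)"
      using ind unfolding rows rows_independent_def by (simp add: card_image)
    finally show "rank A = CARD('m)" by (simp add: row_rank_def_gen)
  qed
qed

text \<open>
  Independence of the rows as an indexed family: the injectivity in the definition is what makes
  coefficients of the set of rows and coefficients of the index set interchangeable.
\<close>

lemma rows_independent_iff:
  fixes A :: "complex^'n^'m"
  shows "rows_independent A \<longleftrightarrow> (\<forall>c. (\<Sum>i\<in>UNIV. c i *s row i A) = 0 \<longrightarrow> (\<forall>i. c i = 0))"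
proof
  have rows: "rows A = range (\<lambda>j. row j A)" by (auto simp: rows_def)
  then have fin: "finite (rows A)" by simp
  have reindex: "(\<Sum>r\<in>rows A. u r *s r) = (\<Sum>i\<in>UNIV. u (row i A) *s row i A)"
    if "inj (\<lambda>j. row j A)" for u
    unfolding rows by (subst sum.reindex[OF that]) simp
  show "\<forall>c. (\<Sum>i\<in>UNIV. c i *s row i A) = 0 \<longrightarrow> (\<forall>i. c i = 0)" if ind: "rows_independent A"
  proof (intro allI impI)
    fix c i assume c: "(\<Sum>i\<in>UNIV. c i *s row i A) = 0"
    have inj: "inj (\<lambda>j. row j A)" using ind by (simp add: rows_independent_def)
    define u where "u r = c (inv (\<lambda>j. row j A) r)" for r
    have u: "u (row j A) = c j" for j using inv_f_f[OF inj, of j] by (simp add: u_def)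
    have "(\<Sum>r\<in>rows A. u r *s r) = 0" using c by (simp add: reindex[OF inj] u)
    moreover have "row i A \<in> rows A" by (simp add: rows)
    ultimately have "u (row i A) = 0"
      using ind fin unfolding rows_independent_def vec.dependent_finite[OF fin] by blast
    then show "c i = 0" by (simp add: u)
  qed
  assume zero: "\<forall>c. (\<Sum>i\<in>UNIV. c i *s row i A) = 0 \<longrightarrow> (\<forall>i. c i = 0)"
  have inj: "inj (\<lambda>j. row j A)"
  proof (rule injI, rule ccontr)
    fix i j assume eq: "row i A = row j A" and "i \<noteq> j"
    define c where "c k = (if k = i then 1 else if k = j then - 1 else 0 :: complex)" for k
    have "(\<Sum>k\<in>UNIV. c k *s row k A) = (\<Sum>k\<in>{i, j}. c k *s row k A)"
      by (intro sum.mono_neutral_right) (auto simp: c_def)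
    then have "(\<Sum>k\<in>UNIV. c k *s row k A) = 0" using \<open>i \<noteq> j\<close> eq by (simp add: c_def)
    then have "c i = 0" using zero by blast
    then show False by (simp add: c_def)
  qed
  have "vec.independent (rows A)"
    unfolding vec.dependent_finite[OF fin]
  proof clarify
    fix u r assume r: "r \<in> rows A" "u r \<noteq> 0" and sum: "(\<Sum>v\<in>rows A. u v *s v) = 0"
    from r(1) obtain i where "r = row i A" by (auto simp: rows)
    moreover have "\<forall>i. u (row i A) = 0"
      using zero[rule_format, of "\<lambda>i. u (row i A)"] sum by (simp add: reindex[OF inj])
    ultimately show False using r(2) by simp
  qed
  then show "rows_independent A" using inj by (simp add: rows_independent_def)
qed

lemma rows_independent_surj:
  fixes A :: "complex^'n^'m"
  assumes "rows_independent A" shows "\<exists>w. h = A *v w"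
proof -
  have "\<exists>B. A ** B = mat 1"
    using assms by (subst matrix_right_invertible_independent_rows) (simp add: rows_independent_iff)
  then obtain B where "A ** B = mat 1" by blast
  then have "A *v (B *v h) = h" by (simp add: matrix_vector_mul_assoc)
  then show ?thesis by metis
qed

section \<open>Orthonormal eigenbases and singular values\<close>

text \<open>
  The complement of a set of eigenvectors of \<open>A\<^sup>* A\<close> is invariant, so a maximiser \<open>u\<close> of
  \<open>\<parallel>A u\<parallel>\<close> on its unit sphere is again an eigenvector: the maximum value \<open>t\<close> of \<open>\<parallel>A u\<parallel>\<^sup>2\<close> bounds
  \<open>\<parallel>A (u + s w)\<parallel>\<^sup>2\<close> by \<open>t \<parallel>u + s w\<parallel>\<^sup>2\<close> for all real \<open>s\<close>. For the defect
  \<open>w = A\<^sup>* A u - t u\<close> the linear coefficients of the two sides differ by \<open>2 \<parallel>w\<parallel>\<^sup>2\<close>, which must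
  therefore vanish.
\<close>

lemma gram_eigenvector_in_complement:
  fixes A :: "complex^'n^'m" and B :: "(complex^'n) set"
  assumes eig: "\<And>b. b \<in> B \<Longrightarrow> \<exists>t. (conj_transpose A ** A) *v b = complex_of_real t *s b"
    and v: "\<And>b. b \<in> B \<Longrightarrow> cvec_inner v b = 0" "v \<noteq> 0"
  obtains u t where "norm u = 1" "\<And>b. b \<in> B \<Longrightarrow> cvec_inner u b = 0"
    "(conj_transpose A ** A) *v u = complex_of_real t *s u"
proof -
  let ?G = "conj_transpose A ** A"
  define W where "W = {w. \<forall>b\<in>B. cvec_inner w b = 0}"
  have W_scaleR: "r *\<^sub>R w \<in> W" if "w \<in> W" for r w
    using that by (simp add: W_def cvec_inner_scale_left flip: of_real_scale)
  have W_add: "w + w' \<in> W" if "w \<in> W" "w' \<in> W" for w w'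
    using that by (simp add: W_def cvec_inner_add_left)
  have W_gram: "?G *v w \<in> W" if "w \<in> W" for w
  proof -
    have "cvec_inner (?G *v w) b = 0" if b: "b \<in> B" for b
    proof -
      obtain t where t: "?G *v b = complex_of_real t *s b" using eig[OF b] by blast
      have "cvec_inner (?G *v w) b = cvec_inner w (?G *v b)"
        by (metis cvec_inner_gram cvec_inner_commute)
      then show ?thesis using \<open>w \<in> W\<close> b by (simp add: t cvec_inner_scale_right W_def)
    qed
    then show ?thesis by (simp add: W_def)
  qed
  have "W = (\<Inter>b\<in>B. {w. cvec_inner w b = 0})" by (auto simp: W_def)
  moreover have "closed {w. cvec_inner w b = 0}" for b :: "complex^'n"
    unfolding cvec_inner_def by (intro closed_Collect_eq continuous_intros)
  ultimately have "closed W" by auto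
  then have "compact (sphere 0 1 \<inter> W)" by (intro compact_Int_closed) auto
  moreover have "sphere 0 1 \<inter> W \<noteq> {}"
  proof -
    have "v \<in> W" using v by (simp add: W_def)
    then have "(1 / norm v) *\<^sub>R v \<in> sphere 0 1 \<inter> W"
      using v by (auto intro: W_scaleR)
    then show ?thesis by blast
  qed
  moreover have "continuous_on (sphere 0 1 \<inter> W) (\<lambda>w. norm (A *v w))"
    unfolding matrix_vector_mult_def by (intro continuous_intros)
  ultimately obtain u where u: "u \<in> sphere 0 1 \<inter> W"
    and max: "\<And>w. w \<in> sphere 0 1 \<inter> W \<Longrightarrow> norm (A *v w) \<le> norm (A *v u)"
    using continuous_attains_sup by metis
  define t where "t = (norm (A *v u))\<^sup>2"
  have A_scaleR: "A *v (r *\<^sub>R w) = r *\<^sub>R (A *v w)" for r w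
    by (metis of_real_scale vec.scale)
  have le: "(norm (A *v w))\<^sup>2 \<le> t * (norm w)\<^sup>2" if "w \<in> W" for w
  proof (cases "w = 0")
    case False
    have "norm (A *v ((1 / norm w) *\<^sub>R w)) \<le> norm (A *v u)"
      using False that by (intro max) (auto intro: W_scaleR)
    then have "norm (A *v w) \<le> norm (A *v u) * norm w"
      using False by (simp add: A_scaleR field_simps)
    then show ?thesis unfolding t_def
      by (metis norm_ge_zero power_mono power_mult_distrib)
  qed auto
  define w where "w = ?G *v u - t *\<^sub>R u"
  have "w = ?G *v u + (- t) *\<^sub>R u" by (simp add: w_def)
  then have wW: "w \<in> W" using u by (auto intro!: W_add W_gram W_scaleR simp del: scaleR_minus_left)
  have key: "s * (2 * (norm w)\<^sup>2) \<le> s\<^sup>2 * (t * (norm w)\<^sup>2)" for s :: real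
  proof -
    have 1: "(norm (A *v (u + s *\<^sub>R w)))\<^sup>2 = t + 2 * s * ((A *v u) \<bullet> (A *v w)) + s\<^sup>2 * (norm (A *v w))\<^sup>2"
      unfolding vec.add A_scaleR t_def power2_norm_eq_inner
      by (simp add: inner_add_left inner_add_right inner_commute power2_eq_square)
    have "u \<bullet> u = 1" using u by (simp add: norm_eq_1)
    then have 2: "(norm (u + s *\<^sub>R w))\<^sup>2 = 1 + 2 * s * (u \<bullet> w) + s\<^sup>2 * (norm w)\<^sup>2"
      unfolding power2_norm_eq_inner
      by (simp add: inner_add_left inner_add_right inner_commute power2_eq_square)
    have 3: "(norm (A *v (u + s *\<^sub>R w)))\<^sup>2 \<le> t * (norm (u + s *\<^sub>R w))\<^sup>2"
      using u wW by (intro le W_add W_scaleR) auto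
    have 4: "(A *v u) \<bullet> (A *v w) = (?G *v u) \<bullet> w"
      by (simp add: cvec_inner_gram flip: Re_cvec_inner)
    have 5: "(norm w)\<^sup>2 = (?G *v u) \<bullet> w - t * (u \<bullet> w)"
      unfolding power2_norm_eq_inner by (subst w_def) (simp add: inner_diff_left)
    have "2 * s * ((?G *v u) \<bullet> w - t * (u \<bullet> w)) + s\<^sup>2 * (norm (A *v w))\<^sup>2 \<le> s\<^sup>2 * (t * (norm w)\<^sup>2)"
      using 3 unfolding 1 2 4 by (simp add: algebra_simps)
    moreover have "0 \<le> s\<^sup>2 * (norm (A *v w))\<^sup>2" by simp
    ultimately have "2 * s * (norm w)\<^sup>2 \<le> s\<^sup>2 * (t * (norm w)\<^sup>2)"
      unfolding 5[symmetric] by linarith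
    then show ?thesis by (simp add: mult_ac)
  qed
  have "t \<ge> 0" by (simp add: t_def)
  have "(norm w)\<^sup>2 \<le> 0"
  proof -
    \<comment> \<open>at \<open>s = 1 / (t + 1)\<close> the quadratic term is at most half of the linear one\<close>
    have "(1 / (t + 1)) * (2 * (norm w)\<^sup>2) \<le> (1 / (t + 1))\<^sup>2 * (t * (norm w)\<^sup>2)" by (rule key)
    then have "(1 / (t + 1)) * (2 * (norm w)\<^sup>2) \<le> (1 / (t + 1)) * (t / (t + 1) * (norm w)\<^sup>2)"
      by (simp add: power2_eq_square)
    then have "2 * (norm w)\<^sup>2 \<le> t / (t + 1) * (norm w)\<^sup>2"
      using \<open>t \<ge> 0\<close> by (subst (asm) mult_le_cancel_left_pos) auto
    also have "\<dots> \<le> 1 * (norm w)\<^sup>2"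
      using \<open>t \<ge> 0\<close> by (intro mult_right_mono) auto
    finally show ?thesis by simp
  qed
  then have "w = 0" by simp
  then have "?G *v u = complex_of_real t *s u" by (simp add: w_def of_real_scale)
  then show thesis using that u by (auto simp: W_def)
qed

text \<open>
  The eigenvalue that belongs to a unit eigenvector \<open>b\<close> of \<open>A\<^sup>* A\<close> is \<open>\<parallel>A b\<parallel>\<^sup>2\<close>; writing it in this form
  avoids a separate function for the eigenvalues. The expansion property says that \<open>B\<close> is complete.
\<close>

definition gram_eigenbasis :: "complex^'n^'m \<Rightarrow> (complex^'n) set \<Rightarrow> bool" where
  "gram_eigenbasis A B \<longleftrightarrow> orthonormal B \<and> card B = CARD('n) \<and>
    (\<forall>v. v = (\<Sum>b\<in>B. cvec_inner v b *s b)) \<and>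
    (\<forall>b\<in>B. (conj_transpose A ** A) *v b = complex_of_real ((norm (A *v b))\<^sup>2) *s b)"

lemma gram_eigenbasisD:
  fixes A :: "complex^'n^'m"
  assumes "gram_eigenbasis A B"
  shows "orthonormal B" "finite B" "card B = CARD('n)" "\<And>v. v = (\<Sum>b\<in>B. cvec_inner v b *s b)"
    "\<And>b. b \<in> B \<Longrightarrow> (conj_transpose A ** A) *v b = complex_of_real ((norm (A *v b))\<^sup>2) *s b"
    "\<And>b. b \<in> B \<Longrightarrow> norm b = 1"
  using assms orthonormal_finite[of B] orthonormal_norm[of B]
  unfolding gram_eigenbasis_def by blast+

text \<open>
  The spectral theorem for \<open>A\<^sup>* A\<close>: a largest orthonormal set of eigenvectors is complete, since a
  nonzero vector orthogonal to it would yield one more eigenvector.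
\<close>

lemma gram_eigenbasis_exists:
  fixes A :: "complex^'n^'m"
  obtains B where "gram_eigenbasis A B"
proof -
  let ?G = "conj_transpose A ** A"
  define P where "P B \<longleftrightarrow> orthonormal B \<and> (\<forall>b\<in>B. \<exists>t. ?G *v b = complex_of_real t *s b)" for B
  have "P {}" by (simp add: P_def orthonormal_def)
  moreover have "\<forall>B. P B \<longrightarrow> card B < Suc CARD('n)"
    using orthonormal_finite by (auto simp: P_def less_Suc_eq_le)
  ultimately obtain B where B: "P B" and Bmax: "\<And>C. P C \<Longrightarrow> card C \<le> card B"
    using ex_has_greatest_nat[of P "{}" card "Suc CARD('n)"] by (metis less_imp_le)
  have on: "orthonormal B" using B by (simp add: P_def)
  have fin: "finite B" using on by (rule orthonormal_finite)
  have zero: "v = 0" if v: "\<And>b. b \<in> B \<Longrightarrow> cvec_inner v b = 0" for v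
  proof (rule ccontr)
    assume "v \<noteq> 0"
    obtain u t where u: "norm u = 1" "\<And>b. b \<in> B \<Longrightarrow> cvec_inner u b = 0"
      "?G *v u = complex_of_real t *s u"
      using gram_eigenvector_in_complement[of B A v] B v \<open>v \<noteq> 0\<close> unfolding P_def by metis
    have uu: "cvec_inner u u = 1" using u(1) by (simp add: cvec_inner_self)
    have "cvec_inner b u = 0" if "b \<in> B" for b
      using u(2)[OF that] cvec_inner_commute[of b u] by simp
    then have "P (insert u B)" using B u uu by (auto simp: P_def orthonormal_def)
    then have "card (insert u B) \<le> card B" by (rule Bmax)
    moreover have "u \<notin> B" using u(2)[of u] uu by auto
    ultimately show False using fin by simp
  qed
  have expand: "v = (\<Sum>b\<in>B. cvec_inner v b *s b)" for v
  proof -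
    have "cvec_inner (v - (\<Sum>b\<in>B. cvec_inner v b *s b)) c = 0" if c: "c \<in> B" for c
    proof -
      have "cvec_inner (\<Sum>b\<in>B. cvec_inner v b *s b) c = (\<Sum>b\<in>B. if b = c then cvec_inner v c else 0)"
        unfolding cvec_inner_sum_left cvec_inner_scale_left
        using on c by (intro sum.cong) (auto simp: orthonormal_def)
      then show ?thesis using c fin by (simp add: cvec_inner_diff_left)
    qed
    then have "v - (\<Sum>b\<in>B. cvec_inner v b *s b) = 0" by (rule zero)
    then show ?thesis by simp
  qed
  have "v \<in> vec.span B" for v
    by (subst expand) (intro vec.span_sum vec.span_scale vec.span_base)
  then have "vec.span B = UNIV" by blast
  then have "card B = CARD('n)"
    using vec.dim_span_eq_card_independent[OF orthonormal_independent[OF on]] vec_dim_card by metis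
  moreover have "?G *v b = complex_of_real ((norm (A *v b))\<^sup>2) *s b" if b: "b \<in> B" for b
  proof -
    obtain t where t: "?G *v b = complex_of_real t *s b" using B b by (auto simp: P_def)
    have "complex_of_real ((norm (A *v b))\<^sup>2) = cvec_inner (?G *v b) b"
      by (simp only: cvec_inner_gram cvec_inner_self)
    also have "\<dots> = complex_of_real t"
      using on b by (simp add: t cvec_inner_scale_left orthonormal_def)
    finally show ?thesis by (simp add: t)
  qed
  ultimately show thesis using that[of B] on expand unfolding gram_eigenbasis_def by blast
qed

lemma orthogonal_sum_norm:
  assumes "finite B" "\<And>b c. b \<in> B \<Longrightarrow> c \<in> B \<Longrightarrow> b \<noteq> c \<Longrightarrow> cvec_inner (f b) (f c) = 0"
  shows "(norm (\<Sum>b\<in>B. u b *s f b))\<^sup>2 = (\<Sum>b\<in>B. (cmod (u b))\<^sup>2 * (norm (f b))\<^sup>2)"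
proof -
  have "complex_of_real ((norm (\<Sum>b\<in>B. u b *s f b))\<^sup>2)
      = (\<Sum>b\<in>B. \<Sum>c\<in>B. u b * (cnj (u c) * cvec_inner (f b) (f c)))"
    unfolding cvec_inner_self[symmetric] cvec_inner_sum_left cvec_inner_scale_left
    by (simp add: cvec_inner_sum_right cvec_inner_scale_right sum_distrib_left)
  also have "\<dots> = (\<Sum>b\<in>B. \<Sum>c\<in>B. if c = b then complex_of_real ((cmod (u b))\<^sup>2 * (norm (f b))\<^sup>2) else 0)"
    using assms(2)
    by (intro sum.cong) (auto simp: cvec_inner_self simp flip: complex_norm_square)
  also have "\<dots> = complex_of_real (\<Sum>b\<in>B. (cmod (u b))\<^sup>2 * (norm (f b))\<^sup>2)"
    using assms(1) by simp
  finally show ?thesis unfolding of_real_eq_iff .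
qed

text \<open>
  An eigenvector for \<open>t\<close> is orthogonal to the basis vectors with other eigenvalues, so its expansion
  only uses those with eigenvalue \<open>t\<close>. This gives the dimensions that count as multiplicities.
\<close>

lemma gram_eigenspace_span:
  fixes A :: "complex^'n^'m"
  assumes B: "gram_eigenbasis A B"
  shows "gram_eigenspace A t = vec.span {b\<in>B. (norm (A *v b))\<^sup>2 = t}"
proof
  let ?G = "conj_transpose A ** A"
  note on = gram_eigenbasisD(1)[OF B] and expand = gram_eigenbasisD(4)[OF B]
    and eig = gram_eigenbasisD(5)[OF B] and fin = gram_eigenbasisD(2)[OF B]
  show "gram_eigenspace A t \<subseteq> vec.span {b\<in>B. (norm (A *v b))\<^sup>2 = t}"
  proof
    fix v assume "v \<in> gram_eigenspace A t"
    then have v: "?G *v v = complex_of_real t *s v" by (simp add: gram_eigenspace_def)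
    have "cvec_inner v b = 0" if b: "b \<in> B" "(norm (A *v b))\<^sup>2 \<noteq> t" for b
    proof -
      have "complex_of_real t * cvec_inner v b = cvec_inner (?G *v v) b"
        by (simp add: v cvec_inner_scale_left)
      also have "\<dots> = cvec_inner v (?G *v b)"
        by (metis cvec_inner_gram cvec_inner_commute)
      also have "\<dots> = complex_of_real ((norm (A *v b))\<^sup>2) * cvec_inner v b"
        using eig[OF b(1)] by (simp add: cvec_inner_scale_right)
      finally show ?thesis using b(2) by (metis mult_cancel_right of_real_eq_iff)
    qed
    then have "(\<Sum>b\<in>B. cvec_inner v b *s b) = (\<Sum>b\<in>{b\<in>B. (norm (A *v b))\<^sup>2 = t}. cvec_inner v b *s b)"
      using fin by (intro sum.mono_neutral_right) auto
    then have "v = (\<Sum>b\<in>{b\<in>B. (norm (A *v b))\<^sup>2 = t}. cvec_inner v b *s b)"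
      using expand[of v] by simp
    then show "v \<in> vec.span {b\<in>B. (norm (A *v b))\<^sup>2 = t}"
      by (metis (no_types, lifting) vec.span_sum vec.span_scale vec.span_base)
  qed
  show "vec.span {b\<in>B. (norm (A *v b))\<^sup>2 = t} \<subseteq> gram_eigenspace A t"
  proof (rule vec.span_minimal)
    show "{b\<in>B. (norm (A *v b))\<^sup>2 = t} \<subseteq> gram_eigenspace A t"
      using eig by (auto simp: gram_eigenspace_def)
    show "vec.subspace (gram_eigenspace A t)"
      by (rule vec.subspaceI)
        (simp_all add: gram_eigenspace_def vec.add vec.scale mult.commute)
  qed
qed

text \<open>
  Each eigenvalue \<open>s\<^sup>2\<close> occurs with the dimension of its eigenspace, which is the number of basis
  vectors \<open>b\<close> with \<open>\<parallel>A b\<parallel> = s\<close>.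
\<close>

lemma singular_values_eigenbasis:
  fixes A :: "complex^'n^'m"
  assumes B: "gram_eigenbasis A B"
  shows "singular_values A
    = rev (sorted_list_of_multiset (image_mset (\<lambda>b. norm (A *v b)) (mset_set B)))"
proof -
  note on = gram_eigenbasisD(1)[OF B]
    and eig = gram_eigenbasisD(5)[OF B] and fin = gram_eigenbasisD(2)[OF B]
  have nz: "0 \<notin> B" using orthonormal_norm[OF on] by force
  have span: "gram_eigenspace A t = vec.span {b\<in>B. (norm (A *v b))\<^sup>2 = t}" for t
    by (rule gram_eigenspace_span[OF B])
  have dim: "vec.dim (gram_eigenspace A (s\<^sup>2)) = card {b\<in>B. norm (A *v b) = s}" if "s \<ge> 0" for s
  proof -
    have "{b\<in>B. (norm (A *v b))\<^sup>2 = s\<^sup>2} = {b\<in>B. norm (A *v b) = s}"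
      using that by simp
    moreover have "vec.independent {b\<in>B. (norm (A *v b))\<^sup>2 = s\<^sup>2}"
      using orthonormal_independent[OF on] by (rule vec.independent_mono) blast
    ultimately show ?thesis
      using span[of "s\<^sup>2"] vec.dim_span_eq_card_independent[of "{b\<in>B. norm (A *v b) = s}"]
      by simp
  qed
  have set: "{s. 0 \<le> s \<and> (\<exists>v\<in>gram_eigenspace A (s\<^sup>2). v \<noteq> 0)} = (\<lambda>b. norm (A *v b)) ` B"
  proof (intro equalityI subsetI)
    fix s assume s: "s \<in> {s. 0 \<le> s \<and> (\<exists>v\<in>gram_eigenspace A (s\<^sup>2). v \<noteq> 0)}"
    then have "vec.span {b\<in>B. (norm (A *v b))\<^sup>2 = s\<^sup>2} \<noteq> {0}"
      unfolding span by blast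
    then have "{b\<in>B. (norm (A *v b))\<^sup>2 = s\<^sup>2} \<noteq> {}" by (metis vec.span_empty)
    then show "s \<in> (\<lambda>b. norm (A *v b)) ` B"
      using s by (auto simp: power2_eq_iff_nonneg)
  next
    fix s assume "s \<in> (\<lambda>b. norm (A *v b)) ` B"
    then obtain b where b: "b \<in> B" "s = norm (A *v b)" by auto
    then have "b \<in> gram_eigenspace A (s\<^sup>2)" using eig by (simp add: gram_eigenspace_def)
    then show "s \<in> {s. 0 \<le> s \<and> (\<exists>v\<in>gram_eigenspace A (s\<^sup>2). v \<noteq> 0)}"
      using b nz by (intro CollectI conjI bexI[of _ b]) auto
  qed
  have "(\<Sum>s\<in>(\<lambda>b. norm (A *v b)) ` B. replicate_mset (vec.dim (gram_eigenspace A (s\<^sup>2))) s)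
      = image_mset (\<lambda>b. norm (A *v b)) (mset_set B)" (is "?l = ?r")
  proof (rule multiset_eqI)
    fix s
    have "count ?l s = (\<Sum>r\<in>(\<lambda>b. norm (A *v b)) ` B. if r = s then card {b\<in>B. norm (A *v b) = s} else 0)"
      unfolding count_sum using dim by (intro sum.cong) auto
    also have "\<dots> = card {b\<in>B. norm (A *v b) = s}"
      using fin by (auto simp: card_eq_0_iff)
    also have "\<dots> = count ?r s"
      using fin by (simp add: count_image_mset' sum.If_cases Int_def conj_commute eq_commute)
    finally show "count ?l s = count ?r s" .
  qed
  then show ?thesis unfolding singular_values_def set by simp
qed

text \<open>
  This locates the two ends of interest in the decreasing list of singular values: with \<open>c\<close> below all
  entries it gives the last singular value, with \<open>c = 0\<close> the least positive one.
\<close>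

lemma sorted_nth_from_top:
  fixes xs :: "real list"
  assumes "sorted xs" "length (filter (\<lambda>x. c < x) xs) = k" "0 < k"
  shows "rev xs ! (k - 1) \<in> set xs \<and> c < rev xs ! (k - 1) \<and>
    (\<forall>x\<in>set xs. c < x \<longrightarrow> rev xs ! (k - 1) \<le> x)"
  using assms
proof (induction xs)
  case (Cons a xs)
  show ?case
  proof (cases "c < a")
    case True
    then have "filter (\<lambda>x. c < x) xs = xs" using Cons.prems by (intro filter_True) auto
    then have "k = Suc (length xs)" using Cons.prems True by simp
    then have "rev (a # xs) ! (k - 1) = a" by (simp add: nth_append)
    then show ?thesis using True Cons.prems by auto
  next
    case False
    then have k: "length (filter (\<lambda>x. c < x) xs) = k" using Cons.prems by simp
    then have "k \<le> length xs" using length_filter_le[of _ xs] by metis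
    then have "k - 1 < length (rev xs)" using \<open>0 < k\<close> by simp
    then have "rev (a # xs) ! (k - 1) = rev xs ! (k - 1)"
      by (simp add: nth_append)
    then show ?thesis using Cons.IH k Cons.prems False by auto
  qed
qed simp

lemma orthonormal_expansion_norm:
  assumes B: "gram_eigenbasis A B"
  shows "(norm v)\<^sup>2 = (\<Sum>b\<in>B. (cmod (cvec_inner v b))\<^sup>2)"
proof -
  have "(norm v)\<^sup>2 = (norm (\<Sum>b\<in>B. cvec_inner v b *s b))\<^sup>2" using gram_eigenbasisD(4)[OF B, of v] by (rule arg_cong[where f="\<lambda>v. (norm v)\<^sup>2"])
  also have "\<dots> = (\<Sum>b\<in>B. (cmod (cvec_inner v b))\<^sup>2 * (norm b)\<^sup>2)"
    using gram_eigenbasisD(1)[OF B] gram_eigenbasisD(2)[OF B] by (intro orthogonal_sum_norm) (auto simp: orthonormal_def)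
  also have "\<dots> = (\<Sum>b\<in>B. (cmod (cvec_inner v b))\<^sup>2)"
    using gram_eigenbasisD(6)[OF B] by simp
  finally show ?thesis .
qed

lemma gram_images_orthogonal:
  fixes A :: "complex^'n^'m"
  assumes B: "gram_eigenbasis A B" and "b \<in> B" "c \<in> B" "b \<noteq> c"
  shows "cvec_inner (A *v b) (A *v c) = 0"
proof -
  have "cvec_inner (A *v b) (A *v c) = cvec_inner ((conj_transpose A ** A) *v b) c"
    by (simp add: cvec_inner_gram)
  then show ?thesis
    using assms gram_eigenbasisD(1)[OF B]
    by (simp add: gram_eigenbasisD(5)[OF B] cvec_inner_scale_left orthonormal_def)
qed

lemma matrix_mult_expansion:
  fixes A :: "complex^'n^'m"
  assumes B: "gram_eigenbasis A B"
  shows "A *v v = (\<Sum>b\<in>B. cvec_inner v b *s (A *v b))"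
proof -
  have "A *v v = A *v (\<Sum>b\<in>B. cvec_inner v b *s b)" by (rule arg_cong[OF gram_eigenbasisD(4)[OF B]])
  then show ?thesis by (simp add: vec.sum vec.scale)
qed

lemma expansion_image_norm:
  fixes A :: "complex^'n^'m"
  assumes B: "gram_eigenbasis A B"
  shows "(norm (A *v v))\<^sup>2 = (\<Sum>b\<in>B. (cmod (cvec_inner v b))\<^sup>2 * (norm (A *v b))\<^sup>2)"
  unfolding matrix_mult_expansion[OF B, of v]
  using gram_images_orthogonal[OF B] gram_eigenbasisD(2)[OF B]
  by (intro orthogonal_sum_norm) auto

lemma singular_value_1:
  fixes A :: "complex^'n^'m"
  obtains u where "norm u = 1" "norm (A *v u) = singular_value 1 A"
    "(conj_transpose A ** A) *v u = complex_of_real ((norm (A *v u))\<^sup>2) *s u"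
    "\<And>v. norm (A *v v) \<le> singular_value 1 A * norm v"
proof -
  obtain B where B: "gram_eigenbasis A B" by (rule gram_eigenbasis_exists)
  note on = gram_eigenbasisD(1)[OF B] and fin = gram_eigenbasisD(2)[OF B]
    and card = gram_eigenbasisD(3)[OF B] and eig = gram_eigenbasisD(5)[OF B]
    and unit = gram_eigenbasisD(6)[OF B]
  define xs where "xs = sorted_list_of_multiset (image_mset (\<lambda>b. norm (A *v b)) (mset_set B))"
  have sv: "singular_values A = rev xs"
    unfolding xs_def by (rule singular_values_eigenbasis[OF B])
  have set: "set xs = (\<lambda>b. norm (A *v b)) ` B" using fin by (simp add: xs_def)
  have "xs \<noteq> []" using set card by auto
  then have s1: "singular_value 1 A = last xs"
    by (simp add: singular_value_def sv rev_nth last_conv_nth)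
  then obtain b where b: "b \<in> B" "norm (A *v b) = singular_value 1 A"
    using last_in_set[OF \<open>xs \<noteq> []\<close>] set by auto
  have "sorted xs" by (simp add: xs_def sorted_sorted_list_of_multiset)
  then have "x \<le> last xs" if "x \<in> set xs" for x
    using that \<open>xs \<noteq> []\<close> by (induction xs) auto
  then have le: "norm (A *v c) \<le> singular_value 1 A" if "c \<in> B" for c
    using that set s1 by auto
  have "norm (A *v v) \<le> singular_value 1 A * norm v" for v
  proof (rule power2_le_imp_le)
    have "(norm (A *v v))\<^sup>2 \<le> (\<Sum>c\<in>B. (cmod (cvec_inner v c))\<^sup>2 * (singular_value 1 A)\<^sup>2)"
      unfolding expansion_image_norm[OF B, of v]
      using le by (intro sum_mono mult_left_mono power_mono) auto
    also have "\<dots> = (singular_value 1 A * norm v)\<^sup>2"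
      by (simp add: orthonormal_expansion_norm[OF B] power_mult_distrib sum_distrib_left mult.commute)
    finally show "(norm (A *v v))\<^sup>2 \<le> (singular_value 1 A * norm v)\<^sup>2" .
    show "0 \<le> singular_value 1 A * norm v" using b by (metis mult_nonneg_nonneg norm_ge_zero)
  qed
  then show thesis by (rule that[OF unit[OF b(1)] b(2) eig[OF b(1)]])
qed

lemma singular_value_last:
  fixes A :: "complex^'n^'m"
  obtains u where "norm u = 1" "norm (A *v u) = singular_value CARD('n) A"
    "\<And>v. singular_value CARD('n) A * norm v \<le> norm (A *v v)"
proof -
  obtain B where B: "gram_eigenbasis A B" by (rule gram_eigenbasis_exists)
  note on = gram_eigenbasisD(1)[OF B] and fin = gram_eigenbasisD(2)[OF B]
    and card = gram_eigenbasisD(3)[OF B] and eig = gram_eigenbasisD(5)[OF B]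
    and unit = gram_eigenbasisD(6)[OF B]
  define xs where "xs = sorted_list_of_multiset (image_mset (\<lambda>b. norm (A *v b)) (mset_set B))"
  have sv: "singular_values A = rev xs"
    unfolding xs_def by (rule singular_values_eigenbasis[OF B])
  have set: "set xs = (\<lambda>b. norm (A *v b)) ` B" using fin by (simp add: xs_def)
  have "length xs = CARD('n)" using card by (simp add: xs_def flip: size_mset)
  moreover have "filter (\<lambda>x. -1 < x) xs = xs"
    using set by (intro filter_True) (auto intro: less_le_trans[OF _ norm_ge_zero])
  ultimately have "length (filter (\<lambda>x. -1 < x) xs) = CARD('n)" by simp
  moreover have "sorted xs" by (simp add: xs_def sorted_sorted_list_of_multiset)
  moreover have "-1 < x" if "x \<in> set xs" for x
    using that set by (auto intro: less_le_trans[OF _ norm_ge_zero])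
  ultimately have *: "singular_value CARD('n) A \<in> set xs"
    "\<And>x. x \<in> set xs \<Longrightarrow> singular_value CARD('n) A \<le> x"
    using sorted_nth_from_top[of xs "-1" "CARD('n)"] by (auto simp: singular_value_def sv)
  obtain b where b: "b \<in> B" "norm (A *v b) = singular_value CARD('n) A" using *(1) set by auto
  have "singular_value CARD('n) A * norm v \<le> norm (A *v v)" for v
  proof (rule power2_le_imp_le)
    have "(singular_value CARD('n) A * norm v)\<^sup>2
        = (\<Sum>c\<in>B. (cmod (cvec_inner v c))\<^sup>2 * (singular_value CARD('n) A)\<^sup>2)"
      by (simp add: orthonormal_expansion_norm[OF B] power_mult_distrib sum_distrib_left mult.commute)
    also have "\<dots> \<le> (norm (A *v v))\<^sup>2"
      unfolding expansion_image_norm[OF B, of v]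
      using *(2) set b by (intro sum_mono mult_left_mono power_mono) (auto, metis norm_ge_zero)
    finally show "(singular_value CARD('n) A * norm v)\<^sup>2 \<le> (norm (A *v v))\<^sup>2" .
  qed simp
  then show thesis by (rule that[OF unit[OF b(1)] b(2)])
qed

text \<open>
  For rank equal to the number \<open>m\<close> of rows, the nonzero ones among the orthogonal vectors \<open>A b\<close>, with
  \<open>b\<close> in the eigenbasis, form a basis of the target space, so exactly \<open>m\<close> singular values are positive
  and \<open>\<sigma>\<^sub>m\<close> is the least of them. Every \<open>v\<close> has the form \<open>A w\<close>; in eigenbasis coordinates of \<open>w\<close> the
  squared norms of \<open>v\<close> and \<open>A\<^sup>* v\<close> carry the weights \<open>\<parallel>A b\<parallel>\<^sup>2\<close> and \<open>\<parallel>A b\<parallel>\<^sup>4\<close>.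
\<close>

lemma singular_value_rank_rows:
  fixes A :: "complex^'n^'m"
  assumes rank: "rank A = CARD('m)"
  obtains h where "h \<noteq> 0" "norm (conj_transpose A *v h) = singular_value CARD('m) A * norm h"
    "0 < singular_value CARD('m) A"
    "\<And>v. singular_value CARD('m) A * norm v \<le> norm (conj_transpose A *v v)"
proof -
  obtain B where B: "gram_eigenbasis A B" by (rule gram_eigenbasis_exists)
  note on = gram_eigenbasisD(1)[OF B] and fin = gram_eigenbasisD(2)[OF B]
    and card = gram_eigenbasisD(3)[OF B] and eig = gram_eigenbasisD(5)[OF B]
    and unit = gram_eigenbasisD(6)[OF B]
  have surj: "\<exists>w. v = A *v w" for v
    using rank rows_independent_surj by (simp add: rank_eq_rows_iff)
  have orth: "cvec_inner (A *v b) (A *v c) = 0" if "b \<in> B" "c \<in> B" "b \<noteq> c" for b c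
    using gram_images_orthogonal[OF B] that by blast
  define C where "C = {b\<in>B. A *v b \<noteq> 0}"
  have inj: "inj_on ((*v) A) C"
  proof (rule inj_onI, rule ccontr)
    fix b c assume "b \<in> C" "c \<in> C" "A *v b = A *v c" "b \<noteq> c"
    then have "cvec_inner (A *v b) (A *v b) = 0" using orth[of b c] by (simp add: C_def)
    then show False using \<open>b \<in> C\<close> by (simp add: cvec_inner_self C_def)
  qed
  have ind: "vec.independent ((*v) A ` C)"
    using orth by (intro orthogonal_independent) (auto simp: C_def)
  have "v \<in> vec.span ((*v) A ` C)" for v
  proof -
    obtain w where w: "v = A *v w" using surj by blast
    have "v = (\<Sum>b\<in>B. cvec_inner w b *s (A *v b))"
      unfolding w by (rule matrix_mult_expansion[OF B])
    also have "\<dots> = (\<Sum>b\<in>C. cvec_inner w b *s (A *v b))"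
      using fin by (intro sum.mono_neutral_right) (auto simp: C_def)
    also have "\<dots> \<in> vec.span ((*v) A ` C)"
      by (intro vec.span_sum vec.span_scale vec.span_base) auto
    finally show ?thesis .
  qed
  then have "vec.span ((*v) A ` C) = UNIV" by blast
  then have "card ((*v) A ` C) = CARD('m)"
    using vec.dim_span_eq_card_independent[OF ind] vec_dim_card by metis
  then have cardC: "card C = CARD('m)" using card_image[OF inj] by simp
  define xs where "xs = sorted_list_of_multiset (image_mset (\<lambda>b. norm (A *v b)) (mset_set B))"
  have sv: "singular_values A = rev xs"
    unfolding xs_def by (rule singular_values_eigenbasis[OF B])
  have set: "set xs = (\<lambda>b. norm (A *v b)) ` B" using fin by (simp add: xs_def)
  have "length (filter (\<lambda>x. 0 < x) xs) = size (filter_mset (\<lambda>x. 0 < x) (mset xs))"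
    by (simp flip: mset_filter)
  also have "\<dots> = size (mset_set C)"
    using fin by (simp add: xs_def filter_mset_image_mset C_def)
  finally have "length (filter (\<lambda>x. 0 < x) xs) = CARD('m)" by (simp add: cardC)
  from sorted_nth_from_top[OF _ this]
  have *: "singular_value CARD('m) A \<in> set xs" "0 < singular_value CARD('m) A"
    "\<And>x. x \<in> set xs \<Longrightarrow> 0 < x \<Longrightarrow> singular_value CARD('m) A \<le> x"
    by (auto simp: singular_value_def sv xs_def sorted_sorted_list_of_multiset)
  obtain b where b: "b \<in> B" "norm (A *v b) = singular_value CARD('m) A" using *(1) set by auto
  have adj: "conj_transpose A *v (A *v c) = complex_of_real ((norm (A *v c))\<^sup>2) *s c" if "c \<in> B" for c
    using eig[OF that] by (simp add: matrix_vector_mul_assoc)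
  have "norm (conj_transpose A *v (A *v b)) = singular_value CARD('m) A * norm (A *v b)"
    using adj[OF b(1)] unit[OF b(1)] b(2) *(2)
    by (simp add: norm_complex_scale norm_mult power2_eq_square)
  moreover have "A *v b \<noteq> 0" using b *(2) by auto
  moreover have "singular_value CARD('m) A * norm v \<le> norm (conj_transpose A *v v)" for v
  proof (rule power2_le_imp_le)
    obtain w where w: "v = A *v w" using surj by blast
    have "(norm v)\<^sup>2 = (\<Sum>c\<in>B. (cmod (cvec_inner w c))\<^sup>2 * (norm (A *v c))\<^sup>2)"
      unfolding w by (rule expansion_image_norm[OF B])
    then have "(singular_value CARD('m) A * norm v)\<^sup>2
        = (\<Sum>c\<in>B. (cmod (cvec_inner w c))\<^sup>2 * ((singular_value CARD('m) A)\<^sup>2 * (norm (A *v c))\<^sup>2))"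
      by (simp add: power_mult_distrib sum_distrib_left mult_ac)
    also have "\<dots> \<le> (\<Sum>c\<in>B. (cmod (cvec_inner w c))\<^sup>2 * ((norm (A *v c))\<^sup>2 * (norm (A *v c))\<^sup>2))"
    proof (intro sum_mono mult_left_mono)
      fix c assume c: "c \<in> B"
      show "(singular_value CARD('m) A)\<^sup>2 * (norm (A *v c))\<^sup>2 \<le> (norm (A *v c))\<^sup>2 * (norm (A *v c))\<^sup>2"
      proof (cases "A *v c = 0")
        case False
        then have "singular_value CARD('m) A \<le> norm (A *v c)" using c set by (intro *(3)) auto
        then show ?thesis using *(2) by (intro mult_right_mono power_mono) auto
      qed simp
    qed auto
    also have "\<dots> = (norm (\<Sum>c\<in>B. cvec_inner w c *s (conj_transpose A *v (A *v c))))\<^sup>2"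
    proof -
      have "norm (conj_transpose A *v (A *v c)) = (norm (A *v c))\<^sup>2" if "c \<in> B" for c
        using adj[OF that] unit[OF that] by (simp add: norm_complex_scale norm_power)
      moreover have "cvec_inner (conj_transpose A *v (A *v c)) (conj_transpose A *v (A *v c')) = 0"
        if "c \<in> B" "c' \<in> B" "c \<noteq> c'" for c c'
        using that adj on by (simp add: cvec_inner_scale_left cvec_inner_scale_right orthonormal_def)
      ultimately show ?thesis
        using fin by (subst orthogonal_sum_norm) (auto simp: power2_eq_square)
    qed
    also have "(\<Sum>c\<in>B. cvec_inner w c *s (conj_transpose A *v (A *v c))) = conj_transpose A *v v"
      unfolding w matrix_mult_expansion[OF B, of w] by (simp add: vec.sum vec.scale)
    finally show "(singular_value CARD('m) A * norm v)\<^sup>2 \<le> (norm (conj_transpose A *v v))\<^sup>2" .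
  qed simp
  ultimately show thesis using that *(2) by blast
qed

text \<open>
  Since \<open>\<parallel>A\<^sup>* h\<parallel>\<^sup>2\<close> is the inner product of \<open>A A\<^sup>* h\<close> with \<open>h\<close>, this follows from Cauchy-Schwarz and the
  bound for \<open>A\<close>.
\<close>

lemma norm_adjoint_le:
  fixes A :: "complex^'n^'m"
  shows "norm (conj_transpose A *v h) \<le> singular_value 1 A * norm h"
proof -
  let ?g = "conj_transpose A *v h"
  obtain u where u: "norm (A *v u) = singular_value 1 A"
    and le: "\<And>v. norm (A *v v) \<le> singular_value 1 A * norm v"
    using singular_value_1[of A] by blast
  have "norm ?g * norm ?g = Re (cvec_inner (A *v ?g) h)"
    by (simp add: cvec_inner_adjoint cvec_inner_self power2_eq_square)
  also have "\<dots> \<le> norm (A *v ?g) * norm h"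
    unfolding Re_cvec_inner by (rule norm_cauchy_schwarz)
  also have "\<dots> \<le> singular_value 1 A * norm ?g * norm h"
    using le by (intro mult_right_mono) auto
  finally have *: "norm ?g * norm ?g \<le> norm ?g * (singular_value 1 A * norm h)"
    by (simp add: mult_ac)
  have "0 \<le> singular_value 1 A * norm h" using u by (metis mult_nonneg_nonneg norm_ge_zero)
  with * show ?thesis by (cases "norm ?g = 0") (auto simp: mult_le_cancel_left_pos)
qed

section \<open>Optimal constants of a matrix and its adjoint\<close>

lemma lower_bound_imp_rank:
  fixes A :: "complex^'n^'m"
  assumes "0 < a" "\<forall>w. a * (norm w)\<^sup>2 \<le> (norm (A *v w))\<^sup>2"
  shows "rank A = CARD('n)"
proof -
  have "w = 0" if "A *v w = 0" for w :: "complex^'n"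
  proof -
    have "a * (norm w)\<^sup>2 \<le> 0" using assms(2)[rule_format, of w] that by simp
    then show ?thesis using assms(1) by (simp add: mult_le_0_iff)
  qed
  then show ?thesis by (simp add: rank_eq_columns_iff)
qed

lemma singular_values_full_column_rank:
  fixes A :: "complex^'n^'m"
  assumes "rank A = CARD('n)"
  shows "0 < singular_value CARD('n) A" "0 < singular_value 1 A"
proof -
  obtain u where u: "norm u = 1" "norm (A *v u) = singular_value CARD('n) A"
    using singular_value_last[of A] by blast
  have "A *v u \<noteq> 0" using assms u(1) by (auto simp: rank_eq_columns_iff)
  then show pos: "0 < singular_value CARD('n) A" by (simp flip: u(2))
  obtain v where "\<And>w. norm (A *v w) \<le> singular_value 1 A * norm w"
    using singular_value_1[of A] by blast
  then have "norm (A *v u) \<le> singular_value 1 A * norm u" .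
  then show "0 < singular_value 1 A" using pos u by simp
qed

lemma singular_value_lower_bound_iff:
  fixes A :: "complex^'n^'m"
  assumes "0 \<le> a" "0 \<le> singular_value CARD('n) A"
  shows "(\<forall>w. a * (norm w)\<^sup>2 \<le> (norm (A *v w))\<^sup>2) \<longleftrightarrow> a \<le> (singular_value CARD('n) A)\<^sup>2"
proof -
  obtain u where u: "norm u = 1" "norm (A *v u) = singular_value CARD('n) A"
    and le: "\<And>v. singular_value CARD('n) A * norm v \<le> norm (A *v v)"
    using singular_value_last[of A] by blast
  show ?thesis
  proof (intro iffI allI)
    assume "\<forall>w. a * (norm w)\<^sup>2 \<le> (norm (A *v w))\<^sup>2"
    then show "a \<le> (singular_value CARD('n) A)\<^sup>2" using u by (auto dest: spec[of _ u])
  next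
    fix w :: "complex^'n" assume "a \<le> (singular_value CARD('n) A)\<^sup>2"
    then have "a * (norm w)\<^sup>2 \<le> (singular_value CARD('n) A)\<^sup>2 * (norm w)\<^sup>2" by (intro mult_right_mono) auto
    also have "\<dots> = (singular_value CARD('n) A * norm w)\<^sup>2" by (simp add: power_mult_distrib)
    also have "\<dots> \<le> (norm (A *v w))\<^sup>2" using le assms(2) by (intro power_mono) auto
    finally show "a * (norm w)\<^sup>2 \<le> (norm (A *v w))\<^sup>2" .
  qed
qed

lemma singular_value_upper_bound_iff:
  fixes A :: "complex^'n^'m"
  shows "(\<forall>w. (norm (A *v w))\<^sup>2 \<le> b * (norm w)\<^sup>2) \<longleftrightarrow> (singular_value 1 A)\<^sup>2 \<le> b"
proof -
  obtain u where u: "norm u = 1" "norm (A *v u) = singular_value 1 A"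
    and le: "\<And>v. norm (A *v v) \<le> singular_value 1 A * norm v"
    using singular_value_1[of A] by blast
  show ?thesis
  proof (intro iffI allI)
    assume "\<forall>w. (norm (A *v w))\<^sup>2 \<le> b * (norm w)\<^sup>2"
    then show "(singular_value 1 A)\<^sup>2 \<le> b" using u by (auto dest: spec[of _ u])
  next
    fix w :: "complex^'n" assume "(singular_value 1 A)\<^sup>2 \<le> b"
    have "(norm (A *v w))\<^sup>2 \<le> (singular_value 1 A * norm w)\<^sup>2" using le by (intro power_mono) auto
    also have "\<dots> = (singular_value 1 A)\<^sup>2 * (norm w)\<^sup>2" by (simp add: power_mult_distrib)
    also have "\<dots> \<le> b * (norm w)\<^sup>2" using \<open>(singular_value 1 A)\<^sup>2 \<le> b\<close> by (intro mult_right_mono) auto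
    finally show "(norm (A *v w))\<^sup>2 \<le> b * (norm w)\<^sup>2" .
  qed
qed

text \<open>
  The bound is attained at the image \<open>A u\<close> of a top eigenvector, for which \<open>A\<^sup>* A u = \<sigma>\<^sub>1\<^sup>2 u\<close>.
\<close>

lemma adjoint_upper_bound_iff:
  fixes A :: "complex^'n^'m"
  shows "(\<forall>h. (norm (conj_transpose A *v h))\<^sup>2 \<le> b * (norm h)\<^sup>2) \<longleftrightarrow> (singular_value 1 A)\<^sup>2 \<le> b"
proof (intro iffI allI)
  assume *: "\<forall>h. (norm (conj_transpose A *v h))\<^sup>2 \<le> b * (norm h)\<^sup>2"
  obtain u where u: "norm u = 1" "norm (A *v u) = singular_value 1 A"
    "(conj_transpose A ** A) *v u = complex_of_real ((norm (A *v u))\<^sup>2) *s u"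
    using singular_value_1[of A] by blast
  show "(singular_value 1 A)\<^sup>2 \<le> b"
  proof (cases "singular_value 1 A = 0")
    case True
    \<comment> \<open>here the claim is \<open>0 \<le> b\<close>, and any unit vector shows it\<close>
    define h :: "complex^'m" where "h = axis undefined 1"
    have "norm h = 1" by (simp add: h_def)
    then have "(norm (conj_transpose A *v h))\<^sup>2 \<le> b" using *[rule_format, of h] by simp
    then have "0 \<le> b" by (rule order_trans[OF zero_le_power2])
    then show ?thesis using True by simp
  next
    case False
    have "conj_transpose A *v (A *v u) = complex_of_real ((singular_value 1 A)\<^sup>2) *s u"
      using u by (simp add: matrix_vector_mul_assoc)
    then have "norm (conj_transpose A *v (A *v u)) = (singular_value 1 A)\<^sup>2"
      using u(1) by (simp add: norm_complex_scale norm_power)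
    then have "(singular_value 1 A)\<^sup>2 * (singular_value 1 A)\<^sup>2 \<le> b * (singular_value 1 A)\<^sup>2"
      using *[rule_format, of "A *v u"] u(2) by (simp add: power2_eq_square)
    then show ?thesis by (rule mult_right_le_imp_le) (use False in simp)
  qed
next
  fix h :: "complex^'m" assume "(singular_value 1 A)\<^sup>2 \<le> b"
  have "(norm (conj_transpose A *v h))\<^sup>2 \<le> (singular_value 1 A * norm h)\<^sup>2"
    by (intro power_mono norm_adjoint_le) simp
  also have "\<dots> = (singular_value 1 A)\<^sup>2 * (norm h)\<^sup>2" by (simp add: power_mult_distrib)
  also have "\<dots> \<le> b * (norm h)\<^sup>2" using \<open>(singular_value 1 A)\<^sup>2 \<le> b\<close> by (intro mult_right_mono) auto
  finally show "(norm (conj_transpose A *v h))\<^sup>2 \<le> b * (norm h)\<^sup>2" .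
qed

lemma adjoint_lower_bound_iff:
  fixes A :: "complex^'n^'m"
  assumes "rank A = CARD('m)"
  shows "(\<forall>h. a * (norm h)\<^sup>2 \<le> (norm (conj_transpose A *v h))\<^sup>2) \<longleftrightarrow> a \<le> (singular_value CARD('m) A)\<^sup>2"
proof -
  let ?s = "singular_value CARD('m) A"
  obtain g where g: "g \<noteq> 0" "norm (conj_transpose A *v g) = ?s * norm g" and pos: "0 < ?s"
    and le: "\<And>v. ?s * norm v \<le> norm (conj_transpose A *v v)"
    using singular_value_rank_rows[OF assms] by blast
  show ?thesis
  proof (intro iffI allI)
    assume "\<forall>h. a * (norm h)\<^sup>2 \<le> (norm (conj_transpose A *v h))\<^sup>2"
    then have "a * (norm g)\<^sup>2 \<le> ?s\<^sup>2 * (norm g)\<^sup>2" using g(2)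
      by (auto dest: spec[of _ g] simp: power_mult_distrib)
    then show "a \<le> ?s\<^sup>2" using g(1) by simp
  next
    fix h :: "complex^'m" assume "a \<le> ?s\<^sup>2"
    then have "a * (norm h)\<^sup>2 \<le> ?s\<^sup>2 * (norm h)\<^sup>2" by (intro mult_right_mono) auto
    also have "\<dots> = (?s * norm h)\<^sup>2" by (simp add: power_mult_distrib)
    also have "\<dots> \<le> (norm (conj_transpose A *v h))\<^sup>2" using le pos by (intro power_mono) auto
    finally show "a * (norm h)\<^sup>2 \<le> (norm (conj_transpose A *v h))\<^sup>2" .
  qed
qed

text \<open>
  A linear relation between the rows is, after conjugation, a vector in the kernel of the adjoint.
\<close>

lemma adjoint_lower_bound_imp_rank:
  fixes A :: "complex^'n^'m"
  assumes "0 < a" "\<forall>h. a * (norm h)\<^sup>2 \<le> (norm (conj_transpose A *v h))\<^sup>2"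
  shows "rank A = CARD('m)"
proof -
  have "c i = 0" if c: "(\<Sum>i\<in>UNIV. c i *s row i A) = 0" for c i
  proof -
    define h :: "complex^'m" where "h = (\<chi> i. cnj (c i))"
    have "(conj_transpose A *v h) $ k = cnj ((\<Sum>i\<in>UNIV. c i *s row i A) $ k)" for k
      by (simp add: matrix_vector_mult_def conj_transpose_def h_def row_def mult.commute)
    then have "conj_transpose A *v h = 0" using c by (simp add: vec_eq_iff)
    then have "a * (norm h)\<^sup>2 \<le> 0" using assms(2)[rule_format, of h] by simp
    then have "h = 0" using assms(1) by (simp add: mult_le_0_iff)
    then show ?thesis by (simp add: h_def vec_eq_iff)
  qed
  then show ?thesis unfolding rank_eq_rows_iff rows_independent_iff by blast
qed

section \<open>Square-integrable functions and Parseval\<close>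

lemma L2_spaceD:
  assumes "f \<in> L2_space M"
  shows "f \<in> borel_measurable M" "integrable M (\<lambda>x. (cmod (f x))\<^sup>2)"
  using assms by (auto simp: L2_space_def)

lemma borel_measurable_cnj: "f \<in> borel_measurable M \<Longrightarrow> (\<lambda>x. cnj (f x)) \<in> borel_measurable M"
  by (rule measurable_compose[OF _ borel_measurable_continuous_onI[OF continuous_on_cnj[OF continuous_on_id]]])

lemma L2_product_integrable:
  assumes f: "f \<in> L2_space M" and g: "g \<in> L2_space M"
  shows "integrable M (\<lambda>x. f x * cnj (g x))"
proof (rule Bochner_Integration.integrable_bound)
  show "integrable M (\<lambda>x. (cmod (f x))\<^sup>2 + (cmod (g x))\<^sup>2)"
    using L2_spaceD(2)[OF f] L2_spaceD(2)[OF g] by simp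
  show "(\<lambda>x. f x * cnj (g x)) \<in> borel_measurable M"
    using L2_spaceD(1)[OF f] L2_spaceD(1)[OF g] by (intro borel_measurable_times borel_measurable_cnj)
  have "cmod (f x) * cmod (g x) \<le> (cmod (f x))\<^sup>2 + (cmod (g x))\<^sup>2" for x
  proof -
    have "0 \<le> (cmod (f x) - cmod (g x))\<^sup>2" "0 \<le> cmod (f x) * cmod (g x)" by auto
    then show ?thesis unfolding power2_diff by linarith
  qed
  then show "AE x in M. norm (f x * cnj (g x)) \<le> norm ((cmod (f x))\<^sup>2 + (cmod (g x))\<^sup>2)"
    by (simp add: norm_mult)
qed

lemma cmod_add_sq_le: "(cmod (a + b))\<^sup>2 \<le> 2 * (cmod a)\<^sup>2 + 2 * (cmod b)\<^sup>2"
proof -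
  have "(cmod (a + b))\<^sup>2 \<le> (cmod a + cmod b)\<^sup>2"
    by (intro power_mono norm_triangle_ineq) simp
  moreover have "0 \<le> (cmod a - cmod b)\<^sup>2" by simp
  ultimately show ?thesis by (simp add: power2_sum power2_diff)
qed

lemma L2_space_add:
  assumes f: "f \<in> L2_space M" and g: "g \<in> L2_space M"
  shows "(\<lambda>x. f x + g x) \<in> L2_space M"
proof -
  note [measurable] = L2_spaceD(1)[OF f] L2_spaceD(1)[OF g]
  have "integrable M (\<lambda>x. (cmod (f x + g x))\<^sup>2)"
  proof (rule Bochner_Integration.integrable_bound)
    show "integrable M (\<lambda>x. 2 * (cmod (f x))\<^sup>2 + 2 * (cmod (g x))\<^sup>2)"
      using L2_spaceD(2)[OF f] L2_spaceD(2)[OF g] by simp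
    show "AE x in M. norm ((cmod (f x + g x))\<^sup>2) \<le> norm (2 * (cmod (f x))\<^sup>2 + 2 * (cmod (g x))\<^sup>2)"
      using cmod_add_sq_le by (intro AE_I2) simp
  qed measurable
  then show ?thesis by (simp add: L2_space_def)
qed

lemma L2_space_scale: "f \<in> L2_space M \<Longrightarrow> (\<lambda>x. c * f x) \<in> L2_space M"
  by (auto simp: L2_space_def norm_mult power_mult_distrib intro: borel_measurable_times)

lemma L2_space_minus: "f \<in> L2_space M \<Longrightarrow> g \<in> L2_space M \<Longrightarrow> (\<lambda>x. f x - g x) \<in> L2_space M"
  using L2_space_add[of f M "\<lambda>x. - 1 * g x"] L2_space_scale[of g M "- 1"] by simp

lemma L2_space_zero: "(\<lambda>x. 0) \<in> L2_space M"
  by (simp add: L2_space_def)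

lemma L2_space_sum:
  "(\<And>i. i \<in> I \<Longrightarrow> f i \<in> L2_space M) \<Longrightarrow> (\<lambda>x. \<Sum>i\<in>I. f i x) \<in> L2_space M"
  by (induction I rule: infinite_finite_induct) (auto simp: L2_space_zero intro!: L2_space_add)

lemma L2_space_bounded:
  assumes "finite_measure M" "f \<in> borel_measurable M" "\<And>x. x \<in> space M \<Longrightarrow> cmod (f x) \<le> C"
  shows "f \<in> L2_space M"
proof -
  interpret finite_measure M by fact
  have "integrable M (\<lambda>x. (cmod (f x))\<^sup>2)"
  proof (rule integrable_const_bound[where B = "C\<^sup>2"])
    show "AE x in M. norm ((cmod (f x))\<^sup>2) \<le> C\<^sup>2"
      using assms(3) by (intro AE_I2) (simp add: power_mono)
  qed (use assms(2) in measurable)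
  then show ?thesis using assms(2) by (simp add: L2_space_def)
qed

lemma L2_norm_sq_nonneg: "0 \<le> L2_norm_sq M f"
  by (simp add: L2_norm_sq_def)

lemma L2_norm_sq_scale: "L2_norm_sq M (\<lambda>x. c * f x) = (cmod c)\<^sup>2 * L2_norm_sq M f"
  by (simp add: L2_norm_sq_def norm_mult power_mult_distrib)

lemma L2_norm_sq_add_le:
  assumes f: "f \<in> L2_space M" and g: "g \<in> L2_space M"
  shows "L2_norm_sq M (\<lambda>x. f x + g x) \<le> 2 * L2_norm_sq M f + 2 * L2_norm_sq M g"
proof -
  have "L2_norm_sq M (\<lambda>x. f x + g x) \<le> (LINT x|M. 2 * (cmod (f x))\<^sup>2 + 2 * (cmod (g x))\<^sup>2)"
    unfolding L2_norm_sq_def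
    using L2_spaceD(2)[OF L2_space_add[OF f g]] L2_spaceD(2)[OF f] L2_spaceD(2)[OF g]
    by (intro integral_mono cmod_add_sq_le) auto
  also have "\<dots> = 2 * L2_norm_sq M f + 2 * L2_norm_sq M g"
    using L2_spaceD(2)[OF f] L2_spaceD(2)[OF g] by (simp add: L2_norm_sq_def)
  finally show ?thesis .
qed

lemma L2_inner_self: "L2_inner M f f = complex_of_real (L2_norm_sq M f)"
  unfolding L2_inner_def L2_norm_sq_def
  by (simp flip: complex_norm_square integral_complex_of_real)

lemma L2_inner_commute: "L2_inner M f g = cnj (L2_inner M g f)"
  unfolding L2_inner_def by (simp add: mult.commute flip: Bochner_Integration.integral_cnj)

lemma L2_inner_diff_left:
  "f \<in> L2_space M \<Longrightarrow> g \<in> L2_space M \<Longrightarrow> h \<in> L2_space M \<Longrightarrow>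
    L2_inner M (\<lambda>x. f x - g x) h = L2_inner M f h - L2_inner M g h"
  by (simp add: L2_inner_def left_diff_distrib L2_product_integrable)

lemma L2_inner_sum_left:
  assumes "\<And>i. i \<in> I \<Longrightarrow> f i \<in> L2_space M" "h \<in> L2_space M"
  shows "L2_inner M (\<lambda>x. \<Sum>i\<in>I. a i * f i x) h = (\<Sum>i\<in>I. a i * L2_inner M (f i) h)"
proof -
  have "L2_inner M (\<lambda>x. \<Sum>i\<in>I. a i * f i x) h = (LINT x|M. (\<Sum>i\<in>I. a i * (f i x * cnj (h x))))"
    by (simp add: L2_inner_def sum_distrib_right mult.assoc)
  also have "\<dots> = (\<Sum>i\<in>I. a i * L2_inner M (f i) h)"
    using assms by (subst Bochner_Integration.integral_sum) (auto simp: L2_inner_def L2_product_integrable)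
  finally show ?thesis .
qed

definition L2_orthonormal :: "'a measure \<Rightarrow> ('i \<Rightarrow> 'a \<Rightarrow> complex) \<Rightarrow> bool" where
  "L2_orthonormal M e \<longleftrightarrow> range e \<subseteq> L2_space M \<and>
     (\<forall>m n. L2_inner M (e m) (e n) = (if m = n then 1 else 0))"

text \<open>
  This identity gives at once Bessel's inequality (\<open>a\<close> equal to the coefficients), the best
  approximation property (comparison with any \<open>a\<close>) and the norm of a finite combination (\<open>f = 0\<close>).
\<close>

lemma L2_norm_sq_orthonormal_diff:
  assumes e: "L2_orthonormal M e" and f: "f \<in> L2_space M" and F: "finite F"
  shows "L2_norm_sq M (\<lambda>x. f x - (\<Sum>n\<in>F. a n * e n x))
    = L2_norm_sq M f - (\<Sum>n\<in>F. (cmod (L2_inner M f (e n)))\<^sup>2)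
      + (\<Sum>n\<in>F. (cmod (L2_inner M f (e n) - a n))\<^sup>2)"
proof -
  define s where "s x = (\<Sum>n\<in>F. a n * e n x)" for x
  define c where "c n = L2_inner M f (e n)" for n
  have eL: "e n \<in> L2_space M" for n using e by (auto simp: L2_orthonormal_def)
  have sL: "s \<in> L2_space M"
    unfolding s_def using eL by (intro L2_space_sum L2_space_scale)
  have s_left: "L2_inner M s h = (\<Sum>n\<in>F. a n * L2_inner M (e n) h)" if "h \<in> L2_space M" for h
    unfolding s_def using eL that by (rule L2_inner_sum_left)
  have sf: "L2_inner M s f = (\<Sum>n\<in>F. a n * cnj (c n))"
    unfolding s_left[OF f] c_def by (intro sum.cong refl arg_cong2[where f = "(*)"] L2_inner_commute)
  then have fs: "L2_inner M f s = (\<Sum>n\<in>F. cnj (a n) * c n)"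
    by (subst L2_inner_commute) simp
  have "L2_inner M (e n) s = cnj (a n)" if "n \<in> F" for n
  proof -
    have "L2_inner M s (e n) = (\<Sum>m\<in>F. if m = n then a n else 0)"
      unfolding s_left[OF eL] using e by (intro sum.cong) (auto simp: L2_orthonormal_def)
    then have "L2_inner M s (e n) = a n" using that F by simp
    then show ?thesis by (subst L2_inner_commute) simp
  qed
  then have ss: "L2_inner M s s = (\<Sum>n\<in>F. a n * cnj (a n))"
    unfolding s_left[OF sL] by (intro sum.cong) auto
  have fsL: "(\<lambda>x. f x - s x) \<in> L2_space M" using f sL by (rule L2_space_minus)
  have "complex_of_real (L2_norm_sq M (\<lambda>x. f x - s x)) = L2_inner M f (\<lambda>x. f x - s x) - L2_inner M s (\<lambda>x. f x - s x)"
    unfolding L2_inner_self[symmetric] using f sL fsL by (rule L2_inner_diff_left)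
  also have "\<dots> = cnj (L2_inner M (\<lambda>x. f x - s x) f) - cnj (L2_inner M (\<lambda>x. f x - s x) s)"
    by (simp flip: L2_inner_commute)
  also have "\<dots> = (L2_inner M f f - L2_inner M f s) - (L2_inner M s f - L2_inner M s s)"
    using f sL by (simp add: L2_inner_diff_left flip: L2_inner_commute)
  also have "\<dots> = complex_of_real (L2_norm_sq M f)
     + (\<Sum>n\<in>F. a n * cnj (a n) - cnj (a n) * c n - a n * cnj (c n))"
    unfolding sf fs ss unfolding L2_inner_self by (simp add: sum_subtractf)
  also have "(\<Sum>n\<in>F. a n * cnj (a n) - cnj (a n) * c n - a n * cnj (c n))
     = (\<Sum>n\<in>F. complex_of_real ((cmod (c n - a n))\<^sup>2 - (cmod (c n))\<^sup>2))"
    unfolding of_real_diff complex_norm_square by (intro sum.cong) (auto simp: algebra_simps)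
  also have "complex_of_real (L2_norm_sq M f) + (\<Sum>n\<in>F. complex_of_real ((cmod (c n - a n))\<^sup>2 - (cmod (c n))\<^sup>2))
    = complex_of_real (L2_norm_sq M f - (\<Sum>n\<in>F. (cmod (c n))\<^sup>2) + (\<Sum>n\<in>F. (cmod (c n - a n))\<^sup>2))"
    by (simp add: sum_subtractf)
  finally show ?thesis unfolding of_real_eq_iff s_def c_def .
qed

definition finite_combinations :: "('i \<Rightarrow> 'a \<Rightarrow> complex) \<Rightarrow> ('a \<Rightarrow> complex) set" where
  "finite_combinations e = {t. \<exists>F a. finite F \<and> t = (\<lambda>x. \<Sum>n\<in>F. a n * e n x)}"

lemma finite_combinationsI: "finite F \<Longrightarrow> (\<lambda>x. \<Sum>n\<in>F. a n * e n x) \<in> finite_combinations e"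
  by (auto simp: finite_combinations_def)

lemma finite_combinationsE:
  assumes "t \<in> finite_combinations e"
  obtains F a where "finite F" "t = (\<lambda>x. \<Sum>n\<in>F. a n * e n x)"
  using assms by (auto simp: finite_combinations_def)

lemma finite_combinations_add:
  assumes s: "s \<in> finite_combinations e" and t: "t \<in> finite_combinations e"
  shows "(\<lambda>x. s x + t x) \<in> finite_combinations e"
proof -
  obtain F a where F: "finite F" "s = (\<lambda>x. \<Sum>n\<in>F. a n * e n x)"
    using s by (rule finite_combinationsE)
  obtain G b where G: "finite G" "t = (\<lambda>x. \<Sum>n\<in>G. b n * e n x)"
    using t by (rule finite_combinationsE)
  define c where "c n = (if n \<in> F then a n else 0) + (if n \<in> G then b n else 0)" for n
  have "(\<Sum>n\<in>F \<union> G. c n * e n x) = s x + t x" for x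
  proof -
    have "(\<Sum>n\<in>F \<union> G. (if n \<in> F then a n else 0) * e n x) = s x"
      unfolding F(2) using F G by (intro sum.mono_neutral_cong_right) auto
    moreover have "(\<Sum>n\<in>F \<union> G. (if n \<in> G then b n else 0) * e n x) = t x"
      unfolding G(2) using F G by (intro sum.mono_neutral_cong_right) auto
    ultimately show ?thesis by (simp add: c_def distrib_right sum.distrib)
  qed
  then have "(\<lambda>x. s x + t x) = (\<lambda>x. \<Sum>n\<in>F \<union> G. c n * e n x)" by simp
  then show ?thesis using F(1) G(1) finite_combinationsI[of "F \<union> G" c e] by simp
qed

lemma finite_combinations_scale:
  assumes "t \<in> finite_combinations e"
  shows "(\<lambda>x. c * t x) \<in> finite_combinations e"
proof -
  obtain F a where F: "finite F" "t = (\<lambda>x. \<Sum>n\<in>F. a n * e n x)"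
    using assms by (rule finite_combinationsE)
  then have "(\<lambda>x. c * t x) = (\<lambda>x. \<Sum>n\<in>F. (c * a n) * e n x)"
    by (simp add: sum_distrib_left mult.assoc)
  then show ?thesis using F(1) finite_combinationsI[of F "\<lambda>n. c * a n" e] by simp
qed

lemma finite_combinations_zero: "(\<lambda>x. 0) \<in> finite_combinations e"
  using finite_combinationsI[of "{}" _ e] by simp

lemma finite_combinations_base: "e n \<in> finite_combinations e"
  using finite_combinationsI[of "{n}" "\<lambda>_. 1" e] by simp

lemma finite_combinations_sum:
  assumes "\<And>i. i \<in> I \<Longrightarrow> f i \<in> finite_combinations e"
  shows "(\<lambda>x. \<Sum>i\<in>I. f i x) \<in> finite_combinations e"
  using assms
  by (induction I rule: infinite_finite_induct)
    (auto simp: finite_combinations_zero intro!: finite_combinations_add)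

lemma finite_combinations_L2:
  assumes "range e \<subseteq> L2_space M" shows "finite_combinations e \<subseteq> L2_space M"
  using assms by (auto simp: finite_combinations_def intro!: L2_space_sum L2_space_scale)

text \<open>
  Membership in the closure of the finite combinations. Parseval holds for each such function, and
  the closure properties below allow it to be established first for indicator functions.
\<close>

definition L2_approximable :: "'a measure \<Rightarrow> ('i \<Rightarrow> 'a \<Rightarrow> complex) \<Rightarrow> ('a \<Rightarrow> complex) \<Rightarrow> bool" where
  "L2_approximable M e f \<longleftrightarrow> f \<in> L2_space M \<and>
     (\<forall>\<epsilon>>0. \<exists>t\<in>finite_combinations e. L2_norm_sq M (\<lambda>x. f x - t x) < \<epsilon>)"

lemma L2_approximableE:
  assumes "L2_approximable M e f" "0 < \<epsilon>"
  obtains t where "t \<in> finite_combinations e" "L2_norm_sq M (\<lambda>x. f x - t x) < \<epsilon>"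
  using assms unfolding L2_approximable_def by blast

text \<open>
  The partial sums are bounded by Bessel, and a good approximation of \<open>f\<close> with indices in \<open>F\<close> shows
  that they are close to \<open>\<parallel>f\<parallel>\<^sup>2\<close> as soon as they include \<open>F\<close>.
\<close>

lemma parseval_has_sum:
  assumes e: "L2_orthonormal M e" and f: "L2_approximable M e f"
  shows "((\<lambda>n. (cmod (L2_inner M f (e n)))\<^sup>2) has_sum L2_norm_sq M f) UNIV"
proof -
  let ?c = "\<lambda>n. (cmod (L2_inner M f (e n)))\<^sup>2"
  have fL: "f \<in> L2_space M" using f by (simp add: L2_approximable_def)
  have bessel: "sum ?c F \<le> L2_norm_sq M f" if "finite F" for F
    using L2_norm_sq_orthonormal_diff[OF e fL that, of "\<lambda>n. L2_inner M f (e n)"]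
      L2_norm_sq_nonneg[of M "\<lambda>x. f x - (\<Sum>n\<in>F. L2_inner M f (e n) * e n x)"] by simp
  show ?thesis
    unfolding has_sum_def
  proof (rule tendstoI)
    fix \<epsilon> :: real assume "0 < \<epsilon>"
    then obtain t where t: "t \<in> finite_combinations e" "L2_norm_sq M (\<lambda>x. f x - t x) < \<epsilon>"
      using L2_approximableE[OF f] by blast
    then obtain F a where F: "finite F" "L2_norm_sq M (\<lambda>x. f x - (\<Sum>n\<in>F. a n * e n x)) < \<epsilon>"
      by (auto elim: finite_combinationsE)
    have "L2_norm_sq M f - \<epsilon> < sum ?c F"
    proof -
      have "0 \<le> (\<Sum>n\<in>F. (cmod (L2_inner M f (e n) - a n))\<^sup>2)" by (intro sum_nonneg) simp
      then show ?thesis using F(2) unfolding L2_norm_sq_orthonormal_diff[OF e fL F(1)] by linarith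
    qed
    then have "dist (sum ?c G) (L2_norm_sq M f) < \<epsilon>" if G: "finite G" "F \<subseteq> G" for G
      using sum_mono2[OF G, of ?c] bessel[OF G(1)] by (auto simp: dist_real_def)
    then show "\<forall>\<^sub>F G in finite_subsets_at_top UNIV. dist (sum ?c G) (L2_norm_sq M f) < \<epsilon>"
      unfolding eventually_finite_subsets_at_top using F(1) by blast
  qed
qed

lemma L2_approximable_add:
  assumes e: "range e \<subseteq> L2_space M" and f: "L2_approximable M e f" and g: "L2_approximable M e g"
  shows "L2_approximable M e (\<lambda>x. f x + g x)"
  unfolding L2_approximable_def
proof (intro conjI allI impI)
  have fL: "f \<in> L2_space M" and gL: "g \<in> L2_space M" using f g by (auto simp: L2_approximable_def)
  then show "(\<lambda>x. f x + g x) \<in> L2_space M" by (rule L2_space_add)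
  fix \<epsilon> :: real assume "0 < \<epsilon>"
  then have "0 < \<epsilon> / 4" by simp
  obtain s where s: "s \<in> finite_combinations e" "L2_norm_sq M (\<lambda>x. f x - s x) < \<epsilon> / 4"
    using L2_approximableE[OF f \<open>0 < \<epsilon> / 4\<close>] .
  obtain t where t: "t \<in> finite_combinations e" "L2_norm_sq M (\<lambda>x. g x - t x) < \<epsilon> / 4"
    using L2_approximableE[OF g \<open>0 < \<epsilon> / 4\<close>] .
  have L: "(\<lambda>x. f x - s x) \<in> L2_space M" "(\<lambda>x. g x - t x) \<in> L2_space M"
    using fL gL s t finite_combinations_L2[OF e] by (auto intro: L2_space_minus)
  have "(\<lambda>x. f x + g x - (s x + t x)) = (\<lambda>x. (f x - s x) + (g x - t x))"
    by (simp add: algebra_simps)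
  then have "L2_norm_sq M (\<lambda>x. f x + g x - (s x + t x)) < \<epsilon>"
    using L2_norm_sq_add_le[OF L] s(2) t(2) by simp
  then show "\<exists>t\<in>finite_combinations e. L2_norm_sq M (\<lambda>x. f x + g x - t x) < \<epsilon>"
    using finite_combinations_add[OF s(1) t(1)] by (intro bexI[of _ "\<lambda>x. s x + t x"])
qed

lemma L2_approximable_scale:
  assumes f: "L2_approximable M e f"
  shows "L2_approximable M e (\<lambda>x. c * f x)"
  unfolding L2_approximable_def
proof (intro conjI allI impI)
  show "(\<lambda>x. c * f x) \<in> L2_space M" using f by (auto simp: L2_approximable_def L2_space_scale)
  fix \<epsilon> :: real assume "0 < \<epsilon>"
  have C: "0 < (cmod c)\<^sup>2 + 1" by (simp add: add_nonneg_pos)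
  then have "0 < \<epsilon> / ((cmod c)\<^sup>2 + 1)" using \<open>0 < \<epsilon>\<close> by simp
  then obtain t where t: "t \<in> finite_combinations e"
    "L2_norm_sq M (\<lambda>x. f x - t x) < \<epsilon> / ((cmod c)\<^sup>2 + 1)"
    using L2_approximableE[OF f] by blast
  have "L2_norm_sq M (\<lambda>x. c * f x - c * t x) = (cmod c)\<^sup>2 * L2_norm_sq M (\<lambda>x. f x - t x)"
    by (simp flip: L2_norm_sq_scale right_diff_distrib)
  also have "\<dots> \<le> ((cmod c)\<^sup>2 + 1) * L2_norm_sq M (\<lambda>x. f x - t x)"
    by (intro mult_right_mono L2_norm_sq_nonneg) simp
  also have "\<dots> < \<epsilon>" using t(2) C by (simp add: pos_less_divide_eq mult.commute)
  finally show "\<exists>t\<in>finite_combinations e. L2_norm_sq M (\<lambda>x. c * f x - t x) < \<epsilon>"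
    using finite_combinations_scale[OF t(1)] by (intro bexI[of _ "\<lambda>x. c * t x"])
qed

lemma L2_approximable_zero: "L2_approximable M e (\<lambda>x. 0)"
  using finite_combinations_zero[of e]
  by (auto simp: L2_approximable_def L2_space_zero L2_norm_sq_def intro!: bexI[of _ "\<lambda>x. 0"])

lemma L2_approximable_sum:
  assumes "range e \<subseteq> L2_space M" "\<And>i. i \<in> I \<Longrightarrow> L2_approximable M e (f i)"
  shows "L2_approximable M e (\<lambda>x. \<Sum>i\<in>I. f i x)"
  using assms(2)
  by (induction I rule: infinite_finite_induct)
    (auto simp: L2_approximable_zero intro!: L2_approximable_add assms(1))

lemma L2_approximable_close:
  assumes e: "range e \<subseteq> L2_space M" and f: "f \<in> L2_space M"
    and close: "\<And>\<epsilon>. 0 < \<epsilon> \<Longrightarrow> \<exists>g. L2_approximable M e g \<and> L2_norm_sq M (\<lambda>x. f x - g x) < \<epsilon>"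
  shows "L2_approximable M e f"
  unfolding L2_approximable_def
proof (intro conjI allI impI)
  fix \<epsilon> :: real assume "0 < \<epsilon>"
  then have "0 < \<epsilon> / 4" by simp
  then obtain g where g: "L2_approximable M e g" "L2_norm_sq M (\<lambda>x. f x - g x) < \<epsilon> / 4"
    using close[of "\<epsilon> / 4"] by auto
  obtain t where t: "t \<in> finite_combinations e" "L2_norm_sq M (\<lambda>x. g x - t x) < \<epsilon> / 4"
    using L2_approximableE[OF g(1) \<open>0 < \<epsilon> / 4\<close>] .
  have gL: "g \<in> L2_space M" using g by (simp add: L2_approximable_def)
  have "(\<lambda>x. g x - t x) \<in> L2_space M"
    using gL t(1) finite_combinations_L2[OF e] by (auto intro: L2_space_minus)
  then have "L2_norm_sq M (\<lambda>x. f x - t x) < \<epsilon>"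
    using L2_norm_sq_add_le[OF L2_space_minus[OF f gL], of "\<lambda>x. g x - t x"] g(2) t(2) by simp
  then show "\<exists>t\<in>finite_combinations e. L2_norm_sq M (\<lambda>x. f x - t x) < \<epsilon>"
    using t(1) by blast
qed (rule f)

text \<open>Dominated convergence for the squared distances.\<close>

lemma L2_approximable_limit:
  assumes e: "range e \<subseteq> L2_space M" and f: "f \<in> L2_space M"
    and s: "\<And>i. L2_approximable M e (s i)"
    and lim: "\<And>x. x \<in> space M \<Longrightarrow> (\<lambda>i. s i x) \<longlonglongrightarrow> f x"
    and w: "integrable M w" "\<And>i x. x \<in> space M \<Longrightarrow> (cmod (f x - s i x))\<^sup>2 \<le> w x"
  shows "L2_approximable M e f"
proof (rule L2_approximable_close[OF e f])
  fix \<epsilon> :: real assume "0 < \<epsilon>"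
  have sL: "s i \<in> L2_space M" for i using s[of i] by (simp add: L2_approximable_def)
  have "(\<lambda>i. L2_norm_sq M (\<lambda>x. f x - s i x)) \<longlonglongrightarrow> (LINT x|M. 0)"
    unfolding L2_norm_sq_def
  proof (rule integral_dominated_convergence[OF _ _ w(1)])
    show "(\<lambda>x. (cmod (f x - s i x))\<^sup>2) \<in> borel_measurable M" for i
      using L2_spaceD(1)[OF L2_space_minus[OF f sL]] by measurable
    show "AE x in M. (\<lambda>i. (cmod (f x - s i x))\<^sup>2) \<longlonglongrightarrow> 0"
    proof (rule AE_I2)
      fix x assume x: "x \<in> space M"
      have "(\<lambda>i. (cmod (f x - s i x))\<^sup>2) \<longlonglongrightarrow> (cmod (f x - f x))\<^sup>2"
        by (intro tendsto_intros lim x)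
      then show "(\<lambda>i. (cmod (f x - s i x))\<^sup>2) \<longlonglongrightarrow> 0" by simp
    qed
  qed (use w(2) in auto)
  then have "\<forall>\<^sub>F i in sequentially. L2_norm_sq M (\<lambda>x. f x - s i x) < \<epsilon>"
    using order_tendstoD(2)[of _ "LINT x|M. 0" _ \<epsilon>] \<open>0 < \<epsilon>\<close> by simp
  then obtain i where "L2_norm_sq M (\<lambda>x. f x - s i x) < \<epsilon>"
    by (auto simp: eventually_sequentially)
  then show "\<exists>g. L2_approximable M e g \<and> L2_norm_sq M (\<lambda>x. f x - g x) < \<epsilon>" using s by blast
qed

section \<open>Translations and disjoint unions\<close>

lemma translation_lebesgue:
  fixes a :: "'a::euclidean_space"
  shows measurable_lebesgue_translation: "(+) a \<in> lebesgue \<rightarrow>\<^sub>M lebesgue"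
    and distr_lebesgue_translation: "distr lebesgue lebesgue ((+) a) = lebesgue"
proof -
  have T: "(\<lambda>x. a + (\<Sum>j\<in>Basis. (1 * (x \<bullet> j)) *\<^sub>R j)) = (+) a"
    by (simp add: euclidean_representation fun_eq_iff)
  show "(+) a \<in> lebesgue \<rightarrow>\<^sub>M lebesgue"
    using lebesgue_affine_measurable[of "\<lambda>_. 1" a] unfolding T by simp
  show "distr lebesgue lebesgue ((+) a) = lebesgue"
    using lebesgue_affine_euclidean[of "\<lambda>_. 1" a] unfolding T by (simp add: density_1)
qed

lemma measurable_lebesgue_on_translation:
  fixes a :: "'a::euclidean_space"
  shows "(+) a \<in> lebesgue_on S \<rightarrow>\<^sub>M lebesgue_on ((+) a ` S)"
  by (intro measurable_restrict_space3 measurable_lebesgue_translation) auto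

lemma distr_lebesgue_on_translation:
  fixes a :: "'a::euclidean_space"
  assumes S: "S \<in> sets lebesgue"
  shows "distr (lebesgue_on S) (lebesgue_on ((+) a ` S)) ((+) a) = lebesgue_on ((+) a ` S)"
proof (rule measure_eqI)
  fix A assume "A \<in> sets (distr (lebesgue_on S) (lebesgue_on ((+) a ` S)) ((+) a))"
  then have A: "A \<in> sets (lebesgue_on ((+) a ` S))" by simp
  have aS: "(+) a ` S \<in> sets lebesgue" using lebesgue_sets_translation[OF S] by simp
  have AL: "A \<in> sets lebesgue" "A \<subseteq> (+) a ` S"
    using A aS by (auto simp: sets_restrict_space_iff)
  have pre: "(+) a -` A \<inter> S = (+) a -` A" using AL(2) by auto
  have "emeasure (distr (lebesgue_on S) (lebesgue_on ((+) a ` S)) ((+) a)) A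
      = emeasure (lebesgue_on S) ((+) a -` A)"
    using emeasure_distr[OF measurable_lebesgue_on_translation A] by (simp add: pre)
  also have "\<dots> = emeasure lebesgue ((+) a -` A)"
    using S pre by (intro emeasure_restrict_space) auto
  also have "\<dots> = emeasure (distr lebesgue lebesgue ((+) a)) A"
    using emeasure_distr[OF measurable_lebesgue_translation AL(1), of a] by simp
  also have "\<dots> = emeasure (lebesgue_on ((+) a ` S)) A"
    using aS AL(2) by (simp add: distr_lebesgue_translation emeasure_restrict_space)
  finally show "emeasure (distr (lebesgue_on S) (lebesgue_on ((+) a ` S)) ((+) a)) A
      = emeasure (lebesgue_on ((+) a ` S)) A" .
qed simp

lemma borel_measurable_translation_iff:
  fixes f :: "'a::euclidean_space \<Rightarrow> 'b::topological_space"
  shows "f \<in> borel_measurable (lebesgue_on ((+) a ` S)) \<longleftrightarrow>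
    (\<lambda>x. f (a + x)) \<in> borel_measurable (lebesgue_on S)"
proof
  assume "f \<in> borel_measurable (lebesgue_on ((+) a ` S))"
  then show "(\<lambda>x. f (a + x)) \<in> borel_measurable (lebesgue_on S)"
    by (rule measurable_compose[OF measurable_lebesgue_on_translation])
next
  assume f: "(\<lambda>x. f (a + x)) \<in> borel_measurable (lebesgue_on S)"
  have S: "(+) (- a) ` (+) a ` S = S" by (simp add: image_image)
  have "(\<lambda>x. f (a + (- a + x))) \<in> borel_measurable (lebesgue_on ((+) a ` S))"
    by (rule measurable_compose[OF measurable_lebesgue_on_translation[of "- a" "(+) a ` S", unfolded S] f])
  then show "f \<in> borel_measurable (lebesgue_on ((+) a ` S))" by simp
qed

lemma integrable_translation_iff:
  fixes f :: "'a::euclidean_space \<Rightarrow> 'b::{banach, second_countable_topology}"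
  assumes S: "S \<in> sets lebesgue"
  shows "integrable (lebesgue_on ((+) a ` S)) f \<longleftrightarrow> integrable (lebesgue_on S) (\<lambda>x. f (a + x))"
proof (cases "f \<in> borel_measurable (lebesgue_on ((+) a ` S))")
  case True
  then show ?thesis
    using integrable_distr_eq[OF measurable_lebesgue_on_translation True]
    by (simp add: distr_lebesgue_on_translation[OF S])
next
  case False
  then show ?thesis using borel_measurable_translation_iff[of f a S] borel_measurable_integrable by blast
qed

lemma integral_translation:
  fixes f :: "'a::euclidean_space \<Rightarrow> 'b::{banach, second_countable_topology}"
  assumes S: "S \<in> sets lebesgue" and f: "f \<in> borel_measurable (lebesgue_on ((+) a ` S))"
  shows "(LINT x|lebesgue_on ((+) a ` S). f x) = (LINT x|lebesgue_on S. f (a + x))"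
  using integral_distr[OF measurable_lebesgue_on_translation f]
  by (simp add: distr_lebesgue_on_translation[OF S])

context
  fixes S :: "'k::finite \<Rightarrow> 'a::euclidean_space set"
  assumes S: "\<And>k. S k \<in> sets lebesgue" and disj: "disjoint_family S"
begin

lemma indicator_disjoint_union:
  fixes f :: "'a \<Rightarrow> 'b::real_vector"
  shows "indicator (\<Union>k. S k) x *\<^sub>R f x = (\<Sum>k\<in>UNIV. indicator (S k) x *\<^sub>R f x)"
proof -
  have "(indicator (\<Union>k. S k) x :: real) = (\<Sum>k\<in>UNIV. indicator (S k) x)"
    using disj by (subst indicator_UN_disjoint) auto
  then show ?thesis by (simp add: scaleR_sum_left)
qed

lemma borel_measurable_disjoint_union_iff:
  fixes f :: "'a \<Rightarrow> 'b::{second_countable_topology, real_normed_vector}"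
  shows "f \<in> borel_measurable (lebesgue_on (\<Union>k. S k)) \<longleftrightarrow>
    (\<forall>k. f \<in> borel_measurable (lebesgue_on (S k)))"
proof
  assume "f \<in> borel_measurable (lebesgue_on (\<Union>k. S k))"
  then show "\<forall>k. f \<in> borel_measurable (lebesgue_on (S k))"
    by (auto intro: measurable_restrict_mono)
next
  assume "\<forall>k. f \<in> borel_measurable (lebesgue_on (S k))"
  then have "(\<lambda>x. indicator (S k) x *\<^sub>R f x) \<in> borel_measurable lebesgue" for k
    using S by (simp add: borel_measurable_restrict_space_iff)
  then have "(\<lambda>x. \<Sum>k\<in>UNIV. indicator (S k) x *\<^sub>R f x) \<in> borel_measurable lebesgue"
    by (intro borel_measurable_sum)
  then show "f \<in> borel_measurable (lebesgue_on (\<Union>k. S k))"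
    using S by (simp add: borel_measurable_restrict_space_iff indicator_disjoint_union)
qed

lemma integral_disjoint_union:
  fixes f :: "'a \<Rightarrow> 'b::{banach, second_countable_topology}"
  shows integrable_disjoint_union_iff:
      "integrable (lebesgue_on (\<Union>k. S k)) f \<longleftrightarrow> (\<forall>k. integrable (lebesgue_on (S k)) f)" (is ?iff)
    and "integrable (lebesgue_on (\<Union>k. S k)) f \<Longrightarrow>
      (LINT x|lebesgue_on (\<Union>k. S k). f x) = (\<Sum>k\<in>UNIV. LINT x|lebesgue_on (S k). f x)"
proof -
  show iff: ?iff
  proof
    assume "integrable (lebesgue_on (\<Union>k. S k)) f"
    then have T: "integrable lebesgue (\<lambda>x. indicator (\<Union>k. S k) x *\<^sub>R f x)"
      using S by (simp add: integrable_restrict_space)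
    have "integrable (lebesgue_on (S k)) f" for k
    proof -
      have "(\<lambda>x. indicator (S k) x *\<^sub>R indicator (\<Union>k. S k) x *\<^sub>R f x) = (\<lambda>x. indicator (S k) x *\<^sub>R f x)"
        by (auto simp: indicator_def fun_eq_iff)
      then show ?thesis
        using integrable_mult_indicator[OF S T, of k] S by (simp add: integrable_restrict_space)
    qed
    then show "\<forall>k. integrable (lebesgue_on (S k)) f" by blast
  next
    assume "\<forall>k. integrable (lebesgue_on (S k)) f"
    then have "integrable lebesgue (\<lambda>x. indicator (S k) x *\<^sub>R f x)" for k
      using S by (simp add: integrable_restrict_space)
    then have "integrable lebesgue (\<lambda>x. \<Sum>k\<in>UNIV. indicator (S k) x *\<^sub>R f x)"
      by (intro Bochner_Integration.integrable_sum)
    then show "integrable (lebesgue_on (\<Union>k. S k)) f"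
      unfolding indicator_disjoint_union[symmetric] using S
      by (subst integrable_restrict_space) auto
  qed
  assume "integrable (lebesgue_on (\<Union>k. S k)) f"
  then have "\<And>k. integrable lebesgue (\<lambda>x. indicator (S k) x *\<^sub>R f x)"
    using S iff by (simp add: integrable_restrict_space)
  then have "(LINT x|lebesgue. indicator (\<Union>k. S k) x *\<^sub>R f x)
      = (\<Sum>k\<in>UNIV. LINT x|lebesgue. indicator (S k) x *\<^sub>R f x)"
    unfolding indicator_disjoint_union by (intro Bochner_Integration.integral_sum)
  moreover have "(LINT x|lebesgue_on A. f x) = (LINT x|lebesgue. indicator A x *\<^sub>R f x)"
    if "A \<in> sets lebesgue" for A
    using that by (intro integral_restrict_space) simp
  ultimately show "(LINT x|lebesgue_on (\<Union>k. S k). f x) = (\<Sum>k\<in>UNIV. LINT x|lebesgue_on (S k). f x)"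
    using S by (simp add: sets.finite_UN)
qed

end

section \<open>Characters on the unit cube\<close>

lemma unit_cube_measurable: "(unit_cube :: (real^'d) set) \<in> sets lebesgue"
proof -
  have "unit_cube = (\<Inter>i. {x :: real^'d. 0 \<le> x $ i} \<inter> {x. x $ i < 1})"
    by (auto simp: unit_cube_def)
  moreover have "{x :: real^'d. 0 \<le> x $ i} \<inter> {x. x $ i < 1} \<in> sets borel" for i
    by (intro sets.Int borel_closed borel_open closed_Collect_le open_Collect_less continuous_intros)
  then have "(\<Inter>i. {x :: real^'d. 0 \<le> x $ i} \<inter> {x. x $ i < 1}) \<in> sets borel"
    by (intro sets.finite_INT) auto
  ultimately have "(unit_cube :: (real^'d) set) \<in> sets borel" by simp
  then show ?thesis by simp
qed

lemma emeasure_unit_cube: "emeasure lebesgue (unit_cube :: (real^'d) set) = 1"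
proof (rule antisym)
  have One: "(One :: real^'d) \<bullet> b - 0 \<bullet> b = 1" if "b \<in> Basis" for b using that by simp
  have One_nth: "(One :: real^'d) $ i = 1" for i
  proof -
    have "axis i (1 :: real) \<in> Basis" by (auto simp: Basis_vec_def)
    then show ?thesis by (simp add: cart_eq_inner_axis)
  qed
  have "emeasure lebesgue (unit_cube :: (real^'d) set) \<le> emeasure lebesgue (cbox 0 (One :: real^'d))"
    by (intro emeasure_mono) (auto simp: unit_cube_def mem_box_cart One_nth less_imp_le simp del: sum_component)
  then show "emeasure lebesgue (unit_cube :: (real^'d) set) \<le> 1"
    by (simp add: emeasure_lborel_cbox_eq)
  have "emeasure lebesgue (box 0 (One :: real^'d)) \<le> emeasure lebesgue (unit_cube :: (real^'d) set)"
    by (intro emeasure_mono) (auto simp: unit_cube_measurable unit_cube_def mem_box_cart One_nth less_imp_le simp del: sum_component)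
  then show "1 \<le> emeasure lebesgue (unit_cube :: (real^'d) set)"
    by (simp add: emeasure_lborel_box_eq)
qed

lemma unit_cube_lmeasurable: "(unit_cube :: (real^'d) set) \<in> lmeasurable"
  by (simp add: fmeasurable_def unit_cube_measurable emeasure_unit_cube)

lemma finite_measure_unit_cube: "finite_measure (lebesgue_on (unit_cube :: (real^'d) set))"
  by (intro finite_measure_lebesgue_on unit_cube_lmeasurable)

lemma measure_unit_cube: "measure (lebesgue_on unit_cube) (unit_cube :: (real^'d) set) = 1"
  by (simp add: emeasure_restrict_space unit_cube_measurable measure_def emeasure_unit_cube)

lemma character_add_left: "character (\<xi> + \<eta>) x = character \<xi> x * character \<eta> x"
  by (simp add: character_def inner_add_left distrib_left flip: exp_add)

lemma character_add_right: "character \<xi> (x + y) = character \<xi> x * character \<xi> y"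
  by (simp add: character_def inner_add_right distrib_left flip: exp_add)

lemma character_zero: "character 0 = (\<lambda>_. 1)"
  by (simp add: character_def fun_eq_iff)

lemma cnj_character: "cnj (character \<xi> x) = character (- \<xi>) x"
  by (simp add: character_def exp_cnj)

lemma norm_character: "cmod (character \<xi> x) = 1"
  by (simp add: character_def)

lemma continuous_character: "continuous_on A (character \<xi>)"
  unfolding character_def by (intro continuous_intros)

lemma measurable_character: "character \<xi> \<in> borel_measurable (lebesgue_on S)"
proof -
  have "character \<xi> \<in> borel_measurable borel"
    by (intro borel_measurable_continuous_onI continuous_character)
  then have "character \<xi> \<in> borel_measurable lebesgue" by (intro measurable_completion) simp
  then show ?thesis by (rule measurable_restrict_space1)
qed

lemma character_integer: "character (int_vec n) (int_vec m) = 1"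
proof -
  have "int_vec n \<bullet> int_vec m = real_of_int (\<Sum>i\<in>UNIV. n $ i * m $ i)"
    by (simp add: int_vec_def inner_vec_def)
  then have "character (int_vec n) (int_vec m)
      = exp ((2 * of_int (\<Sum>i\<in>UNIV. n $ i * m $ i) * pi) * \<i>)"
    by (simp only: character_def of_real_of_int_eq) (simp add: mult_ac)
  then show ?thesis using exp_integer_2pi[OF Ints_of_int] by metis
qed

lemma int_vec_add: "int_vec (m + n) = int_vec m + int_vec n"
  by (simp add: int_vec_def vec_eq_iff)

lemma int_vec_zero: "int_vec 0 = 0"
  by (simp add: int_vec_def vec_eq_iff)

lemma int_vec_minus: "int_vec (- n) = - int_vec n"
  by (simp add: int_vec_def vec_eq_iff)

lemma int_vec_diff: "int_vec (m - n) = int_vec m - int_vec n"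
  by (simp add: int_vec_def vec_eq_iff)

lemma character_axis: "character (int_vec n) (c *\<^sub>R axis i 1) = exp (2 * complex_of_real pi * \<i> * complex_of_real (real_of_int (n $ i) * c))"
  by (simp add: character_def int_vec_def inner_axis mult.commute)

text \<open>
  Cut the cube into two slabs at height \<open>1 - a\<close> in a direction \<open>i\<close> with \<open>n\<^sub>i \<noteq> 0\<close>, and move them by \<open>a\<close>
  and \<open>a - 1\<close>; the translates fill the cube again. For \<open>a = 1 / (2 |n\<^sub>i|)\<close> both moves multiply the
  character by \<open>-1\<close>, so the integral equals its own negative.
\<close>

lemma integral_character_unit_cube:
  fixes n :: "int^'d"
  assumes "n \<noteq> 0"
  shows "(LINT x|lebesgue_on unit_cube. character (int_vec n) x) = 0"
proof -
  obtain i where i: "n $ i \<noteq> 0" using assms by (auto simp: vec_eq_iff)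
  define a where "a = 1 / (2 * \<bar>real_of_int (n $ i)\<bar>)"
  have "1 \<le> \<bar>real_of_int (n $ i)\<bar>" using i by linarith
  then have a: "0 < a" "a < 1" by (auto simp: a_def divide_less_eq)
  define v :: "bool \<Rightarrow> real^'d" where "v b = (if b then a else a - 1) *\<^sub>R axis i 1" for b
  define S :: "bool \<Rightarrow> (real^'d) set"
    where "S b = unit_cube \<inter> {x. if b then x $ i < 1 - a else 1 - a \<le> x $ i}" for b
  have "{x :: real^'d. x $ i < 1 - a} \<in> sets borel" "{x :: real^'d. 1 - a \<le> x $ i} \<in> sets borel"
    by (intro borel_open borel_closed open_Collect_less closed_Collect_le continuous_intros)+
  then have S: "S b \<in> sets lebesgue" for b
    unfolding S_def using unit_cube_measurable by (cases b) auto
  have disj: "disjoint_family S" by (auto simp: disjoint_family_on_def S_def split: if_splits)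
  have U: "(\<Union>b. S b) = unit_cube" by (auto simp: S_def UNIV_bool)
  have vS: "(+) (v b) ` S b = {x \<in> unit_cube. if b then a \<le> x $ i else x $ i < a}" for b
  proof -
    have "x \<in> (+) (v b) ` S b \<longleftrightarrow> x - v b \<in> S b" for x
      by (metis (no_types, lifting) add.commute diff_add_cancel image_iff add_diff_cancel_left')
    moreover have "x - v b \<in> S b \<longleftrightarrow> x \<in> {x \<in> unit_cube. if b then a \<le> x $ i else x $ i < a}" for x
    proof -
      have "(x - v b) $ j = (if j = i then x $ i - (if b then a else a - 1) else x $ j)" for j
        by (simp add: v_def axis_def)
      then show ?thesis
        using a by (cases b; simp add: S_def unit_cube_def) (smt (verit))+
    qed
    ultimately show ?thesis by blast
  qed
  have vS': "(+) (v b) ` S b \<in> sets lebesgue" for b by (intro lebesgue_sets_translation S)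
  have vdisj: "disjoint_family (\<lambda>b. (+) (v b) ` S b)"
    unfolding vS by (auto simp: disjoint_family_on_def split: if_splits)
  have vU: "(\<Union>b. (+) (v b) ` S b) = unit_cube" unfolding vS by (auto simp: UNIV_bool)
  let ?\<chi> = "character (int_vec n)"
  have chi_v: "?\<chi> (v b) = - 1" for b
  proof -
    have "?\<chi> (v True) = - 1"
    proof -
      have "real_of_int (n $ i) * a = 1 / 2 \<or> real_of_int (n $ i) * a = - 1 / 2"
        using i by (auto simp: a_def abs_if)
      then have "2 * complex_of_real pi * \<i> * complex_of_real (real_of_int (n $ i) * a) = complex_of_real pi * \<i> \<or>
          2 * complex_of_real pi * \<i> * complex_of_real (real_of_int (n $ i) * a) = - (complex_of_real pi * \<i>)"
        by (elim disjE; simp only:; simp)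
      moreover have "?\<chi> (v True) = exp (2 * complex_of_real pi * \<i> * complex_of_real (real_of_int (n $ i) * a))"
        by (simp only: v_def character_axis if_True)
      ultimately show ?thesis by (elim disjE; simp only: exp_minus exp_pi_i; simp)
    qed
    moreover have "?\<chi> (v True) = ?\<chi> (v False + int_vec (axis i 1))"
      by (rule arg_cong[where f = ?\<chi>]) (auto simp: v_def int_vec_def vec_eq_iff axis_def)
    ultimately show ?thesis by (cases b) (auto simp: character_add_right character_integer)
  qed
  have int: "integrable (lebesgue_on unit_cube) ?\<chi>"
  proof -
    interpret finite_measure "lebesgue_on (unit_cube :: (real^'d) set)" by (rule finite_measure_unit_cube)
    show ?thesis
      by (rule integrable_const_bound[where B = 1]) (auto simp: norm_character measurable_character)
  qed
  have "(LINT x|lebesgue_on unit_cube. ?\<chi> x) = (\<Sum>b\<in>UNIV. LINT x|lebesgue_on ((+) (v b) ` S b). ?\<chi> x)"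
    using integral_disjoint_union(2)[OF vS' vdisj, of ?\<chi>] int unfolding vU by simp
  also have "\<dots> = (\<Sum>b\<in>UNIV. LINT x|lebesgue_on (S b). ?\<chi> (v b + x))"
    by (intro sum.cong refl integral_translation S measurable_character)
  also have "\<dots> = - (\<Sum>b\<in>UNIV. LINT x|lebesgue_on (S b). ?\<chi> x)"
    by (simp add: character_add_right chi_v sum_negf)
  also have "(\<Sum>b\<in>UNIV. LINT x|lebesgue_on (S b). ?\<chi> x) = (LINT x|lebesgue_on unit_cube. ?\<chi> x)"
    using integral_disjoint_union(2)[OF S disj, of ?\<chi>] int unfolding U by simp
  finally show ?thesis by simp
qed

lemma characters_orthonormal:
  "L2_orthonormal (lebesgue_on (unit_cube :: (real^'d) set)) (\<lambda>n. character (int_vec n))"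
  unfolding L2_orthonormal_def
proof (intro conjI allI image_subsetI)
  show "character (int_vec n) \<in> L2_space (lebesgue_on (unit_cube :: (real^'d) set))" for n
    by (rule L2_space_bounded[where C = 1])
      (auto simp: finite_measure_unit_cube measurable_character norm_character)
  fix m n :: "int^'d"
  have "L2_inner (lebesgue_on unit_cube) (character (int_vec m)) (character (int_vec n))
      = (LINT x|lebesgue_on unit_cube. character (int_vec (m - n)) x)"
    unfolding L2_inner_def
    by (simp add: cnj_character int_vec_diff flip: character_add_left)
  also have "\<dots> = (if m = n then 1 else 0)"
  proof (cases "m = n")
    case True
    then show ?thesis
      by (simp add: int_vec_zero character_zero measure_unit_cube)
  next
    case False
    then show ?thesis by (simp add: integral_character_unit_cube)
  qed
  finally show "L2_inner (lebesgue_on unit_cube) (character (int_vec m)) (character (int_vec n))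
      = (if m = n then 1 else 0)" .
qed

section \<open>Density of trigonometric polynomials\<close>

abbreviation lattice_character :: "int^'d \<Rightarrow> real^'d \<Rightarrow> complex" where
  "lattice_character \<equiv> \<lambda>n. character (int_vec n)"

lemma trig_polynomial_mult:
  assumes s: "s \<in> finite_combinations lattice_character" and t: "t \<in> finite_combinations lattice_character"
  shows "(\<lambda>x. s x * t x) \<in> finite_combinations lattice_character"
proof -
  obtain F a where F: "finite F" "s = (\<lambda>x. \<Sum>m\<in>F. a m * lattice_character m x)"
    using s by (rule finite_combinationsE)
  obtain G b where G: "finite G" "t = (\<lambda>x. \<Sum>n\<in>G. b n * lattice_character n x)"
    using t by (rule finite_combinationsE)
  have "(\<lambda>x. s x * t x) = (\<lambda>x. \<Sum>m\<in>F. \<Sum>n\<in>G. (a m * b n) * lattice_character (m + n) x)"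
    by (simp add: F(2) G(2) sum_product int_vec_add character_add_left mult_ac)
  also have "\<dots> \<in> finite_combinations lattice_character"
    by (intro finite_combinations_sum finite_combinations_scale finite_combinations_base[where e = lattice_character])
  finally show ?thesis .
qed

text \<open>
  This map identifies opposite faces of the cube, so that continuous functions on \<open>complex^'d\<close> pull back
  to continuous periodic functions.
\<close>

definition torus_point :: "real^'d \<Rightarrow> complex^'d" where
  "torus_point x = (\<chi> j. lattice_character (axis j 1) x)"

lemma torus_point_nth: "torus_point x $ j = exp (2 * complex_of_real pi * \<i> * complex_of_real (x $ j))"
proof -
  have "int_vec (axis j 1) = axis j 1" by (simp add: int_vec_def axis_def vec_eq_iff)
  then show ?thesis by (simp add: torus_point_def character_def inner_axis')
qed

lemma continuous_torus_point: "continuous_on A torus_point"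
  unfolding torus_point_def by (intro continuous_on_vec_lambda continuous_character)

lemma inj_on_torus_point: "inj_on torus_point unit_cube"
proof (rule inj_onI)
  fix x y :: "real^'d" assume x: "x \<in> unit_cube" and y: "y \<in> unit_cube" and eq: "torus_point x = torus_point y"
  have "x $ j = y $ j" for j
  proof -
    have "exp (2 * complex_of_real pi * \<i> * complex_of_real (x $ j))
        = exp (2 * complex_of_real pi * \<i> * complex_of_real (y $ j))"
      using eq by (metis torus_point_nth)
    then obtain n :: int where "2 * complex_of_real pi * \<i> * complex_of_real (x $ j)
        = 2 * complex_of_real pi * \<i> * complex_of_real (y $ j) + (of_int (2 * n) * pi) * \<i>"
      unfolding exp_eq by blast
    then have "(2 * complex_of_real pi * \<i>) * (complex_of_real (x $ j) - complex_of_real (y $ j + of_int n)) = 0"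
      by (simp add: algebra_simps)
    then have "complex_of_real (x $ j) = complex_of_real (y $ j + of_int n)"
      by (simp only: mult_eq_0_iff) simp
    then have "x $ j = y $ j + of_int n" by (simp only: of_real_eq_iff)
    moreover have "0 \<le> x $ j" "x $ j < 1" "0 \<le> y $ j" "y $ j < 1"
      using x y by (auto simp: unit_cube_def)
    ultimately have "real_of_int n < 1" "-1 < real_of_int n" by linarith+
    then have "n = 0" by linarith
    then show ?thesis using \<open>x $ j = y $ j + of_int n\<close> by simp
  qed
  then show "x = y" by (simp add: vec_eq_iff)
qed

text \<open>
  Real and imaginary parts of the torus coordinates are combinations of a character and its conjugate,
  and products of characters are characters.
\<close>

lemma polynomial_on_torus:
  fixes q :: "complex^'d \<Rightarrow> real"
  assumes "real_polynomial_function q"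
  shows "(\<lambda>x. complex_of_real (q (torus_point x))) \<in> finite_combinations lattice_character"
  using assms
proof induction
  case (linear f)
  interpret f: bounded_linear f by fact
  have coord: "(\<lambda>x. complex_of_real (torus_point x \<bullet> b)) \<in> finite_combinations lattice_character"
    if basis: "b \<in> Basis" for b
  proof -
    obtain j u where b: "b = axis j u" "u = 1 \<or> u = \<i>"
      using basis unfolding Basis_vec_def Basis_complex_def by blast
    let ?e = "lattice_character (axis j 1)" and ?e' = "lattice_character (- axis j 1)"
    have e': "?e' x = cnj (?e x)" for x by (simp add: cnj_character int_vec_minus)
    define c :: complex where "c = (if u = 1 then 1 / 2 else - \<i> / 2)"
    have "complex_of_real (torus_point x \<bullet> b) = c * ?e x + cnj c * ?e' x" for x
      using b(2) unfolding b(1) c_def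
      by (auto simp: inner_axis torus_point_def inner_complex_def e' complex_eq_iff)
    then show ?thesis
      by (auto intro!: finite_combinations_add finite_combinations_scale
          finite_combinations_base[where e = lattice_character])
  qed
  have "f (torus_point x) = f (\<Sum>b\<in>Basis. (torus_point x \<bullet> b) *\<^sub>R b)" for x
    by (simp add: euclidean_representation)
  then have "complex_of_real (f (torus_point x)) = (\<Sum>b\<in>Basis. complex_of_real (f b) * complex_of_real (torus_point x \<bullet> b))" for x
    by (simp add: f.sum f.scaleR mult.commute del: euclidean_representation)
  then show ?case by (auto intro!: finite_combinations_sum finite_combinations_scale coord)
next
  case (const c)
  have "(\<lambda>x. complex_of_real c * lattice_character 0 x) \<in> finite_combinations lattice_character"
    by (intro finite_combinations_scale finite_combinations_base[where e = lattice_character])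
  then show ?case by (simp add: int_vec_zero character_zero)
next
  case (add f g)
  then show ?case by (auto intro!: finite_combinations_add)
next
  case (mult f g)
  then show ?case by (auto intro!: trig_polynomial_mult)
qed

abbreviation cube_measure :: "(real^'d) measure" where
  "cube_measure \<equiv> lebesgue_on unit_cube"

lemma characters_L2: "range lattice_character \<subseteq> L2_space cube_measure"
  by (rule conjunct1[OF characters_orthonormal[unfolded L2_orthonormal_def]])

lemma L2_norm_sq_le_const:
  fixes f :: "real^'d \<Rightarrow> complex"
  assumes "\<And>x. x \<in> unit_cube \<Longrightarrow> cmod (f x) \<le> C" "f \<in> borel_measurable cube_measure" "0 \<le> C"
  shows "L2_norm_sq cube_measure f \<le> C\<^sup>2"
proof -
  interpret finite_measure "cube_measure :: (real^'d) measure" by (rule finite_measure_unit_cube)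
  have "f \<in> L2_space cube_measure"
    using assms by (intro L2_space_bounded[where C = C]) (auto simp: finite_measure_unit_cube)
  then have "L2_norm_sq cube_measure f \<le> (LINT x|(cube_measure :: (real^'d) measure). C\<^sup>2)"
    unfolding L2_norm_sq_def
    by (intro Bochner_Integration.integral_mono L2_spaceD(2)) (auto intro!: power_mono assms(1))
  then show ?thesis by (simp add: measure_unit_cube)
qed

text \<open>
  Stone-Weierstrass on the compact torus; uniform approximation on the cube is approximation in norm because the
  cube has measure one.
\<close>

lemma continuous_on_torus_approximable:
  fixes g :: "complex^'d \<Rightarrow> real"
  assumes g: "continuous_on UNIV g"
  shows "L2_approximable cube_measure lattice_character (\<lambda>x. complex_of_real (g (torus_point x)))"
  unfolding L2_approximable_def
proof (intro conjI allI impI)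
  let ?f = "\<lambda>x. complex_of_real (g (torus_point x))"
  let ?S = "torus_point ` cbox 0 (\<chi> i. 1) :: (complex^'d) set"
  have cube: "torus_point x \<in> ?S" if "x \<in> unit_cube" for x
    using that by (intro imageI) (auto simp: unit_cube_def mem_box_cart less_imp_le)
  have S: "compact ?S"
    by (intro compact_continuous_image continuous_torus_point compact_cbox)
  have "continuous_on UNIV ?f"
    by (intro continuous_on_of_real continuous_on_compose2[OF g] continuous_torus_point) auto
  then have meas: "?f \<in> borel_measurable cube_measure"
    using borel_measurable_continuous_onI[of ?f]
    by (intro measurable_restrict_space1 measurable_completion) auto
  have "bounded (g ` ?S)"
    by (rule compact_imp_bounded[OF compact_continuous_image[OF continuous_on_subset[OF g] S]]) simp
  then obtain C where "\<And>z. z \<in> ?S \<Longrightarrow> \<bar>g z\<bar> \<le> C" by (auto simp: bounded_iff)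
  then show fL: "?f \<in> L2_space cube_measure"
    using meas cube by (intro L2_space_bounded[where C = C]) (auto simp: finite_measure_unit_cube)
  fix \<epsilon> :: real assume "0 < \<epsilon>"
  define \<delta> where "\<delta> = min 1 (\<epsilon> / 2)"
  have \<delta>: "0 < \<delta>" "\<delta>\<^sup>2 < \<epsilon>"
  proof -
    show "0 < \<delta>" using \<open>0 < \<epsilon>\<close> by (simp add: \<delta>_def)
    then have "\<delta> * \<delta> \<le> 1 * (\<epsilon> / 2)" by (intro mult_mono) (auto simp: \<delta>_def)
    then show "\<delta>\<^sup>2 < \<epsilon>" using \<open>0 < \<epsilon>\<close> by (simp add: power2_eq_square)
  qed
  obtain q where q: "real_polynomial_function q" "\<And>z. z \<in> ?S \<Longrightarrow> \<bar>g z - q z\<bar> < \<delta>"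
    using Stone_Weierstrass_real_polynomial_function[OF S continuous_on_subset[OF g] \<delta>(1)] by auto
  let ?t = "\<lambda>x. complex_of_real (q (torus_point x))"
  have t: "?t \<in> finite_combinations lattice_character" using q(1) by (rule polynomial_on_torus)
  then have "?t \<in> L2_space cube_measure" using finite_combinations_L2[OF characters_L2] by blast
  then have "(\<lambda>x. ?f x - ?t x) \<in> borel_measurable cube_measure"
    using L2_spaceD(1)[OF L2_space_minus[OF fL]] by blast
  moreover have "cmod (?f x - ?t x) \<le> \<delta>" if "x \<in> unit_cube" for x
    using q(2)[OF cube[OF that]] by (simp flip: of_real_diff)
  ultimately have "L2_norm_sq cube_measure (\<lambda>x. ?f x - ?t x) < \<epsilon>"
    using L2_norm_sq_le_const[of "\<lambda>x. ?f x - ?t x" \<delta>] \<delta> by auto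
  then show "\<exists>t\<in>finite_combinations lattice_character. L2_norm_sq cube_measure (\<lambda>x. ?f x - t x) < \<epsilon>"
    using t by (intro bexI[of _ ?t])
qed

text \<open>
  As \<open>torus_point\<close> is injective on the half-open cube, a point outside \<open>T\<close> has positive distance from
  the compact image of \<open>T\<close> on the torus. Cut-off functions of this distance are continuous on the torus
  and converge pointwise to the indicator function, even where \<open>T\<close> meets the boundary of the cube.
\<close>

lemma indicator_compact_approximable:
  fixes T :: "(real^'d) set"
  assumes T: "compact T" "T \<subseteq> unit_cube"
  shows "L2_approximable cube_measure lattice_character (indicator T)"
proof (cases "T = {}")
  case True
  then have "(indicator T :: real^'d \<Rightarrow> complex) = (\<lambda>x. 0)" by (simp add: fun_eq_iff)
  then show ?thesis using L2_approximable_zero[of cube_measure lattice_character] by simp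
next
  case False
  let ?K = "torus_point ` T"
  have K: "closed ?K" "?K \<noteq> {}"
    using T False by (auto intro!: compact_imp_closed compact_continuous_image continuous_torus_point)
  define g where "g m z = max 0 (1 - real m * infdist z ?K)" for m z
  have g01: "0 \<le> g m z" "g m z \<le> 1" for m z
    by (auto simp: g_def infdist_nonneg)
  have ind_meas: "(indicator T :: real^'d \<Rightarrow> complex) \<in> borel_measurable cube_measure"
    using T(1) by (intro borel_measurable_indicator measurable_restrict_space1) 
      (auto simp: sets_restrict_space_iff unit_cube_measurable T(2) compact_imp_closed)
  show ?thesis
  proof (rule L2_approximable_limit[OF characters_L2, where w = "\<lambda>_. 1"
        and s = "\<lambda>m x. complex_of_real (g m (torus_point x))"])
    show "(indicator T :: real^'d \<Rightarrow> complex) \<in> L2_space cube_measure"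
      using ind_meas by (intro L2_space_bounded[where C = 1])
        (auto simp: finite_measure_unit_cube indicator_def)
    show "L2_approximable cube_measure lattice_character (\<lambda>x. complex_of_real (g m (torus_point x)))" for m
      unfolding g_def by (intro continuous_on_torus_approximable continuous_intros)
    show "integrable (cube_measure :: (real^'d) measure) (\<lambda>_. 1 :: real)"
      using finite_measure_unit_cube finite_measure.integrable_const by blast
    fix x :: "real^'d" assume "x \<in> space cube_measure"
    then have x: "x \<in> unit_cube" by simp
    show "(\<lambda>m. complex_of_real (g m (torus_point x))) \<longlonglongrightarrow> indicator T x"
    proof (cases "x \<in> T")
      case True
      then have "infdist (torus_point x) ?K = 0" by simp
      then show ?thesis using True by (simp add: g_def)
    next
      case False
      then have "torus_point x \<notin> ?K"
        using inj_on_torus_point x T(2) by (auto dest: inj_onD)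
      then have pos: "0 < infdist (torus_point x) ?K"
        using K in_closed_iff_infdist_zero[of ?K] infdist_nonneg[of "torus_point x" ?K] by force
      obtain N where N: "1 / infdist (torus_point x) ?K < real N" using reals_Archimedean2 by blast
      have "g m (torus_point x) = 0" if "N \<le> m" for m
      proof -
        have "1 / infdist (torus_point x) ?K < real m" using N that by (meson less_le_trans of_nat_mono)
        then have "1 < real m * infdist (torus_point x) ?K" using pos by (simp add: divide_less_eq)
        then show ?thesis by (simp add: g_def)
      qed
      then have "\<forall>\<^sub>F m in sequentially. complex_of_real (g m (torus_point x)) = indicator T x"
        using False by (auto simp: eventually_sequentially intro!: exI[of _ N])
      then show ?thesis by (rule tendsto_eventually)
    qed
    show "(cmod (indicator T x - complex_of_real (g m (torus_point x))))\<^sup>2 \<le> 1" for m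
    proof -
      have "indicator T x - complex_of_real (g m (torus_point x))
          = complex_of_real (indicator T x - g m (torus_point x))" by (simp add: indicator_def)
      then have "cmod (indicator T x - complex_of_real (g m (torus_point x)))
          = \<bar>indicator T x - g m (torus_point x)\<bar>" by (simp only: norm_of_real)
      then show ?thesis using g01[of m "torus_point x"]
        by (simp add: abs_square_le_1) (auto simp: indicator_def)
    qed
  qed
qed

text \<open>Inner regularity of Lebesgue measure reduces measurable sets to compact ones.\<close>

lemma indicator_approximable:
  fixes A :: "(real^'d) set"
  assumes A: "A \<in> sets cube_measure"
  shows "L2_approximable cube_measure lattice_character (indicator A)"
proof (rule L2_approximable_close[OF characters_L2])
  have AQ: "A \<in> sets lebesgue" "A \<subseteq> unit_cube"
    using A by (auto simp: sets_restrict_space_iff unit_cube_measurable)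
  show "(indicator A :: real^'d \<Rightarrow> complex) \<in> L2_space cube_measure"
    using A by (intro L2_space_bounded[where C = 1])
      (auto simp: finite_measure_unit_cube indicator_def intro!: borel_measurable_indicator)
  fix \<epsilon> :: real assume "0 < \<epsilon>"
  then obtain T where T: "closed T" "T \<subseteq> A" "A - T \<in> lmeasurable" "emeasure lebesgue (A - T) < ennreal \<epsilon>"
    using sets_lebesgue_inner_closed[OF AQ(1)] by blast
  have "bounded (unit_cube :: (real^'d) set)"
    by (rule bounded_subset[OF bounded_cbox[of 0 "\<chi> i. 1"]])
      (auto simp: unit_cube_def mem_box_cart less_imp_le)
  then have "compact T" using T AQ(2) by (meson bounded_subset compact_eq_bounded_closed)
  then have "L2_approximable cube_measure lattice_character (indicator T)"
    using T(2) AQ(2) by (intro indicator_compact_approximable) auto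
  moreover have "L2_norm_sq cube_measure (\<lambda>x. indicator A x - indicator T x) < \<epsilon>"
  proof -
    have "(cmod (indicator A x - indicator T x))\<^sup>2 = indicator (A - T) x" for x :: "real^'d"
      using T(2) by (auto simp: indicator_def)
    then have "L2_norm_sq cube_measure (\<lambda>x. indicator A x - indicator T x)
        = measure cube_measure ((A - T) \<inter> unit_cube)"
      by (simp add: L2_norm_sq_def)
    also have "\<dots> = measure lebesgue (A - T)"
      using AQ(2) by (subst measure_restrict_space) (auto simp: unit_cube_measurable intro!: arg_cong[where f = "measure lebesgue"])
    also have "\<dots> < \<epsilon>"
      using T(3,4) \<open>0 < \<epsilon>\<close> by (simp add: emeasure_eq_measure2 ennreal_less_iff)
    finally show ?thesis .
  qed
  ultimately show "\<exists>g. L2_approximable cube_measure lattice_character g \<and>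
      L2_norm_sq cube_measure (\<lambda>x. indicator A x - g x) < \<epsilon>" by blast
qed

text \<open>
  Simple functions are dense; those used here are dominated by \<open>2 |f|\<close>, hence the factor 9 in the
  dominating function for the squared differences.
\<close>

lemma L2_cube_approximable:
  fixes f :: "real^'d \<Rightarrow> complex"
  assumes f: "f \<in> L2_space cube_measure"
  shows "L2_approximable cube_measure lattice_character f"
proof -
  let ?M = "cube_measure :: (real^'d) measure"
  obtain s where s: "\<And>i. simple_function ?M (s i)" "\<And>x. x \<in> space ?M \<Longrightarrow> (\<lambda>i. s i x) \<longlonglongrightarrow> f x"
    "\<And>i x. x \<in> space ?M \<Longrightarrow> dist (s i x) 0 \<le> 2 * dist (f x) 0"
    using borel_measurable_implies_sequence_metric[OF L2_spaceD(1)[OF f], of 0] by blast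
  define r where "r i x = (\<Sum>y\<in>s i ` space ?M. y * indicator (s i -` {y} \<inter> space ?M) x)" for i x
  have rs: "r i x = s i x" if "x \<in> space ?M" for i x
  proof -
    have "r i x = (\<Sum>y\<in>s i ` space ?M. if y = s i x then y else 0)"
      unfolding r_def using that by (intro sum.cong) (auto simp: indicator_def)
    then show ?thesis using that simple_functionD(1)[OF s(1)] by simp
  qed
  show ?thesis
  proof (rule L2_approximable_limit[OF characters_L2 f, where s = r and w = "\<lambda>x. 9 * (cmod (f x))\<^sup>2"])
    show "L2_approximable ?M lattice_character (r i)" for i
      unfolding r_def
      by (intro L2_approximable_sum L2_approximable_scale indicator_approximable characters_L2
          simple_functionD(2) s(1))
    show "integrable ?M (\<lambda>x. 9 * (cmod (f x))\<^sup>2)" using L2_spaceD(2)[OF f] by simp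
    fix x assume x: "x \<in> space ?M"
    show "(\<lambda>i. r i x) \<longlonglongrightarrow> f x" using s(2)[OF x] by (simp add: rs[OF x])
    fix i
    have "cmod (f x - r i x) \<le> 3 * cmod (f x)"
      using s(3)[OF x, of i] norm_triangle_ineq4[of "f x" "s i x"] by (simp add: rs[OF x])
    then have "(cmod (f x - r i x))\<^sup>2 \<le> (3 * cmod (f x))\<^sup>2" by (intro power_mono) auto
    then show "(cmod (f x - r i x))\<^sup>2 \<le> 9 * (cmod (f x))\<^sup>2" by (simp add: power_mult_distrib)
  qed
qed

section \<open>Fibres over a union of lattice translates of the cube\<close>

lemma multi_tile_eq: "multi_tile p = (\<Union>k. (+) (int_vec (p k)) ` unit_cube)"
  by (simp add: multi_tile_def add.commute)

lemma tile_measurable: "(+) (int_vec m) ` (unit_cube :: (real^'d) set) \<in> sets lebesgue"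
  by (intro lebesgue_sets_translation unit_cube_measurable)

lemma tiles_disjoint:
  fixes p :: "'n::finite \<Rightarrow> int^'d"
  assumes "inj p"
  shows "disjoint_family (\<lambda>k. (+) (int_vec (p k)) ` unit_cube)"
proof -
  have "p k = p l" if x: "x \<in> (+) (int_vec (p k)) ` unit_cube" "x \<in> (+) (int_vec (p l)) ` unit_cube" for k l x
  proof -
    obtain u v where "u \<in> unit_cube" "v \<in> unit_cube" "int_vec (p k) + u = int_vec (p l) + v"
      using x by (metis imageE)
    then have *: "real_of_int (p k $ i) + u $ i = real_of_int (p l $ i) + v $ i"
      "0 \<le> u $ i" "u $ i < 1" "0 \<le> v $ i" "v $ i < 1" for i
      by (auto simp: unit_cube_def int_vec_def vec_eq_iff)
    have "p k $ i = p l $ i" for i using *[of i] by linarith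
    then show ?thesis by (simp add: vec_eq_iff)
  qed
  then have "k = l" if "x \<in> (+) (int_vec (p k)) ` unit_cube" "x \<in> (+) (int_vec (p l)) ` unit_cube" for k l x
    using that assms by (meson injD)
  then show ?thesis unfolding disjoint_family_on_def by blast
qed

context
  fixes p :: "'n::finite \<Rightarrow> int^'d"
  assumes inj: "inj p"
begin

lemma multi_tile_integral:
  fixes f :: "real^'d \<Rightarrow> 'b::{banach, second_countable_topology}"
  shows multi_tile_integrable_iff:
      "integrable (lebesgue_on (multi_tile p)) f \<longleftrightarrow>
        (\<forall>k. integrable cube_measure (\<lambda>x. f (int_vec (p k) + x)))" (is ?iff)
    and "integrable (lebesgue_on (multi_tile p)) f \<Longrightarrow>
      (LINT x|lebesgue_on (multi_tile p). f x)
        = (\<Sum>k\<in>UNIV. LINT x|cube_measure. f (int_vec (p k) + x))"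
proof -
  note union = integral_disjoint_union[OF tile_measurable tiles_disjoint[OF inj]]
  show ?iff
    unfolding multi_tile_eq union(1) by (simp add: integrable_translation_iff unit_cube_measurable)
  assume f: "integrable (lebesgue_on (multi_tile p)) f"
  then have "f \<in> borel_measurable (lebesgue_on ((+) (int_vec (p k)) ` unit_cube))" for k
    unfolding multi_tile_eq union(1) using borel_measurable_integrable by blast
  then show "(LINT x|lebesgue_on (multi_tile p). f x)
        = (\<Sum>k\<in>UNIV. LINT x|cube_measure. f (int_vec (p k) + x))"
    using union(2)[of f] f unfolding multi_tile_eq
    by (simp add: integral_translation unit_cube_measurable)
qed

lemma multi_tile_L2_iff:
  "f \<in> L2_space (lebesgue_on (multi_tile p)) \<longleftrightarrow>
    (\<forall>k. (\<lambda>x. f (int_vec (p k) + x)) \<in> L2_space cube_measure)"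
proof -
  have "f \<in> borel_measurable (lebesgue_on (multi_tile p)) \<longleftrightarrow>
    (\<forall>k. (\<lambda>x. f (int_vec (p k) + x)) \<in> borel_measurable cube_measure)"
    unfolding multi_tile_eq
      borel_measurable_disjoint_union_iff[OF tile_measurable tiles_disjoint[OF inj]]
    by (simp add: borel_measurable_translation_iff)
  then show ?thesis by (auto simp: L2_space_def multi_tile_integrable_iff)
qed

lemma multi_tile_L2_norm_sq:
  assumes "f \<in> L2_space (lebesgue_on (multi_tile p))"
  shows "L2_norm_sq (lebesgue_on (multi_tile p)) f
    = (\<Sum>k\<in>UNIV. L2_norm_sq cube_measure (\<lambda>x. f (int_vec (p k) + x)))"
  unfolding L2_norm_sq_def by (rule multi_tile_integral(2)[OF L2_spaceD(2)[OF assms]])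

lemma multi_tile_L2_inner:
  assumes "f \<in> L2_space (lebesgue_on (multi_tile p))" "g \<in> L2_space (lebesgue_on (multi_tile p))"
  shows "L2_inner (lebesgue_on (multi_tile p)) f g
    = (\<Sum>k\<in>UNIV. L2_inner cube_measure (\<lambda>x. f (int_vec (p k) + x)) (\<lambda>x. g (int_vec (p k) + x)))"
  unfolding L2_inner_def by (rule multi_tile_integral(2)[OF L2_product_integrable[OF assms]])

lemma exists_constant_on_tiles:
  obtains f where "f \<in> L2_space (lebesgue_on (multi_tile p))"
    "\<And>k x. x \<in> unit_cube \<Longrightarrow> f (int_vec (p k) + x) = c k"
proof
  let ?tile = "\<lambda>k. (+) (int_vec (p k)) ` unit_cube"
  define f :: "real^'d \<Rightarrow> complex" where "f x = (\<Sum>k\<in>UNIV. if x \<in> ?tile k then c k else 0)" for x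
  show f: "f (int_vec (p k) + x) = c k" if "x \<in> unit_cube" for k x
  proof -
    have "int_vec (p k) + x \<in> ?tile l \<longleftrightarrow> l = k" for l
      using that tiles_disjoint[OF inj] by (auto simp: disjoint_family_on_def)
    then show ?thesis by (simp add: f_def)
  qed
  have "(\<lambda>x. f (int_vec (p k) + x)) \<in> L2_space cube_measure" for k
  proof (rule L2_space_bounded[OF finite_measure_unit_cube])
    have "(\<lambda>x. f (int_vec (p k) + x)) \<in> borel_measurable cube_measure
        \<longleftrightarrow> (\<lambda>_. c k) \<in> borel_measurable (cube_measure :: (real^'d) measure)"
      by (rule measurable_cong) (simp add: f)
    then show "(\<lambda>x. f (int_vec (p k) + x)) \<in> borel_measurable cube_measure" by simp
    show "cmod (f (int_vec (p k) + x)) \<le> cmod (c k)" if "x \<in> space cube_measure" for x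
      using that by (simp add: f)
  qed
  then show "f \<in> L2_space (lebesgue_on (multi_tile p))" by (simp add: multi_tile_L2_iff)
qed

end

lemma vector_L2_norm_sq:
  fixes H :: "'a \<Rightarrow> complex^'j"
  assumes "\<And>j. (\<lambda>x. H x $ j) \<in> L2_space M"
  shows "integrable M (\<lambda>x. (norm (H x))\<^sup>2)"
    and "(LINT x|M. (norm (H x))\<^sup>2) = (\<Sum>j\<in>UNIV. L2_norm_sq M (\<lambda>x. H x $ j))"
  using L2_spaceD(2)[OF assms] by (simp_all add: norm_vec_power2 L2_norm_sq_def)

lemma matrix_vector_L2:
  fixes H :: "'a \<Rightarrow> complex^'j"
  assumes "\<And>j. (\<lambda>x. H x $ j) \<in> L2_space M"
  shows "(\<lambda>x. (A *v H x) $ i) \<in> L2_space M"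
  unfolding matrix_vector_mult_def by (simp, intro L2_space_sum L2_space_scale assms)

lemma L2_space_cnj: "f \<in> L2_space M \<Longrightarrow> (\<lambda>x. cnj (f x)) \<in> L2_space M"
  by (auto simp: L2_space_def intro: borel_measurable_cnj)

lemma L2_norm_sq_cnj: "L2_norm_sq M (\<lambda>x. cnj (f x)) = L2_norm_sq M f"
  by (simp add: L2_norm_sq_def)

lemma L2_space_character_mult:
  assumes "f \<in> L2_space (lebesgue_on S)"
  shows "(\<lambda>x. character \<xi> x * f x) \<in> L2_space (lebesgue_on S)"
  using L2_spaceD[OF assms] measurable_character[of \<xi> S]
  by (auto simp: L2_space_def norm_mult norm_character intro: borel_measurable_times)

lemma L2_norm_sq_character_mult: "L2_norm_sq M (\<lambda>x. character \<xi> x * f x) = L2_norm_sq M f"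
  by (simp add: L2_norm_sq_def norm_mult norm_character)

text \<open>
  The integer frequency \<open>n\<close> does not see the shift by the integer vector \<open>p\<^sub>k\<close>.
\<close>

lemma exp_system_on_tile:
  "exp_system \<delta> (j, n) (int_vec (p k) + x)
    = Gamma_matrix \<delta> p $ j $ k * character (\<delta> j) x * lattice_character n x"
  by (simp add: exp_system_def Gamma_matrix_def character_add_left character_add_right
      character_integer mult_ac)

lemma exp_system_L2:
  fixes \<delta> :: "'l::finite \<Rightarrow> real^'d" and p :: "'n::finite \<Rightarrow> int^'d"
  assumes "inj p"
  shows "exp_system \<delta> i \<in> L2_space (lebesgue_on (multi_tile p))"
proof -
  obtain j n where i: "i = (j, n)" by (cases i)
  have "(\<lambda>x. Gamma_matrix \<delta> p $ j $ k * (character (\<delta> j) x * lattice_character n x)) \<in> L2_space cube_measure" for k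
    using characters_L2 by (intro L2_space_scale L2_space_character_mult) blast
  then show ?thesis unfolding i multi_tile_L2_iff[OF assms] exp_system_on_tile
    by (simp add: mult.assoc)
qed

section \<open>Frame bounds of the exponential system\<close>

lemma has_sum_ennreal:
  assumes "(f has_sum S) A" "\<And>i. 0 \<le> f i"
  shows "((\<lambda>i. ennreal (f i)) has_sum ennreal S) A"
proof -
  have "sum (\<lambda>i. ennreal (f i)) = (\<lambda>F. ennreal (sum f F))"
    using assms(2) by (simp add: fun_eq_iff sum_ennreal)
  then show ?thesis using tendsto_ennrealI[OF assms(1)[unfolded has_sum_def]] by (simp add: has_sum_def)
qed

text \<open>
  The entries are conjugated so that the coefficients of \<open>f\<close>, which involve conjugates of the matrix
  entries, become conjugates of the entries of the matrix applied to the fibre.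
\<close>

definition tile_fiber :: "('n \<Rightarrow> int^'d) \<Rightarrow> (real^'d \<Rightarrow> complex) \<Rightarrow> real^'d \<Rightarrow> complex^'n" where
  "tile_fiber p f x = (\<chi> k. cnj (f (int_vec (p k) + x)))"

text \<open>
  For fixed \<open>j\<close> the coefficients of \<open>f\<close> are the Fourier coefficients of a single function on the cube,
  whose modulus is that of the \<open>j\<close>-th entry of the matrix applied to the fibre; apply Parseval and sum
  over \<open>j\<close>.
\<close>

lemma frame_coefficients_sum:
  fixes \<delta> :: "'l::finite \<Rightarrow> real^'d" and p :: "'n::finite \<Rightarrow> int^'d"
  assumes inj: "inj p" and f: "f \<in> L2_space (lebesgue_on (multi_tile p))"
  shows "(\<Sum>\<^sub>\<infinity>i. ennreal ((cmod (L2_inner (lebesgue_on (multi_tile p)) f (exp_system \<delta> i)))\<^sup>2))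
    = ennreal (LINT x|cube_measure. (norm (Gamma_matrix \<delta> p *v tile_fiber p f x))\<^sup>2)"
proof -
  let ?\<Gamma> = "Gamma_matrix \<delta> p" and ?M = "lebesgue_on (multi_tile p)"
  define fk where "fk k x = f (int_vec (p k) + x)" for k x
  have fk: "fk k \<in> L2_space cube_measure" for k
    using f unfolding multi_tile_L2_iff[OF inj] fk_def by blast
  define h where "h j x = character (- \<delta> j) x * (\<Sum>k\<in>UNIV. cnj (?\<Gamma> $ j $ k) * fk k x)" for j x
  have h: "h j \<in> L2_space cube_measure" for j
    unfolding h_def by (intro L2_space_character_mult L2_space_sum L2_space_scale fk)
  have coeff: "L2_inner ?M f (exp_system \<delta> (j, n)) = L2_inner cube_measure (h j) (lattice_character n)" for j n
  proof -
    have int: "integrable cube_measure (\<lambda>x. fk k x * cnj (exp_system \<delta> (j, n) (int_vec (p k) + x)))" for k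
      using exp_system_L2[OF inj, of \<delta> "(j, n)"] fk
      by (intro L2_product_integrable) (auto simp: multi_tile_L2_iff[OF inj])
    have "L2_inner ?M f (exp_system \<delta> (j, n))
        = (\<Sum>k\<in>UNIV. LINT x|cube_measure. fk k x * cnj (exp_system \<delta> (j, n) (int_vec (p k) + x)))"
      using multi_tile_L2_inner[OF inj f exp_system_L2[OF inj]] by (simp add: L2_inner_def fk_def)
    also have "\<dots> = (LINT x|cube_measure. (\<Sum>k\<in>UNIV. fk k x * cnj (exp_system \<delta> (j, n) (int_vec (p k) + x))))"
      using int by (intro Bochner_Integration.integral_sum[symmetric])
    also have "\<dots> = L2_inner cube_measure (h j) (lattice_character n)"
      unfolding L2_inner_def exp_system_on_tile h_def
      by (simp add: cnj_character sum_distrib_left sum_distrib_right mult_ac)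
    finally show ?thesis .
  qed
  have row: "((\<lambda>n. (cmod (L2_inner ?M f (exp_system \<delta> (j, n))))\<^sup>2) has_sum L2_norm_sq cube_measure (h j)) UNIV" for j
    unfolding coeff by (rule parseval_has_sum[OF characters_orthonormal L2_cube_approximable[OF h]])
  have "((\<lambda>i. (cmod (L2_inner ?M f (exp_system \<delta> i)))\<^sup>2) has_sum (\<Sum>j\<in>UNIV. L2_norm_sq cube_measure (h j)))
      (UNIV \<times> UNIV)"
  proof (rule has_sum_SigmaI)
    show "(L2_norm_sq cube_measure \<circ> h has_sum (\<Sum>j\<in>UNIV. L2_norm_sq cube_measure (h j))) UNIV"
      using has_sum_finite[of UNIV "L2_norm_sq cube_measure \<circ> h"] by simp
    show "((\<lambda>n. (cmod (L2_inner ?M f (exp_system \<delta> (j, n))))\<^sup>2) has_sum (L2_norm_sq cube_measure \<circ> h) j) UNIV" for j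
      using row by simp
    show "(\<lambda>i. (cmod (L2_inner ?M f (exp_system \<delta> i)))\<^sup>2) summable_on UNIV \<times> UNIV"
      using row by (intro summable_on_SigmaI[where g = "L2_norm_sq cube_measure \<circ> h"]) auto
  qed
  then have total: "((\<lambda>i. (cmod (L2_inner ?M f (exp_system \<delta> i)))\<^sup>2)
      has_sum (\<Sum>j\<in>UNIV. L2_norm_sq cube_measure (h j))) UNIV" by simp
  have comp: "(?\<Gamma> *v tile_fiber p f x) $ j = cnj (\<Sum>k\<in>UNIV. cnj (?\<Gamma> $ j $ k) * fk k x)" for x j
    by (simp add: matrix_vector_mult_def tile_fiber_def fk_def)
  have "(\<Sum>\<^sub>\<infinity>i. ennreal ((cmod (L2_inner ?M f (exp_system \<delta> i)))\<^sup>2))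
      = ennreal (\<Sum>j\<in>UNIV. L2_norm_sq cube_measure (h j))"
    by (intro infsumI has_sum_ennreal total) simp
  also have "(\<Sum>j\<in>UNIV. L2_norm_sq cube_measure (h j)) = (\<Sum>j\<in>UNIV. L2_norm_sq cube_measure (\<lambda>x. (?\<Gamma> *v tile_fiber p f x) $ j))"
    unfolding comp L2_norm_sq_cnj h_def L2_norm_sq_character_mult by simp
  also have "\<dots> = (LINT x|cube_measure. (norm (?\<Gamma> *v tile_fiber p f x))\<^sup>2)"
  proof (rule vector_L2_norm_sq(2)[symmetric])
    show "(\<lambda>x. (?\<Gamma> *v tile_fiber p f x) $ j) \<in> L2_space cube_measure" for j
      unfolding comp by (intro L2_space_cnj L2_space_sum L2_space_scale fk)
  qed
  finally show ?thesis .
qed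

lemma tile_fiber_L2:
  assumes "inj p" "f \<in> L2_space (lebesgue_on (multi_tile p))"
  shows "(\<lambda>x. tile_fiber p f x $ k) \<in> L2_space cube_measure"
  using assms by (auto simp: tile_fiber_def multi_tile_L2_iff intro: L2_space_cnj)

lemma tile_fiber_norm_sq:
  assumes "inj p" "f \<in> L2_space (lebesgue_on (multi_tile p))"
  shows "Re (L2_inner (lebesgue_on (multi_tile p)) f f) = (LINT x|cube_measure. (norm (tile_fiber p f x))\<^sup>2)"
  unfolding vector_L2_norm_sq(2)[OF tile_fiber_L2[OF assms]]
  using assms by (simp add: L2_inner_self multi_tile_L2_norm_sq tile_fiber_def L2_norm_sq_cnj)

lemma exists_constant_fiber:
  assumes "inj p"
  obtains f where "f \<in> L2_space (lebesgue_on (multi_tile p))"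
    "\<And>x. x \<in> unit_cube \<Longrightarrow> tile_fiber p f x = w"
proof -
  obtain f where "f \<in> L2_space (lebesgue_on (multi_tile p))"
    "\<And>k x. x \<in> unit_cube \<Longrightarrow> f (int_vec (p k) + x) = cnj (w $ k)"
    using exists_constant_on_tiles[OF assms, of "\<lambda>k. cnj (w $ k)"] by blast
  then show thesis by (intro that[of f]) (simp_all add: tile_fiber_def vec_eq_iff)
qed

lemma integral_cube_const:
  fixes g :: "real^'d \<Rightarrow> real"
  assumes "\<And>x. x \<in> unit_cube \<Longrightarrow> g x = c"
  shows "(LINT x|cube_measure. g x) = c"
proof -
  have "(LINT x|cube_measure. g x) = (LINT x|(cube_measure :: (real^'d) measure). c)"
    by (rule Bochner_Integration.integral_cong) (auto simp: assms)
  then show ?thesis by (simp add: measure_unit_cube)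
qed

text \<open>
  An inequality for all vectors, applied to the fibres and integrated over the cube, is the frame
  inequality; a function with constant fibre \<open>w\<close> gives back the inequality for \<open>w\<close>.
\<close>

lemma exp_system_frame_lower_bound_iff:
  fixes \<delta> :: "'l::finite \<Rightarrow> real^'d" and p :: "'n::finite \<Rightarrow> int^'d"
  assumes inj: "inj p"
  defines "M \<equiv> lebesgue_on (multi_tile p)"
  shows "frame_lower_bound (L2_space M) (L2_inner M) (exp_system \<delta>) A \<longleftrightarrow>
    (\<forall>w. A * (norm w)\<^sup>2 \<le> (norm (Gamma_matrix \<delta> p *v w))\<^sup>2)"
proof -
  let ?\<Gamma> = "Gamma_matrix \<delta> p"
  have "frame_lower_bound (L2_space M) (L2_inner M) (exp_system \<delta>) A \<longleftrightarrow>
      (\<forall>f\<in>L2_space M. A * (LINT x|cube_measure. (norm (tile_fiber p f x))\<^sup>2)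
        \<le> (LINT x|cube_measure. (norm (?\<Gamma> *v tile_fiber p f x))\<^sup>2))"
    unfolding frame_lower_bound_def M_def
    by (intro ball_cong refl) (simp add: frame_coefficients_sum[OF inj] tile_fiber_norm_sq[OF inj])
  also have "\<dots> \<longleftrightarrow> (\<forall>w. A * (norm w)\<^sup>2 \<le> (norm (?\<Gamma> *v w))\<^sup>2)"
  proof (intro iffI allI ballI)
    fix w assume *: "\<forall>f\<in>L2_space M. A * (LINT x|cube_measure. (norm (tile_fiber p f x))\<^sup>2)
        \<le> (LINT x|cube_measure. (norm (?\<Gamma> *v tile_fiber p f x))\<^sup>2)"
    obtain f where f: "f \<in> L2_space M" "\<And>x. x \<in> unit_cube \<Longrightarrow> tile_fiber p f x = w"
      using exists_constant_fiber[OF inj] unfolding M_def by metis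
    have "(LINT x|cube_measure. (norm (tile_fiber p f x))\<^sup>2) = (norm w)\<^sup>2"
      "(LINT x|cube_measure. (norm (?\<Gamma> *v tile_fiber p f x))\<^sup>2) = (norm (?\<Gamma> *v w))\<^sup>2"
      by (intro integral_cube_const; simp add: f)+
    then show "A * (norm w)\<^sup>2 \<le> (norm (?\<Gamma> *v w))\<^sup>2" using * f(1) by metis
  next
    fix f assume *: "\<forall>w. A * (norm w)\<^sup>2 \<le> (norm (?\<Gamma> *v w))\<^sup>2" and f: "f \<in> L2_space M"
    note L2 = tile_fiber_L2[OF inj f[unfolded M_def]]
    have "(LINT x|cube_measure. A * (norm (tile_fiber p f x))\<^sup>2)
        \<le> (LINT x|cube_measure. (norm (?\<Gamma> *v tile_fiber p f x))\<^sup>2)"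
      using * by (intro Bochner_Integration.integral_mono integrable_mult_right
          vector_L2_norm_sq(1) matrix_vector_L2 L2) auto
    then show "A * (LINT x|cube_measure. (norm (tile_fiber p f x))\<^sup>2)
        \<le> (LINT x|cube_measure. (norm (?\<Gamma> *v tile_fiber p f x))\<^sup>2)" by simp
  qed
  finally show ?thesis .
qed

lemma exp_system_frame_upper_bound_iff:
  fixes \<delta> :: "'l::finite \<Rightarrow> real^'d" and p :: "'n::finite \<Rightarrow> int^'d"
  assumes inj: "inj p" and B: "0 \<le> B"
  defines "M \<equiv> lebesgue_on (multi_tile p)"
  shows "frame_upper_bound (L2_space M) (L2_inner M) (exp_system \<delta>) B \<longleftrightarrow>
    (\<forall>w. (norm (Gamma_matrix \<delta> p *v w))\<^sup>2 \<le> B * (norm w)\<^sup>2)"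
proof -
  let ?\<Gamma> = "Gamma_matrix \<delta> p"
  have "frame_upper_bound (L2_space M) (L2_inner M) (exp_system \<delta>) B \<longleftrightarrow>
      (\<forall>f\<in>L2_space M. (LINT x|cube_measure. (norm (?\<Gamma> *v tile_fiber p f x))\<^sup>2)
        \<le> B * (LINT x|cube_measure. (norm (tile_fiber p f x))\<^sup>2))"
    unfolding frame_upper_bound_def M_def
    by (intro ball_cong refl)
      (simp add: frame_coefficients_sum[OF inj] tile_fiber_norm_sq[OF inj] ennreal_le_iff B)
  also have "\<dots> \<longleftrightarrow> (\<forall>w. (norm (?\<Gamma> *v w))\<^sup>2 \<le> B * (norm w)\<^sup>2)"
  proof (intro iffI allI ballI)
    fix w assume *: "\<forall>f\<in>L2_space M. (LINT x|cube_measure. (norm (?\<Gamma> *v tile_fiber p f x))\<^sup>2)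
        \<le> B * (LINT x|cube_measure. (norm (tile_fiber p f x))\<^sup>2)"
    obtain f where f: "f \<in> L2_space M" "\<And>x. x \<in> unit_cube \<Longrightarrow> tile_fiber p f x = w"
      using exists_constant_fiber[OF inj] unfolding M_def by metis
    have "(LINT x|cube_measure. (norm (tile_fiber p f x))\<^sup>2) = (norm w)\<^sup>2"
      "(LINT x|cube_measure. (norm (?\<Gamma> *v tile_fiber p f x))\<^sup>2) = (norm (?\<Gamma> *v w))\<^sup>2"
      by (intro integral_cube_const; simp add: f)+
    then show "(norm (?\<Gamma> *v w))\<^sup>2 \<le> B * (norm w)\<^sup>2" using * f(1) by metis
  next
    fix f assume *: "\<forall>w. (norm (?\<Gamma> *v w))\<^sup>2 \<le> B * (norm w)\<^sup>2" and f: "f \<in> L2_space M"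
    note L2 = tile_fiber_L2[OF inj f[unfolded M_def]]
    have "(LINT x|cube_measure. (norm (?\<Gamma> *v tile_fiber p f x))\<^sup>2)
        \<le> (LINT x|cube_measure. B * (norm (tile_fiber p f x))\<^sup>2)"
      using * by (intro Bochner_Integration.integral_mono integrable_mult_right
          vector_L2_norm_sq(1) matrix_vector_L2 L2) auto
    then show "(LINT x|cube_measure. (norm (?\<Gamma> *v tile_fiber p f x))\<^sup>2)
        \<le> B * (LINT x|cube_measure. (norm (tile_fiber p f x))\<^sup>2)" by simp
  qed
  finally show ?thesis .
qed

section \<open>Riesz bounds of the exponential system\<close>

text \<open>
  The fibre vector \<open>H\<close> whose image under the adjoint matrix is the conjugated fibre of the
  combination of the exponential system with coefficients \<open>a\<close> on the index set \<open>J\<close>.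
\<close>

definition coefficient_fiber ::
    "('l \<Rightarrow> real^'d) \<Rightarrow> ('l \<times> (int^'d)) set \<Rightarrow> ('l \<times> (int^'d) \<Rightarrow> complex) \<Rightarrow> real^'d \<Rightarrow> complex^'l" where
  "coefficient_fiber \<delta> J a x =
    (\<chi> j. cnj (character (\<delta> j) x * (\<Sum>n | (j, n) \<in> J. a (j, n) * lattice_character n x)))"

context
  fixes \<delta> :: "'l::finite \<Rightarrow> real^'d" and J :: "('l \<times> (int^'d)) set"
  assumes J: "finite J"
begin

lemma finite_index_slice: "finite {n. (j, n) \<in> J}"
  by (rule finite_subset[OF _ finite_imageI[OF J, of snd]]) force

lemma sum_index_slices: "(\<Sum>i\<in>J. f i) = (\<Sum>j\<in>UNIV. \<Sum>n | (j, n) \<in> J. f (j, n))"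
proof -
  have "J = Sigma UNIV (\<lambda>j. {n. (j, n) \<in> J})" by auto
  then have "(\<Sum>i\<in>J. f i) = (\<Sum>i\<in>Sigma UNIV (\<lambda>j. {n. (j, n) \<in> J}). f i)" by simp
  also have "\<dots> = (\<Sum>j\<in>UNIV. \<Sum>n | (j, n) \<in> J. f (j, n))"
    using finite_index_slice by (subst sum.Sigma) auto
  finally show ?thesis .
qed

lemma coefficient_slice_L2:
  "(\<lambda>x. \<Sum>n | (j, n) \<in> J. a (j, n) * lattice_character n x) \<in> L2_space cube_measure"
  using characters_L2 by (intro L2_space_sum L2_space_scale) blast

lemma coefficient_fiber_L2: "(\<lambda>x. coefficient_fiber \<delta> J a x $ j) \<in> L2_space cube_measure"
  unfolding coefficient_fiber_def
  by (simp del: complex_cnj_mult) (intro L2_space_cnj L2_space_character_mult coefficient_slice_L2)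

lemma coefficient_fiber_norm_sq:
  "(LINT x|cube_measure. (norm (coefficient_fiber \<delta> J a x))\<^sup>2) = (\<Sum>i\<in>J. (cmod (a i))\<^sup>2)"
proof -
  have "L2_norm_sq cube_measure (\<lambda>x. \<Sum>n | (j, n) \<in> J. a (j, n) * lattice_character n x)
      = (\<Sum>n | (j, n) \<in> J. (cmod (a (j, n)))\<^sup>2)" for j
    using L2_norm_sq_orthonormal_diff[OF characters_orthonormal L2_space_zero finite_index_slice,
        of "\<lambda>n. a (j, n)" j]
    by (simp add: L2_norm_sq_def L2_inner_def)
  then show ?thesis
    unfolding vector_L2_norm_sq(2)[OF coefficient_fiber_L2] sum_index_slices
    by (simp add: coefficient_fiber_def L2_norm_sq_cnj L2_norm_sq_character_mult del: complex_cnj_mult)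
qed

lemma synthesis_norm_sq:
  fixes p :: "'n::finite \<Rightarrow> int^'d"
  assumes inj: "inj p"
  shows "L2_norm_sq (lebesgue_on (multi_tile p)) (\<lambda>x. \<Sum>i\<in>J. a i * exp_system \<delta> i x)
    = (LINT x|cube_measure. (norm (conj_transpose (Gamma_matrix \<delta> p) *v coefficient_fiber \<delta> J a x))\<^sup>2)"
proof -
  let ?\<Gamma> = "Gamma_matrix \<delta> p"
  have "(\<Sum>i\<in>J. a i * exp_system \<delta> i (int_vec (p k) + x))
      = cnj ((conj_transpose ?\<Gamma> *v coefficient_fiber \<delta> J a x) $ k)" for k x
    unfolding sum_index_slices exp_system_on_tile
    by (simp add: matrix_vector_mult_def conj_transpose_def coefficient_fiber_def sum_distrib_left mult_ac)
  then have fiber: "(\<lambda>x. \<Sum>i\<in>J. a i * exp_system \<delta> i (int_vec (p k) + x))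
      = (\<lambda>x. cnj ((conj_transpose ?\<Gamma> *v coefficient_fiber \<delta> J a x) $ k))" for k by blast
  have L2: "(\<lambda>x. \<Sum>i\<in>J. a i * exp_system \<delta> i x) \<in> L2_space (lebesgue_on (multi_tile p))"
    by (intro L2_space_sum L2_space_scale exp_system_L2 inj)
  have "L2_norm_sq (lebesgue_on (multi_tile p)) (\<lambda>x. \<Sum>i\<in>J. a i * exp_system \<delta> i x)
      = (\<Sum>k\<in>UNIV. L2_norm_sq cube_measure (\<lambda>x. (conj_transpose ?\<Gamma> *v coefficient_fiber \<delta> J a x) $ k))"
    unfolding multi_tile_L2_norm_sq[OF inj L2] fiber L2_norm_sq_cnj by simp
  also have "\<dots> = (LINT x|cube_measure. (norm (conj_transpose ?\<Gamma> *v coefficient_fiber \<delta> J a x))\<^sup>2)"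
    by (intro vector_L2_norm_sq(2)[symmetric] matrix_vector_L2 coefficient_fiber_L2)
  finally show ?thesis .
qed

end

text \<open>
  The mixed term is split by the weighted inequality of arithmetic and geometric means, so that after
  integration only the squared norms of the two parts occur.
\<close>

lemma norm_sq_perturbation:
  fixes u v :: "'a::real_inner"
  assumes "0 < \<theta>"
  shows "\<bar>(norm (u + v))\<^sup>2 - (norm u)\<^sup>2\<bar> \<le> \<theta> * (norm u)\<^sup>2 + (1 + 1 / \<theta>) * (norm v)\<^sup>2"
proof -
  have "(norm (u + v))\<^sup>2 - (norm u)\<^sup>2 = 2 * (u \<bullet> v) + (norm v)\<^sup>2"
    unfolding power2_norm_eq_inner by (simp add: inner_add_left inner_add_right inner_commute)
  moreover have "\<bar>u \<bullet> v\<bar> \<le> norm u * norm v" by (rule Cauchy_Schwarz_ineq2)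
  moreover have "2 * (norm u * norm v) \<le> \<theta> * (norm u)\<^sup>2 + (1 / \<theta>) * (norm v)\<^sup>2"
  proof -
    have "0 \<le> (\<theta> * norm u - norm v)\<^sup>2 / \<theta>" using assms by simp
    also have "\<dots> = \<theta> * (norm u)\<^sup>2 + (1 / \<theta>) * (norm v)\<^sup>2 - 2 * (norm u * norm v)"
      using assms by (simp add: power2_diff field_simps power2_eq_square)
    finally show ?thesis by simp
  qed
  moreover have "(1 + 1 / \<theta>) * (norm v)\<^sup>2 = (norm v)\<^sup>2 + (1 / \<theta>) * (norm v)\<^sup>2"
    by (simp add: distrib_right)
  ultimately show ?thesis by (smt (verit) zero_le_power2)
qed

text \<open>
  Splitting with the weight \<open>\<theta>\<close> puts a factor \<open>1 / \<theta>\<close> on the squared deviation of \<open>H\<close> from \<open>h\<close>; the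
  bound \<open>\<theta>\<^sup>2\<close> on its integral compensates for that, so the whole error is of order \<open>\<theta>\<close>.
\<close>

lemma integral_near_constant:
  fixes A :: "complex^'l^'m" and H :: "real^'d \<Rightarrow> complex^'l"
  assumes H: "\<And>j. (\<lambda>x. H x $ j) \<in> L2_space cube_measure"
    and \<theta>: "0 < \<theta>" "\<theta> \<le> 1"
    and close: "(LINT x|cube_measure. (norm (H x - h))\<^sup>2) \<le> \<theta>\<^sup>2"
  shows "\<bar>(LINT x|cube_measure. (norm (A *v H x))\<^sup>2) - (norm (A *v h))\<^sup>2\<bar>
    \<le> \<theta> * ((norm (A *v h))\<^sup>2 + 2 * (singular_value 1 A)\<^sup>2)"
proof -
  let ?K = "cube_measure :: (real^'d) measure" and ?C = "singular_value 1 A"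
  interpret finite_measure ?K by (rule finite_measure_unit_cube)
  have "(\<lambda>x. H x $ j - h $ j) \<in> L2_space ?K" for j
    by (intro L2_space_minus H L2_space_bounded[where C = "cmod (h $ j)"]) (auto simp: finite_measure_unit_cube)
  then have intR: "integrable ?K (\<lambda>x. (norm (H x - h))\<^sup>2)"
    by (intro vector_L2_norm_sq(1)) simp
  have intA: "integrable ?K (\<lambda>x. (norm (A *v H x))\<^sup>2)"
    by (intro vector_L2_norm_sq(1) matrix_vector_L2 H)
  have pointwise: "\<bar>(norm (A *v H x))\<^sup>2 - (norm (A *v h))\<^sup>2\<bar>
      \<le> \<theta> * (norm (A *v h))\<^sup>2 + (1 + 1 / \<theta>) * ?C\<^sup>2 * (norm (H x - h))\<^sup>2" for x
  proof -
    have "\<bar>(norm (A *v H x))\<^sup>2 - (norm (A *v h))\<^sup>2\<bar>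
        \<le> \<theta> * (norm (A *v h))\<^sup>2 + (1 + 1 / \<theta>) * (norm (A *v (H x - h)))\<^sup>2"
      using norm_sq_perturbation[OF \<theta>(1), of "A *v h" "A *v (H x - h)"] by (simp add: vec.diff)
    moreover have "norm (A *v (H x - h)) \<le> ?C * norm (H x - h)"
      using singular_value_1[of A] by blast
    then have "(norm (A *v (H x - h)))\<^sup>2 \<le> ?C\<^sup>2 * (norm (H x - h))\<^sup>2"
      by (metis norm_ge_zero power_mono power_mult_distrib)
    then have "(1 + 1 / \<theta>) * (norm (A *v (H x - h)))\<^sup>2 \<le> (1 + 1 / \<theta>) * (?C\<^sup>2 * (norm (H x - h))\<^sup>2)"
      using \<theta> by (intro mult_left_mono) auto
    ultimately show ?thesis by (simp add: mult.assoc)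
  qed
  have "(LINT x|?K. (norm (A *v H x))\<^sup>2) - (norm (A *v h))\<^sup>2
      = (LINT x|?K. (norm (A *v H x))\<^sup>2 - (norm (A *v h))\<^sup>2)"
    using intA by (simp add: measure_unit_cube)
  also have "\<bar>\<dots>\<bar> \<le> (LINT x|?K. \<bar>(norm (A *v H x))\<^sup>2 - (norm (A *v h))\<^sup>2\<bar>)"
    by (rule integral_abs_bound)
  also have "\<dots> \<le> (LINT x|?K. \<theta> * (norm (A *v h))\<^sup>2 + (1 + 1 / \<theta>) * ?C\<^sup>2 * (norm (H x - h))\<^sup>2)"
    using intA intR pointwise by (intro Bochner_Integration.integral_mono) auto
  also have "\<dots> = \<theta> * (norm (A *v h))\<^sup>2 + (1 + 1 / \<theta>) * ?C\<^sup>2 * (LINT x|?K. (norm (H x - h))\<^sup>2)"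
    using intR by (simp add: measure_unit_cube)
  also have "\<dots> \<le> \<theta> * (norm (A *v h))\<^sup>2 + (1 + 1 / \<theta>) * ?C\<^sup>2 * \<theta>\<^sup>2"
    using close \<theta> by (intro add_left_mono mult_left_mono) auto
  also have "(1 + 1 / \<theta>) * ?C\<^sup>2 * \<theta>\<^sup>2 = (\<theta> + 1) * (\<theta> * ?C\<^sup>2)"
    using \<theta> by (simp add: field_simps power2_eq_square)
  also have "\<theta> * (norm (A *v h))\<^sup>2 + (\<theta> + 1) * (\<theta> * ?C\<^sup>2) \<le> \<theta> * (norm (A *v h))\<^sup>2 + 2 * (\<theta> * ?C\<^sup>2)"
    using \<theta> by (intro add_left_mono mult_right_mono) auto
  finally show ?thesis by (simp add: algebra_simps)
qed

text \<open>
  The \<open>j\<close>-th entry is a trigonometric polynomial times a character with frequency \<open>\<delta>\<^sub>j\<close>, which is in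
  general not periodic. So the conjugate of the constant \<open>h\<^sub>j\<close> is divided by that character, and
  the quotient is approximated by trigonometric polynomials.
\<close>

lemma exists_near_constant_fiber:
  fixes \<delta> :: "'l::finite \<Rightarrow> real^'d"
  assumes "0 < \<theta>"
  obtains J a where "finite J" "(LINT x|cube_measure. (norm (coefficient_fiber \<delta> J a x - h))\<^sup>2) \<le> \<theta>\<^sup>2"
proof -
  let ?K = "cube_measure :: (real^'d) measure"
  \<comment> \<open>multiplied by the character of frequency \<open>\<delta>\<^sub>j\<close> this is the conjugate of \<open>h\<^sub>j\<close>\<close>
  define c where "c j x = cnj (h $ j) * character (- \<delta> j) x" for j x
  have cL: "c j \<in> L2_space ?K" for j
    unfolding c_def
    by (intro L2_space_scale L2_space_bounded[where C = 1])
      (auto simp: finite_measure_unit_cube measurable_character norm_character)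
  define \<rho> where "\<rho> = \<theta>\<^sup>2 / CARD('l)"
  have "0 < \<rho>" using assms by (simp add: \<rho>_def)
  define good where "good j F b \<longleftrightarrow> finite F \<and>
    L2_norm_sq ?K (\<lambda>x. c j x - (\<Sum>n\<in>F. b n * lattice_character n x)) < \<rho>" for j F b
  have "\<exists>F b. good j F b" for j
  proof -
    obtain t where t: "t \<in> finite_combinations lattice_character" "L2_norm_sq ?K (\<lambda>x. c j x - t x) < \<rho>"
      using L2_approximableE[OF L2_cube_approximable[OF cL] \<open>0 < \<rho>\<close>] .
    from t(1) obtain F b where "finite F" "t = (\<lambda>x. \<Sum>n\<in>F. b n * lattice_character n x)"
      by (rule finite_combinationsE)
    then show ?thesis using t(2) unfolding good_def by blast
  qed
  then obtain F b where "\<And>j. good j (F j) (b j)" by metis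
  then have F: "\<And>j. finite (F j)"
    "\<And>j. L2_norm_sq ?K (\<lambda>x. c j x - (\<Sum>n\<in>F j. b j n * lattice_character n x)) < \<rho>"
    by (simp_all add: good_def)
  define J where "J = Sigma UNIV F"
  define a where "a = (\<lambda>(j, n). b j n)"
  have J: "finite J" using F(1) by (simp add: J_def)
  have "(coefficient_fiber \<delta> J a x - h) $ j
      = cnj (character (\<delta> j) x * (- 1 * (c j x - (\<Sum>n\<in>F j. b j n * lattice_character n x))))" for j x
  proof -
    have "character (\<delta> j) x * character (- \<delta> j) x = 1"
      by (simp add: character_zero flip: character_add_left)
    then have "character (\<delta> j) x * c j x = cnj (h $ j)" by (simp add: c_def)
    then show ?thesis
      by (simp add: coefficient_fiber_def J_def a_def right_diff_distrib del: complex_cnj_mult)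
  qed
  then have comp: "(\<lambda>x. (coefficient_fiber \<delta> J a x - h) $ j)
      = (\<lambda>x. cnj (character (\<delta> j) x * (- 1 * (c j x - (\<Sum>n\<in>F j. b j n * lattice_character n x)))))" for j
    by blast
  have diffL: "(\<lambda>x. c j x - (\<Sum>n\<in>F j. b j n * lattice_character n x)) \<in> L2_space ?K" for j
    using characters_L2 by (intro L2_space_minus cL L2_space_sum L2_space_scale) blast
  have "(LINT x|?K. (norm (coefficient_fiber \<delta> J a x - h))\<^sup>2)
      = (\<Sum>j\<in>UNIV. L2_norm_sq ?K (\<lambda>x. (coefficient_fiber \<delta> J a x - h) $ j))"
  proof (rule vector_L2_norm_sq(2))
    show "(\<lambda>x. (coefficient_fiber \<delta> J a x - h) $ j) \<in> L2_space ?K" for j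
      unfolding comp by (intro L2_space_cnj L2_space_character_mult L2_space_scale diffL)
  qed
  also have "\<dots> = (\<Sum>j\<in>UNIV. L2_norm_sq ?K (\<lambda>x. c j x - (\<Sum>n\<in>F j. b j n * lattice_character n x)))"
    unfolding comp L2_norm_sq_cnj L2_norm_sq_character_mult L2_norm_sq_scale by simp
  also have "\<dots> \<le> (\<Sum>j\<in>(UNIV :: 'l set). \<rho>)" using F(2) by (intro sum_mono less_imp_le)
  also have "\<dots> = \<theta>\<^sup>2" by (simp add: \<rho>_def)
  finally show thesis using that J by blast
qed

text \<open>
  A Riesz inequality tested on these combinations becomes, as \<open>\<epsilon>\<close> tends to 0, an inequality for the
  vector \<open>h\<close>. Both errors are at most fixed multiples of \<open>\<theta>\<close>, so one small \<open>\<theta>\<close> serves the identity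
  matrix, which gives the sum of the squared coefficients, and the adjoint matrix at once.
\<close>

lemma riesz_test_combination:
  fixes \<delta> :: "'l::finite \<Rightarrow> real^'d" and p :: "'n::finite \<Rightarrow> int^'d"
  assumes inj: "inj p" and "0 < \<epsilon>"
  obtains J a where "finite J" "\<bar>(\<Sum>i\<in>J. (cmod (a i))\<^sup>2) - (norm h)\<^sup>2\<bar> < \<epsilon>"
    "\<bar>L2_norm_sq (lebesgue_on (multi_tile p)) (\<lambda>x. \<Sum>i\<in>J. a i * exp_system \<delta> i x)
      - (norm (conj_transpose (Gamma_matrix \<delta> p) *v h))\<^sup>2\<bar> < \<epsilon>"
proof -
  let ?G = "conj_transpose (Gamma_matrix \<delta> p)" and ?I = "mat 1 :: complex^'l^'l"
  define D where "D = ((norm (?I *v h))\<^sup>2 + 2 * (singular_value 1 ?I)\<^sup>2)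
    + ((norm (?G *v h))\<^sup>2 + 2 * (singular_value 1 ?G)\<^sup>2) + 1"
  define \<theta> where "\<theta> = min 1 (\<epsilon> / D)"
  have D: "1 \<le> D" "(norm (?I *v h))\<^sup>2 + 2 * (singular_value 1 ?I)\<^sup>2 < D"
    "(norm (?G *v h))\<^sup>2 + 2 * (singular_value 1 ?G)\<^sup>2 < D"
    by (simp_all add: D_def add_nonneg_pos add_pos_nonneg)
  have \<theta>: "0 < \<theta>" "\<theta> \<le> 1" "\<theta> * D \<le> \<epsilon>"
  proof -
    show "0 < \<theta>" "\<theta> \<le> 1" using D \<open>0 < \<epsilon>\<close> by (auto simp: \<theta>_def)
    have "\<theta> * D \<le> \<epsilon> / D * D" using D by (intro mult_right_mono) (auto simp: \<theta>_def)
    then show "\<theta> * D \<le> \<epsilon>" using D by simp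
  qed
  obtain J a where J: "finite J"
    and close: "(LINT x|cube_measure. (norm (coefficient_fiber \<delta> J a x - h))\<^sup>2) \<le> \<theta>\<^sup>2"
    using exists_near_constant_fiber[OF \<theta>(1)] by blast
  note near = integral_near_constant[OF coefficient_fiber_L2[OF J] \<theta>(1,2) close]
  have "\<theta> * E < \<epsilon>" if "E < D" for E
    using mult_strict_left_mono[OF that \<theta>(1)] \<theta>(3) by linarith
  then have "\<bar>(\<Sum>i\<in>J. (cmod (a i))\<^sup>2) - (norm h)\<^sup>2\<bar> < \<epsilon>"
    "\<bar>L2_norm_sq (lebesgue_on (multi_tile p)) (\<lambda>x. \<Sum>i\<in>J. a i * exp_system \<delta> i x) - (norm (?G *v h))\<^sup>2\<bar> < \<epsilon>"
    using near[of ?I] near[of ?G] D(2,3)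
    unfolding synthesis_norm_sq[OF J inj] coefficient_fiber_norm_sq[OF J, symmetric, of a \<delta>]
    by (force simp del: of_real_sum)+
  then show thesis using that J by blast
qed

text \<open>
  As for frames, except that the inequality for a given \<open>h\<close> is first recovered up to an arbitrary
  \<open>\<epsilon>\<close>, from combinations whose fibres are nearly constant.
\<close>

lemma exp_system_riesz_lower_bound_iff:
  fixes \<delta> :: "'l::finite \<Rightarrow> real^'d" and p :: "'n::finite \<Rightarrow> int^'d"
  assumes inj: "inj p" and A: "0 \<le> A"
  shows "riesz_lower_bound (lebesgue_on (multi_tile p)) (exp_system \<delta>) A \<longleftrightarrow>
    (\<forall>h. A * (norm h)\<^sup>2 \<le> (norm (conj_transpose (Gamma_matrix \<delta> p) *v h))\<^sup>2)"
proof
  let ?G = "conj_transpose (Gamma_matrix \<delta> p)"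
  assume lower: "riesz_lower_bound (lebesgue_on (multi_tile p)) (exp_system \<delta>) A"
  show "\<forall>h. A * (norm h)\<^sup>2 \<le> (norm (?G *v h))\<^sup>2"
  proof
    fix h
    have "A * (norm h)\<^sup>2 \<le> (norm (?G *v h))\<^sup>2 + \<epsilon>" if "0 < \<epsilon>" for \<epsilon>
    proof -
      define \<eta> where "\<eta> = \<epsilon> / (A + 1)"
      have \<eta>: "0 < \<eta>" "A * \<eta> + \<eta> = \<epsilon>"
      proof -
        show "0 < \<eta>" using that A by (simp add: \<eta>_def)
        have "A * \<eta> + \<eta> = (A + 1) * \<eta>" by (simp add: distrib_right)
        then show "A * \<eta> + \<eta> = \<epsilon>" using A by (simp add: \<eta>_def)
      qed
      obtain J a where "finite J" and 1: "\<bar>(\<Sum>i\<in>J. (cmod (a i))\<^sup>2) - (norm h)\<^sup>2\<bar> < \<eta>"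
        and 2: "\<bar>L2_norm_sq (lebesgue_on (multi_tile p)) (\<lambda>x. \<Sum>i\<in>J. a i * exp_system \<delta> i x)
          - (norm (?G *v h))\<^sup>2\<bar> < \<eta>"
        using riesz_test_combination[OF inj \<eta>(1), of h \<delta>] by blast
      have "A * (norm h)\<^sup>2 \<le> A * ((\<Sum>i\<in>J. (cmod (a i))\<^sup>2) + \<eta>)"
        using 1 A by (intro mult_left_mono) auto
      also have "\<dots> = A * (\<Sum>i\<in>J. (cmod (a i))\<^sup>2) + A * \<eta>" by (simp add: distrib_left)
      also have "A * (\<Sum>i\<in>J. (cmod (a i))\<^sup>2)
          \<le> L2_norm_sq (lebesgue_on (multi_tile p)) (\<lambda>x. \<Sum>i\<in>J. a i * exp_system \<delta> i x)"
        using lower \<open>finite J\<close> by (simp add: riesz_lower_bound_def)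
      finally show ?thesis using 2 \<eta>(2) by linarith
    qed
    then show "A * (norm h)\<^sup>2 \<le> (norm (?G *v h))\<^sup>2" by (rule field_le_epsilon)
  qed
next
  let ?G = "conj_transpose (Gamma_matrix \<delta> p)"
  assume *: "\<forall>h. A * (norm h)\<^sup>2 \<le> (norm (?G *v h))\<^sup>2"
  show "riesz_lower_bound (lebesgue_on (multi_tile p)) (exp_system \<delta>) A"
    unfolding riesz_lower_bound_def
  proof (intro allI impI)
    fix J :: "('l \<times> (int^'d)) set" and a assume J: "finite J"
    have "(LINT x|cube_measure. A * (norm (coefficient_fiber \<delta> J a x))\<^sup>2)
        \<le> (LINT x|cube_measure. (norm (?G *v coefficient_fiber \<delta> J a x))\<^sup>2)"
      using * by (intro Bochner_Integration.integral_mono integrable_mult_right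
          vector_L2_norm_sq(1) matrix_vector_L2 coefficient_fiber_L2 J) auto
    then show "A * (\<Sum>i\<in>J. (cmod (a i))\<^sup>2)
        \<le> L2_norm_sq (lebesgue_on (multi_tile p)) (\<lambda>x. \<Sum>i\<in>J. a i * exp_system \<delta> i x)"
      unfolding synthesis_norm_sq[OF J inj] by (simp add: coefficient_fiber_norm_sq[OF J])
  qed
qed

lemma exp_system_riesz_upper_bound_iff:
  fixes \<delta> :: "'l::finite \<Rightarrow> real^'d" and p :: "'n::finite \<Rightarrow> int^'d"
  assumes inj: "inj p" and B: "0 \<le> B"
  shows "riesz_upper_bound (lebesgue_on (multi_tile p)) (exp_system \<delta>) B \<longleftrightarrow>
    (\<forall>h. (norm (conj_transpose (Gamma_matrix \<delta> p) *v h))\<^sup>2 \<le> B * (norm h)\<^sup>2)"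
proof
  let ?G = "conj_transpose (Gamma_matrix \<delta> p)"
  assume upper: "riesz_upper_bound (lebesgue_on (multi_tile p)) (exp_system \<delta>) B"
  show "\<forall>h. (norm (?G *v h))\<^sup>2 \<le> B * (norm h)\<^sup>2"
  proof
    fix h
    have "(norm (?G *v h))\<^sup>2 \<le> B * (norm h)\<^sup>2 + \<epsilon>" if "0 < \<epsilon>" for \<epsilon>
    proof -
      define \<eta> where "\<eta> = \<epsilon> / (B + 1)"
      have \<eta>: "0 < \<eta>" "B * \<eta> + \<eta> = \<epsilon>"
      proof -
        show "0 < \<eta>" using that B by (simp add: \<eta>_def)
        have "B * \<eta> + \<eta> = (B + 1) * \<eta>" by (simp add: distrib_right)
        then show "B * \<eta> + \<eta> = \<epsilon>" using B by (simp add: \<eta>_def)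
      qed
      obtain J a where "finite J" and 1: "\<bar>(\<Sum>i\<in>J. (cmod (a i))\<^sup>2) - (norm h)\<^sup>2\<bar> < \<eta>"
        and 2: "\<bar>L2_norm_sq (lebesgue_on (multi_tile p)) (\<lambda>x. \<Sum>i\<in>J. a i * exp_system \<delta> i x)
          - (norm (?G *v h))\<^sup>2\<bar> < \<eta>"
        using riesz_test_combination[OF inj \<eta>(1), of h \<delta>] by blast
      have "L2_norm_sq (lebesgue_on (multi_tile p)) (\<lambda>x. \<Sum>i\<in>J. a i * exp_system \<delta> i x)
          \<le> B * (\<Sum>i\<in>J. (cmod (a i))\<^sup>2)"
        using upper \<open>finite J\<close> by (simp add: riesz_upper_bound_def)
      also have "\<dots> \<le> B * ((norm h)\<^sup>2 + \<eta>)"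
        using 1 B by (intro mult_left_mono) auto
      also have "\<dots> = B * (norm h)\<^sup>2 + B * \<eta>" by (simp add: distrib_left)
      finally show ?thesis using 2 \<eta>(2) by linarith
    qed
    then show "(norm (?G *v h))\<^sup>2 \<le> B * (norm h)\<^sup>2" by (rule field_le_epsilon)
  qed
next
  let ?G = "conj_transpose (Gamma_matrix \<delta> p)"
  assume *: "\<forall>h. (norm (?G *v h))\<^sup>2 \<le> B * (norm h)\<^sup>2"
  show "riesz_upper_bound (lebesgue_on (multi_tile p)) (exp_system \<delta>) B"
    unfolding riesz_upper_bound_def
  proof (intro allI impI)
    fix J :: "('l \<times> (int^'d)) set" and a assume J: "finite J"
    have "(LINT x|cube_measure. (norm (?G *v coefficient_fiber \<delta> J a x))\<^sup>2)
        \<le> (LINT x|cube_measure. B * (norm (coefficient_fiber \<delta> J a x))\<^sup>2)"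
      using * by (intro Bochner_Integration.integral_mono integrable_mult_right
          vector_L2_norm_sq(1) matrix_vector_L2 coefficient_fiber_L2 J) auto
    then show "L2_norm_sq (lebesgue_on (multi_tile p)) (\<lambda>x. \<Sum>i\<in>J. a i * exp_system \<delta> i x)
        \<le> B * (\<Sum>i\<in>J. (cmod (a i))\<^sup>2)"
      unfolding synthesis_norm_sq[OF J inj] by (simp add: coefficient_fiber_norm_sq[OF J])
  qed
qed

section \<open>Frame bounds of the rows of a matrix\<close>

definition conj_vec :: "complex^'n \<Rightarrow> complex^'n" where
  "conj_vec w = (\<chi> i. cnj (w $ i))"

lemma norm_conj_vec: "norm (conj_vec w) = norm w"
  by (simp add: conj_vec_def norm_vec_def)

lemma conj_vec_conj_vec: "conj_vec (conj_vec w) = w"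
  by (simp add: conj_vec_def vec_eq_iff)

text \<open>
  The coefficients of \<open>w\<close> against the rows are conjugates of the entries of the matrix applied to the
  conjugate of \<open>w\<close>; this removes that conjugation under a quantifier.
\<close>

lemma all_conj_vec_iff: "(\<forall>w. Q (norm w) (conj_vec w)) \<longleftrightarrow> (\<forall>w. Q (norm w) w)"
proof (intro iffI allI)
  fix w assume "\<forall>w. Q (norm w) (conj_vec w)"
  then have "Q (norm (conj_vec w)) (conj_vec (conj_vec w))" by blast
  then show "Q (norm w) w" by (simp only: norm_conj_vec conj_vec_conj_vec)
next
  fix w assume "\<forall>w. Q (norm w) w"
  then have "Q (norm (conj_vec w)) (conj_vec w)" by blast
  then show "Q (norm w) (conj_vec w)" by (simp only: norm_conj_vec)
qed

lemma row_coefficients_sum: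
  fixes A :: "complex^'n^'l"
  shows "(\<Sum>\<^sub>\<infinity>j. ennreal ((cmod (cvec_inner w (row j A)))\<^sup>2)) = ennreal ((norm (A *v conj_vec w))\<^sup>2)"
proof -
  have "cvec_inner w (row j A) = cnj ((A *v conj_vec w) $ j)" for j
    by (simp add: cvec_inner_def row_def matrix_vector_mult_def conj_vec_def mult.commute)
  then show ?thesis by (simp add: norm_vec_power2 sum_ennreal)
qed

lemma rows_frame_lower_bound_iff:
  fixes A :: "complex^'n^'l"
  shows "frame_lower_bound UNIV cvec_inner (\<lambda>j. row j A) a \<longleftrightarrow> (\<forall>w. a * (norm w)\<^sup>2 \<le> (norm (A *v w))\<^sup>2)"
  unfolding frame_lower_bound_def row_coefficients_sum
  using all_conj_vec_iff[of "\<lambda>r w. a * r\<^sup>2 \<le> (norm (A *v w))\<^sup>2"] by (simp add: cvec_inner_self)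

lemma rows_frame_upper_bound_iff:
  fixes A :: "complex^'n^'l"
  assumes "0 \<le> b"
  shows "frame_upper_bound UNIV cvec_inner (\<lambda>j. row j A) b \<longleftrightarrow> (\<forall>w. (norm (A *v w))\<^sup>2 \<le> b * (norm w)\<^sup>2)"
  unfolding frame_upper_bound_def row_coefficients_sum
  using assms all_conj_vec_iff[of "\<lambda>r w. (norm (A *v w))\<^sup>2 \<le> b * r\<^sup>2"]
  by (simp add: cvec_inner_self ennreal_le_iff)

section \<open>The equivalences and the optimal constants\<close>

theorem theorem1p1:
  fixes \<delta> :: "'l::finite \<Rightarrow> real^'d" and p :: "'n::finite \<Rightarrow> int^'d"
  assumes "distinct_mod_lattice \<delta>" and "inj p"
  shows
    "let M = lebesgue_on (multi_tile p);
         \<Gamma> = Gamma_matrix \<delta> p;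
         L = CARD('l);
         N = CARD('n)
     in
       (L \<ge> N \<longrightarrow>
          (is_frame (L2_space M) (L2_inner M) (exp_system \<delta>) \<longleftrightarrow> rank \<Gamma> = N) \<and>
          (rank \<Gamma> = N \<longleftrightarrow> is_frame UNIV cvec_inner (\<lambda>j. row j \<Gamma>)) \<and>
          (is_frame (L2_space M) (L2_inner M) (exp_system \<delta>) \<or> rank \<Gamma> = N \<or>
             is_frame UNIV cvec_inner (\<lambda>j. row j \<Gamma>) \<longrightarrow>
           optimal_frame_constants (L2_space M) (L2_inner M) (exp_system \<delta>)
             ((singular_value N \<Gamma>)\<^sup>2) ((singular_value 1 \<Gamma>)\<^sup>2))) \<and>
       (L \<le> N \<longrightarrow>
          (is_riesz_sequence M (exp_system \<delta>) \<longleftrightarrow> rank \<Gamma> = L) \<and>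
          (rank \<Gamma> = L \<longleftrightarrow> rows_independent \<Gamma>) \<and>
          (is_riesz_sequence M (exp_system \<delta>) \<or> rank \<Gamma> = L \<or> rows_independent \<Gamma> \<longrightarrow>
           optimal_riesz_constants M (exp_system \<delta>)
             ((singular_value L \<Gamma>)\<^sup>2) ((singular_value 1 \<Gamma>)\<^sup>2)))"
proof -
  define M where "M = lebesgue_on (multi_tile p)"
  define \<Gamma> where "\<Gamma> = Gamma_matrix \<delta> p"
  let ?L = "CARD('l)" and ?N = "CARD('n)"
  have range: "range (exp_system \<delta>) \<subseteq> L2_space M"
    unfolding M_def using exp_system_L2[OF \<open>inj p\<close>] by blast
  have frame_lower: "frame_lower_bound (L2_space M) (L2_inner M) (exp_system \<delta>) A \<longleftrightarrow>
      (\<forall>w. A * (norm w)\<^sup>2 \<le> (norm (\<Gamma> *v w))\<^sup>2)" for A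
    unfolding M_def \<Gamma>_def by (rule exp_system_frame_lower_bound_iff[OF \<open>inj p\<close>])
  have frame_upper: "frame_upper_bound (L2_space M) (L2_inner M) (exp_system \<delta>) B \<longleftrightarrow>
      (singular_value 1 \<Gamma>)\<^sup>2 \<le> B" if "0 \<le> B" for B
    unfolding M_def \<Gamma>_def exp_system_frame_upper_bound_iff[OF \<open>inj p\<close> that]
    by (rule singular_value_upper_bound_iff)
  have optimal_frame: "optimal_frame_constants (L2_space M) (L2_inner M) (exp_system \<delta>)
      ((singular_value ?N \<Gamma>)\<^sup>2) ((singular_value 1 \<Gamma>)\<^sup>2)" if "rank \<Gamma> = ?N"
  proof -
    note pos = singular_values_full_column_rank[OF that]
    show ?thesis
      unfolding optimal_frame_constants_def frame_constants_def
      using range pos by (simp add: frame_lower frame_upper singular_value_lower_bound_iff less_imp_le)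
  qed
  have frame_rank: "is_frame (L2_space M) (L2_inner M) (exp_system \<delta>) \<longleftrightarrow> rank \<Gamma> = ?N"
  proof
    assume "is_frame (L2_space M) (L2_inner M) (exp_system \<delta>)"
    then obtain A where "0 < A" "\<forall>w. A * (norm w)\<^sup>2 \<le> (norm (\<Gamma> *v w))\<^sup>2"
      by (auto simp: is_frame_def frame_constants_def frame_lower)
    then show "rank \<Gamma> = ?N" by (rule lower_bound_imp_rank)
  next
    assume "rank \<Gamma> = ?N"
    then show "is_frame (L2_space M) (L2_inner M) (exp_system \<delta>)"
      using optimal_frame unfolding optimal_frame_constants_def is_frame_def by blast
  qed
  have rows_rank: "rank \<Gamma> = ?N \<longleftrightarrow> is_frame UNIV cvec_inner (\<lambda>j. row j \<Gamma>)"
  proof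
    assume "is_frame UNIV cvec_inner (\<lambda>j. row j \<Gamma>)"
    then obtain A where "0 < A" "\<forall>w. A * (norm w)\<^sup>2 \<le> (norm (\<Gamma> *v w))\<^sup>2"
      by (auto simp: is_frame_def frame_constants_def rows_frame_lower_bound_iff)
    then show "rank \<Gamma> = ?N" by (rule lower_bound_imp_rank)
  next
    assume "rank \<Gamma> = ?N"
    note pos = singular_values_full_column_rank[OF this]
    have "frame_constants UNIV cvec_inner (\<lambda>j. row j \<Gamma>) ((singular_value ?N \<Gamma>)\<^sup>2) ((singular_value 1 \<Gamma>)\<^sup>2)"
      unfolding frame_constants_def
      using pos by (simp add: rows_frame_lower_bound_iff rows_frame_upper_bound_iff
          singular_value_lower_bound_iff singular_value_upper_bound_iff less_imp_le)
    then show "is_frame UNIV cvec_inner (\<lambda>j. row j \<Gamma>)" unfolding is_frame_def by blast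
  qed
  have riesz_lower: "riesz_lower_bound M (exp_system \<delta>) A \<longleftrightarrow>
      (\<forall>h. A * (norm h)\<^sup>2 \<le> (norm (conj_transpose \<Gamma> *v h))\<^sup>2)" if "0 \<le> A" for A
    unfolding M_def \<Gamma>_def by (rule exp_system_riesz_lower_bound_iff[OF \<open>inj p\<close> that])
  have riesz_upper: "riesz_upper_bound M (exp_system \<delta>) B \<longleftrightarrow> (singular_value 1 \<Gamma>)\<^sup>2 \<le> B"
    if "0 \<le> B" for B
    unfolding M_def \<Gamma>_def exp_system_riesz_upper_bound_iff[OF \<open>inj p\<close> that]
    by (rule adjoint_upper_bound_iff)
  have optimal_riesz: "optimal_riesz_constants M (exp_system \<delta>)
      ((singular_value ?L \<Gamma>)\<^sup>2) ((singular_value 1 \<Gamma>)\<^sup>2)" if rank: "rank \<Gamma> = ?L"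
  proof -
    obtain h where h: "h \<noteq> 0" "norm (conj_transpose \<Gamma> *v h) = singular_value ?L \<Gamma> * norm h"
      and pos: "0 < singular_value ?L \<Gamma>"
      using singular_value_rank_rows[OF rank] by blast
    have "0 < singular_value ?L \<Gamma> * norm h" using pos h by simp
    also have "\<dots> \<le> singular_value 1 \<Gamma> * norm h" using h(2) norm_adjoint_le[of \<Gamma> h] by linarith
    finally have "0 < singular_value 1 \<Gamma>" using h(1) by (simp add: zero_less_mult_iff)
    then show ?thesis
      unfolding optimal_riesz_constants_def riesz_constants_def
      using range pos by (simp add: riesz_lower riesz_upper adjoint_lower_bound_iff[OF rank] less_imp_le)
  qed
  have riesz_rank: "is_riesz_sequence M (exp_system \<delta>) \<longleftrightarrow> rank \<Gamma> = ?L"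
  proof
    assume "is_riesz_sequence M (exp_system \<delta>)"
    then obtain A where "0 < A" "\<forall>h. A * (norm h)\<^sup>2 \<le> (norm (conj_transpose \<Gamma> *v h))\<^sup>2"
      by (auto simp: is_riesz_sequence_def riesz_constants_def riesz_lower)
    then show "rank \<Gamma> = ?L" by (rule adjoint_lower_bound_imp_rank)
  next
    assume "rank \<Gamma> = ?L"
    then show "is_riesz_sequence M (exp_system \<delta>)"
      using optimal_riesz unfolding optimal_riesz_constants_def is_riesz_sequence_def by blast
  qed
  show ?thesis
    unfolding Let_def M_def[symmetric] \<Gamma>_def[symmetric]
    using frame_rank rows_rank optimal_frame riesz_rank rank_eq_rows_iff[of \<Gamma>] optimal_riesz by blast
qed

end
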